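(* Let $p$ be a prime with $p\equiv 3\pmod 8$, let $s\ge 1$, $q=p^s$, and let $m\ge 3$ be an integer with $2^{m+1}\mid(q-1)$. Let $n\ge 1$ and let $N$ be the number of $(x_1,\dots,x_n)\in\mathbb F_q^n$ with $x_1^{2^m}+\dots+x_n^{2^m}=0$. For $r=2,3,\dots,m$ let $A_r,B_r$ be integers with $$p^{s/2^{r-2}}=A_r^2+2B_r^2,\qquad A_r\equiv -1\pmod 4,\qquad p\nmid A_r.$$ If $m=3$ then \begin{align*} N=\,&q^{n-1}+\frac{q-1}{8q}\Bigl[2\cdot\left((q^{\frac12}+4B_3q^{\frac14})^n+(q^{\frac12}-4B_3q^{\frac14})^n\right)+2q^{\frac n2}\\ &+\left(-3q^{\frac12}+4A_3q^{\frac14}\right)^n+\left(-3q^{\frac12}-4A_3q^{\frac14}\right)^n\Bigr]. \end{align*} If $m\ge 4$ then \begin{align*} N=\,&q^{n-1}+\frac{q-1}{2^mq}\cdot\Bigl[2^{m-2}\cdot\Bigl((q^{\frac12}+4B_3q^{\frac14})^n+(q^{\frac12}-4B_3q^{\frac14})^n\Bigr)\\ &+2^{m-3}\cdot\Bigl((q^{\frac12}+8B_4q^{\frac38})^n+(q^{\frac12}-8B_4q^{\frac38})^n\Bigr)\\ &+\sum_{t=2}^{m-3}2^{m-t-2}\Bigl((-3q^{\frac12}+\sum_{r=3}^t 2^{r-1}A_rq^{\frac{2^{r-2}-1}{2^{r-1}}}-2^t A_{t+1}q^{\frac{2^{t-1}-1}{2^t}}+2^{t+2} B_{t+3}q^{\frac{2^{t+1}-1}{2^{t+2}}})^n\\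 &\qquad+(-3q^{\frac12}+\sum_{r=3}^t 2^{r-1}A_rq^{\frac{2^{r-2}-1}{2^{r-1}}}-2^t A_{t+1}q^{\frac{2^{t-1}-1}{2^t}}-2^{t+2} B_{t+3}q^{\frac{2^{t+1}-1}{2^{t+2}}})^n\Bigr)\\ &+2\cdot\Bigl(-3q^{\frac 12}+\sum_{r=3}^{m-2} 2^{r-1}A_rq^{\frac{2^{r-2}-1}{2^{r-1}}}-2^{m-2} A_{m-1}q^{\frac{2^{m-3}-1}{2^{m-2}}}\Bigr)^n\\ &+\Bigl(-3q^{\frac 12}+\sum_{r=3}^{m-1}2^{r-1}A_r q^{\frac{2^{r-2}-1}{2^{r-1}}}-2^{m-1}A_m q^{\frac{2^{m-2}-1}{2^{m-1}}}\Bigr)^n\\ &+\Bigl(-3q^{\frac 12}+\sum_{r=3}^{m}2^{r-1}A_r q^{\frac{2^{r-2}-1}{2^{r-1}}}\Bigr)^n\Bigr]. \end{align*}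
   Context: Powers $q^{a}$ with rational $a$ denote positive real powers. Empty sums (e.g. $\sum_{t=2}^{1}$ or $\sum_{r=3}^{2}$) are zero. Under the hypotheses, $2^{r-2}\mid s$ for $r\le m$, so $p^{s/2^{r-2}}$ is an integer; the conditions determine $A_r$ uniquely and $B_r$ up to sign, and the formula holds for either choice of signs. *)

theory Defs
  imports "HOL-Library.FuncSet" "HOL-Number_Theory.Number_Theory"
begin

definition Ssum :: "real \<Rightarrow> (nat \<Rightarrow> int) \<Rightarrow> nat \<Rightarrow> real" where
  "Ssum Q A k = -3 * Q powr (1/2)
     + (\<Sum>r=3..k. 2^(r-1) * real_of_int (A r) * Q powr ((2^(r-2) - 1) / 2^(r-1)))"

end

theory Submission
  imports Defs "HOL-Algebra.Multiplicative_Group" "HOL-Computational_Algebra.Polynomial"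
begin

text \<open>
  Orthogonality of the additive characters \<open>x \<mapsto> psi (a * x)\<close> turns the number of solutions into
  the sum of the \<open>n\<close>-th powers of \<open>T a = (\<Sum>x. psi (a * x ^ 2^m))\<close>, and \<open>T a\<close> expands into Gauss sums of
  the characters of order \<open>2^r\<close> with \<open>1 \<le> r \<le> m\<close>. Since \<open>p \<equiv> 3 (mod 8)\<close>, invariance under the Frobenius
  map puts these Gauss sums \<open>G\<^sub>r\<close> into \<open>\<int>[\<surd>-2]\<close>. For orders 2 and 4 they equal \<open>-\<surd>q\<close>.

  The duplication formula gives \<open>G\<^sub>r\<^sub>+\<^sub>1\<^sup>2 = -\<surd>q G\<^sub>r\<close> for \<open>r \<ge> 3\<close>, and \<open>G\<^sub>3\<^sup>2 = -\<surd>q J\<close> for a Jacobi sum \<open>J\<close>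
  that is not divisible by \<open>p\<close>: its reduction modulo one prime above \<open>p\<close> is, up to sign, the binomial coefficient
  \<open>(q-1)/2\<close> over \<open>(q-1)/8\<close>, which is nonzero by Lucas. Extracting square roots in
  \<open>\<int>[\<surd>-2]\<close> yields the exact power of \<open>p\<close> in \<open>G\<^sub>r\<close>, and the cofactor is a primitive representation of a
  power of \<open>p\<close> by \<open>A\<^sup>2 + 2 B\<^sup>2\<close>, hence unique up to signs. The sign of \<open>A\<^sub>r\<close> comes from reading the
  same relation one step higher, where \<open>2^(m+1)\<close> dividing \<open>q - 1\<close> provides a character of
  order \<open>2^(r+1)\<close>.
\<close>

section \<open>Binomial coefficients and powers of p modulo powers of two\<close>

text \<open>For r \<ge> 3 the powers of \<open>p\<close> modulo 2^r are exactly the residues 1 and 3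
  modulo 8, so Frobenius acts on 2^r-th roots of unity with fixed field Q(sqrt(-2)), whatever r is.
  A Gauss sum also involves p-th roots of unity, which drop out only if the character is trivial on
  the prime field. As \<open>p - 1\<close> is twice an odd number, a character of two-power order is
  at most quadratic there, so squares of such characters are trivial. The characters of order up to
  2^m are such squares because \<open>2^(m+1)\<close> divides \<open>q - 1\<close>; at order 2^(m+1)
  itself triviality may fail, and both possibilities have to be followed. Extracting roots loses
  signs. They come back one level higher: minus the primitive cofactor of a Gauss sum is a square in
  \<open>\<int>[sqrt(-2)]\<close>, possibly after splitting off a factor of square
  \<open>-p\<close>, and this determines its real part modulo 4. Elements of that ring are complex
  numbers with explicit integer coordinates. Reduction modulo a prime above \<open>p\<close> amounts
  to evaluating the same integer coordinates in the finite field, with another root of X^4 + 1 in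
  place of \<open>omega\<close>.\<close>

lemma choose_add_prime_cong:
  fixes p n k :: nat
  assumes "prime p"
  shows "[(p + n) choose k = (n choose k) + (if k < p then 0 else n choose (k - p))] (mod p)"
proof -
  have "(p + n) choose k = (\<Sum>i\<le>k. (p choose i) * (n choose (k - i)))"
    by (rule vandermonde[symmetric])
  also have "[\<dots> = (\<Sum>i\<le>k. (if i = 0 then n choose k else 0) + (if i = p then n choose (k - p) else 0))] (mod p)"
  proof (rule cong_sum)
    fix i assume "i \<in> {..k}"
    consider "i = 0" | "i = p" | "i > p" | "0 < i" "i < p" by linarith
    then show "[(p choose i) * (n choose (k - i)) =
        (if i = 0 then n choose k else 0) + (if i = p then n choose (k - p) else 0)] (mod p)"
    proof cases
      case 4
      then have "p dvd (p choose i)" using assms by (intro dvd_choose_prime) auto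
      then show ?thesis using 4 by (auto simp: cong_0_iff)
    qed (use assms prime_gt_0_nat in \<open>auto simp: binomial_eq_0\<close>)
  qed
  also have "(\<Sum>i\<le>k. (if i = 0 then n choose k else 0) + (if i = p then n choose (k - p) else 0))
      = (n choose k) + (if k < p then 0 else n choose (k - p))"
    by (auto simp: sum.distrib)
  finally show ?thesis .
qed

text \<open>Modulo \<open>p\<close>, \<open>(1 + X)^(p * a + b)\<close> is
  \<open>(1 + X^p)^a * (1 + X)^b\<close>. Raising \<open>a\<close> by one adds \<open>p\<close> to
  the upper index, and the two surviving terms combine by Pascal's rule for \<open>a\<close> and
  \<open>c\<close>.\<close>

lemma lucas_step:
  fixes p a b c d :: nat
  assumes "prime p" "b < p" "d < p"
  shows "[(p * a + b) choose (p * c + d) = (a choose c) * (b choose d)] (mod p)"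
proof (induction a arbitrary: c)
  case 0
  show ?case
  proof (cases c)
    case (Suc c')
    then have "p * c + d > b" using assms by (simp add: trans_less_add1)
    then show ?thesis using Suc by (simp add: binomial_eq_0)
  qed auto
next
  case (Suc a)
  have eq: "p * Suc a + b = p + (p * a + b)" by simp
  show ?case
  proof (cases c)
    case 0
    show ?thesis unfolding eq
      using choose_add_prime_cong[OF assms(1), of "p*a+b" d] Suc[of 0] assms 0
      by (auto intro: cong_trans)
  next
    case (Suc c')
    have eq2: "p * c + d - p = p * c' + d" "\<not> p * c + d < p" using Suc by auto
    have "[(p + (p * a + b)) choose (p * c + d) =
        ((p*a+b) choose (p * c + d)) + ((p*a+b) choose (p * c' + d))] (mod p)"
      using choose_add_prime_cong[OF assms(1), of "p*a+b" "p*c+d"] eq2 by simp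
    also have "[((p*a+b) choose (p * c + d)) + ((p*a+b) choose (p * c' + d)) =
       (a choose c) * (b choose d) + (a choose c') * (b choose d)] (mod p)"
      by (intro cong_add Suc.IH)
    also have "(a choose c) * (b choose d) + (a choose c') * (b choose d) = (Suc a choose c) * (b choose d)"
      using Suc by (simp add: algebra_simps)
    finally show ?thesis unfolding eq .
  qed
qed

lemma prime_not_dvd_choose:
  fixes p n k :: nat
  assumes "prime p" "n < p" "k \<le> n"
  shows "\<not> p dvd (n choose k)"
proof
  assume "p dvd (n choose k)"
  then have "p dvd fact k * fact (n - k) * (n choose k)" by simp
  then have "p dvd fact n" using binomial_fact_lemma[OF assms(3)] by simp
  then show False using assms prime_dvd_fact_iff by auto
qed

lemma lucas_not_dvd:
  fixes p a b c d :: nat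
  assumes "prime p" "b < p" "d \<le> b" "\<not> p dvd (a choose c)"
  shows "\<not> p dvd ((p * a + b) choose (p * c + d))"
proof -
  have "\<not> p dvd (a choose c) * (b choose d)"
    using assms prime_not_dvd_choose[of p b d] by (auto simp: prime_dvd_mult_iff)
  then show ?thesis
    using lucas_step[of p b d a c] assms cong_dvd_iff by (metis order.strict_trans1)
qed

text \<open>With \<open>p = 8 * t + 3\<close> and positive exponent, the two lowest
  base-\<open>p\<close> digits of the lower index are \<open>3 * t + 1\<close> and \<open>t\<close>,
  while those of the upper index are both \<open>4 * t + 1\<close>. Every digit is dominated, so
  each induction step strips two digits. The second conjunct keeps the division by 8 exact.\<close>

lemma not_dvd_choose_half_eighth:
  fixes p :: nat
  assumes p: "prime p" and p8: "p mod 8 = 3"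
  shows "\<not> p dvd (((p^(2*k) - 1) div 2) choose ((p^(2*k) - 1) div 8))
     \<and> p^(2*k) mod 8 = 1"
proof (induction k)
  case 0
  show ?case using p by (auto simp: prime_nat_iff)
next
  case (Suc k)
  define t where "t = p div 8"
  have pt: "p = 8 * t + 3" using p8 t_def by presburger
  define X where "X = p^(2*k) div 8"
  have X: "p^(2*k) = 8 * X + 1" using Suc X_def by (metis mult_div_mod_eq)
  have "p^(2 * Suc k) = p * p * p^(2*k)" by (simp add: power_add)
  also have "\<dots> = 8 * (p * (p * X + t) + (3*t+1)) + 1"
    unfolding X by (simp add: pt algebra_simps)
  finally have e: "p^(2 * Suc k) = 8 * (p * (p * X + t) + (3*t+1)) + 1" .
  have e8: "(p^(2 * Suc k) - 1) div 8 = p * (p * X + t) + (3*t+1)" unfolding e by simp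
  have e2: "(p^(2 * Suc k) - 1) div 2 = p * (p * (4*X) + (4*t+1)) + (4*t+1)"
    unfolding e by (simp add: pt algebra_simps)
  have "\<not> p dvd ((4*X) choose X)" using Suc X by simp
  then have "\<not> p dvd ((p * (4*X) + (4*t+1)) choose (p * X + t))"
    using p by (rule_tac lucas_not_dvd) (auto simp: pt)
  then have "\<not> p dvd ((p * (p * (4*X) + (4*t+1)) + (4*t+1)) choose (p * (p * X + t) + (3*t+1)))"
    using p by (rule_tac lucas_not_dvd) (auto simp: pt)
  moreover have "p^(2 * Suc k) mod 8 = 1" unfolding e by presburger
  ultimately show ?case unfolding e8 e2 by blast
qed

text \<open>Squaring raises the 2-adic precision by one. The purpose: this power of Frobenius
  negates every root of unity of exact order \<open>2^(j+3)\<close>.\<close>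

lemma power_two_power_cong:
  fixes p j :: nat
  assumes "p mod 8 = 3" "j \<ge> 1"
  shows "[p ^ (2^j) = 1 + 2^(j+2)] (mod 2^(j+3))"
  using assms(2)
proof (induction j rule: dec_induct)
  case base
  have "p ^ 2 mod 16 = 9"
  proof -
    define k where "k = p div 8"
    have "p = 8 * k + 3" using assms k_def by presburger
    then have "p^2 = 16 * (4 * k^2 + 3 * k) + 9" by (simp add: power2_eq_square algebra_simps)
    then show ?thesis by presburger
  qed
  then show ?case by (simp add: cong_def)
next
  case (step j)
  have "int (p ^ (2^j)) mod 2^(j+3) = (1 + 2^(j+2)) mod 2^(j+3)"
    using step.IH by (metis cong_def cong_int_iff of_nat_1 of_nat_add of_nat_numeral of_nat_power)
  then obtain c :: int where c: "int (p ^ (2^j)) = 1 + 2^(j+2) + c * 2^(j+3)"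
    by (metis cong_iff_lin cong_def cong_sym mult.commute)
  have "int (p ^ (2^Suc j)) = (int (p ^ (2^j)))^2"
    by (simp add: power_mult[symmetric] mult.commute)
  also have "\<dots> = 1 + 2^(j+3) + 2^(j+4) * (2^j * (1 + 2 * c)^2 + c)"
    unfolding c by (simp add: power2_eq_square algebra_simps power_add)
  finally have "[int (p ^ (2^Suc j)) = int (1 + 2^(Suc j+2))] (mod int (2^(Suc j+3)))"
    by (simp add: cong_iff_dvd_diff numeral_eq_Suc)
  then show ?case by (metis cong_int_iff)
qed

text \<open>If \<open>s = 2^k * u\<close> with \<open>u\<close> odd, then \<open>p^s\<close> is
  \<open>1 + 2^(k+2)\<close> and not 1 modulo \<open>2^(k+3)\<close>. This makes the exponents of
  \<open>p\<close> obtained by repeated halving of \<open>s\<close> integral.\<close>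

lemma two_power_dvd_exponent:
  fixes p s k :: nat
  assumes "p mod 8 = 3" "k \<ge> 1" "2^(k+2) dvd p^s - 1" "s \<ge> 1"
  shows "2^k dvd s"
  using assms(2,3)
proof (induction k rule: dec_induct)
  case base
  have p1: "p \<ge> 1" using assms(1) by (cases p) auto
  have c: "[p^s = 1] (mod 8)" using base p1 cong_altdef_nat[of 1 "p^s" 8] by simp
  show ?case
  proof (rule ccontr)
    assume "\<not> 2 ^ 1 dvd s"
    then obtain l where l: "s = 2 * l + 1" by (auto elim: oddE)
    have "[p = 3] (mod 8)" using assms by (simp add: cong_def)
    then have "[p * (p^2)^l = 3 * (3^2)^l] (mod 8)" by (intro cong_mult cong_pow)
    moreover have "[3 * (3^2)^l = 3 * (1::nat)^l] (mod 8)" by (intro cong_mult cong_pow cong_refl) (simp add: cong_def)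
    ultimately have "[p^s = 3] (mod 8)" unfolding l
      by (metis cong_trans mult.commute mult.right_neutral power_add power_mult power_one power_one_right)
    then show False using c by (simp add: cong_def)
  qed
next
  case (step k)
  have p1: "p \<ge> 1" using assms(1) by (cases p) auto
  have "(2::nat)^(k+2) dvd 2^(Suc k+2)" by (intro le_imp_power_dvd) auto
  then have "2^k dvd s" using step dvd_trans by blast
  then obtain u where u: "s = 2^k * u" by auto
  have c1: "[p^s = 1] (mod 2^(k+3))" using step(4) p1
    by (metis add_Suc_shift cong_altdef_nat cong_sym numeral_2_eq_2 numeral_3_eq_3 one_le_power)
  show ?case
  proof (cases "even u")
    case True
    then show ?thesis using u by auto
  next
    case False
    then obtain v where v: "u = 2*v+1" by (auto elim: oddE)
    have a: "[p^(2^k) = 1 + 2^(k+2)] (mod 2^(k+3))" using power_two_power_cong assms(1) step by auto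
    have b: "[(1 + 2^(k+2))^2 = (1::nat)] (mod 2^(k+3))"
    proof -
      have "(1 + 2^(k+2))^2 = 2^(k+3) * (1 + 2^(k+1)) + (1::nat)"
        by (simp add: power2_eq_square algebra_simps power_add)
      moreover have "[2^(k+3) * (1 + 2^(k+1)) + 1 = 0 + (1::nat)] (mod 2^(k+3))"
        by (intro cong_add cong_refl) (simp add: cong_0_iff)
      ultimately show ?thesis by simp
    qed
    have "[p^s = (1 + 2^(k+2)) ^ u] (mod 2^(k+3))"
      unfolding u power_mult by (intro cong_pow a)
    also have "((1 + 2^(k+2)) ^ u :: nat) = (1 + 2^(k+2)) * ((1 + 2^(k+2))^2)^v"
      unfolding v power_add[of _ "2*v"] power_mult power_one_right by (rule mult.commute)
    also have "[(1 + 2^(k+2)) * ((1 + 2^(k+2) :: nat)^2)^v = (1 + 2^(k+2)) * 1 ^ v] (mod 2^(k+3))"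
      by (intro cong_mult cong_pow cong_refl b)
    finally have "[1 = 1 + (2::nat)^(k+2)] (mod 2^(k+3))" using c1 by (simp add: cong_def)
    then have "(2::nat)^(k+3) dvd 2^(k+2)"
      by (metis add_diff_cancel_left' cong_altdef_nat' cong_sym le_add1 cong_altdef_nat)
    then have "k + 3 \<le> k + 2" by (rule power_dvd_imp_le) simp
    then show ?thesis by simp
  qed
qed

section \<open>The ring of integers with the square root of -2 adjoined\<close>

text \<open>\<open>zs a b\<close> is \<open>a + b \<surd>-2\<close>.\<close>

definition zs :: "int \<Rightarrow> int \<Rightarrow> complex" where
  "zs a b = Complex (of_int a) (of_int b * sqrt 2)"

lemma zs_eq_iff: "zs a b = zs c d \<longleftrightarrow> a = c \<and> b = d"
  by (auto simp: zs_def)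

lemma zs_uminus: "- zs a b = zs (-a) (-b)"
  by (simp add: zs_def complex_eq_iff)

lemma zs_mult: "zs a b * zs c d = zs (a * c - 2 * b * d) (a * d + b * c)"
  by (simp add: zs_def complex_eq_iff algebra_simps)

lemma zs_scale: "of_int n * zs a b = zs (n * a) (n * b)"
  by (simp add: zs_def complex_eq_iff)

lemma zs_cnj: "cnj (zs a b) = zs a (-b)"
  by (simp add: zs_def complex_eq_iff)

lemma zs_of_int: "of_int n = zs n 0"
  by (simp add: zs_def complex_eq_iff)

lemma zs_mult_cnj: "zs a b * cnj (zs a b) = of_int (a^2 + 2 * b^2)"
  by (simp add: zs_cnj zs_mult zs_of_int zs_eq_iff power2_eq_square)

lemma odd_prime_not_dvd_2:
  fixes p :: int
  assumes "prime p" "odd p"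
  shows "\<not> p dvd 2"
proof
  assume "p dvd 2"
  moreover have "prime (2::int)" by simp
  ultimately have "p = 2" using primes_dvd_imp_eq assms(1) by blast
  then show False using assms(2) by simp
qed

text \<open>An odd prime does not ramify in \<open>\<int>[sqrt(-2)]\<close>, so if it divides the
  square of \<open>a + b * sqrt(-2)\<close> it divides both coordinates. Removing it from the root
  lowers \<open>j\<close> by 2; \<open>j = 1\<close> would make \<open>p\<close> divide both
  \<open>c\<close> and \<open>d\<close>.\<close>

lemma zs_square_prime_power:
  fixes p :: int
  assumes p: "prime p" "odd p"
    and "a^2 - 2 * b^2 = p^j * c" "2 * a * b = p^j * d" "\<not> (p dvd c \<and> p dvd d)"
  shows "even j \<and> (\<exists>a' b'. a = p^(j div 2) * a' \<and> b = p^(j div 2) * b'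
     \<and> a'^2 - 2 * b'^2 = c \<and> 2 * a' * b' = d)"
  using assms(3,4)
proof (induction j arbitrary: a b rule: less_induct)
  case (less j)
  have p2: "\<not> p dvd 2" by (rule odd_prime_not_dvd_2[OF p])
  have p0: "p \<noteq> 0" using p by auto
  show ?case
  proof (cases "j = 0")
    case True
    then show ?thesis using less.prems by auto
  next
    case False
    then have j: "p dvd p^j" by simp
    have "p dvd 2 * a * b" using less.prems j by simp
    then have "p dvd a \<or> p dvd b" using p p2 by (simp add: prime_dvd_mult_iff)
    moreover have d: "p dvd a^2 - 2 * b^2" using less.prems j by simp
    have "p dvd a \<longleftrightarrow> p dvd b"
    proof
      assume "p dvd a"
      then have "p dvd a^2" by (simp add: power2_eq_square)
      then have "p dvd 2 * b^2" using d by (metis diff_diff_eq2 dvd_diff add_diff_cancel_left' cancel_comm_monoid_add_class.diff_cancel diff_add_cancel)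
      then show "p dvd b" using p p2 by (simp add: prime_dvd_mult_iff prime_dvd_power_iff)
    next
      assume "p dvd b"
      then have "p dvd 2 * b^2" by (simp add: power2_eq_square)
      then have "p dvd a^2" using d by (metis diff_add_cancel dvd_add)
      then show "p dvd a" using p by (simp add: prime_dvd_power_iff)
    qed
    ultimately have "p dvd a" "p dvd b" by auto
    then obtain x y where xy: "a = p * x" "b = p * y" by (auto elim!: dvdE)
    have 1: "p * (p * (x^2 - 2 * y^2)) = p * (p^(j-1) * c)" "p * (p * (2 * x * y)) = p * (p^(j-1) * d)"
      using less.prems False unfolding xy by (cases j; simp add: power2_eq_square algebra_simps)+
    then have 2: "p * (x^2 - 2 * y^2) = p^(j-1) * c" "p * (2 * x * y) = p^(j-1) * d"
      using p0 by auto
    have "j \<noteq> 1" using 2 assms(5) by (metis dvd_triv_left diff_self_eq_0 mult_1 power_0)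
    then obtain i where i: "j = Suc (Suc i)" using False by (metis One_nat_def not0_implies_Suc)
    have "p * (x^2 - 2 * y^2) = p * (p^i * c)" "p * (2 * x * y) = p * (p^i * d)"
      using 2 i by auto
    then have "x^2 - 2 * y^2 = p^i * c" "2 * x * y = p^i * d" using p0 by auto
    from less.IH[OF _ this] i
    show ?thesis by (auto simp: xy)
  qed
qed

text \<open>\<open>p^k\<close> divides \<open>(a * d - b * c) * (a * d + b * c)\<close>, but
  \<open>p\<close> cannot divide both factors, so one factor takes all of \<open>p^k\<close>. The
  composition identity for the form then forces this factor to vanish by size.\<close>

lemma prime_power_form_unique:
  fixes p a b c d :: int
  assumes p: "prime p" "odd p" and ab: "a^2 + 2 * b^2 = p^k" and cd: "c^2 + 2 * d^2 = p^k"
    and na: "\<not> p dvd a" "\<not> p dvd c"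
  shows "\<bar>a\<bar> = \<bar>c\<bar> \<and> \<bar>b\<bar> = \<bar>d\<bar>"
proof -
  define P where "P = p^k"
  have P0: "P > 0" using p prime_gt_0_int by (simp add: P_def)
  have p2: "\<not> p dvd 2" by (rule odd_prime_not_dvd_2[OF p])
  have abc: "\<bar>a\<bar> = \<bar>c\<bar> \<and> \<bar>b\<bar> = \<bar>d\<bar>" if "p^k dvd a * d - b * c" "c^2 + 2 * d^2 = p^k" for c d
  proof -
    define X where "X = a * d - b * c"
    have cop: "(a * c + 2 * b * d)^2 + 2 * X^2 = P^2"
    proof -
      have "(a * c + 2 * b * d)^2 + 2 * X^2 = (a^2 + 2 * b^2) * (c^2 + 2 * d^2)"
        by (simp add: X_def power2_eq_square algebra_simps)
      then show ?thesis using ab that by (simp add: P_def power2_eq_square)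
    qed
    have "X = 0"
    proof (rule ccontr)
      assume "X \<noteq> 0"
      then have "P \<le> \<bar>X\<bar>" using that(1) P0 unfolding P_def[symmetric] X_def[symmetric]
        by (metis dvd_imp_le_int abs_of_pos)
      then have "P^2 \<le> X^2" using P0 by (metis abs_le_square_iff abs_of_pos)
      then have "2 * P^2 \<le> P^2" using cop by (smt (verit) zero_le_power2)
      then show False using P0 by simp
    qed
    then have ad: "a * d = b * c" by (simp add: X_def)
    have "a^2 * P = a^2 * c^2 + 2 * (a * d)^2" using that(2) P_def by (simp add: power_mult_distrib algebra_simps flip: that(2))
    also have "\<dots> = c^2 * P" using ab P_def unfolding ad by (simp add: power_mult_distrib algebra_simps flip: ab)
    finally have "a^2 = c^2" using P0 by simp
    moreover have "b^2 = d^2" using ab that(2) \<open>a^2 = c^2\<close> by simp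
    ultimately show ?thesis by (simp add: power2_eq_iff abs_eq_iff)
  qed
  have "(a * d - b * c) * (a * d + b * c) = a^2 * d^2 - b^2 * c^2"
    by (simp add: power2_eq_square algebra_simps)
  also have "\<dots> = (P - 2 * b^2) * d^2 - b^2 * (P - 2 * d^2)" using ab cd by (metis P_def add_diff_cancel_right')
  also have "\<dots> = P * (d^2 - b^2)" by (simp add: algebra_simps)
  finally have dv: "p^k dvd (a * d - b * c) * (a * d + b * c)" by (simp add: P_def)
  show ?thesis
  proof (cases "k = 0")
    \<comment> \<open>For exponent 0 the prime need not divide the norm; size alone settles this
      case.\<close>
    case True
    have z: "y = 0" "x^2 = 1" if "x^2 + 2 * y^2 = (1::int)" for x y
    proof -
      show "y = 0" using that by (smt (verit) zero_le_power2 zero_less_power2)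
      then show "x^2 = 1" using that by simp
    qed
    show ?thesis using z[of a b] z[of c d] ab cd True by (auto simp: power2_eq_1_iff)
  next
    case False
    have "\<not> p dvd d"
    proof
      assume "p dvd d"
      then have "p dvd 2 * d^2" by (simp add: power2_eq_square)
      moreover have "p dvd p^k" using False by simp
      ultimately have "p dvd c^2" using cd by (metis dvd_add_left_iff)
      then show False using na p by (simp add: prime_dvd_power_iff)
    qed
    then have "\<not> p dvd 2 * (a * d)" using p p2 na by (simp add: prime_dvd_mult_iff)
    moreover have "2 * (a * d) = (a * d - b * c) + (a * d + b * c)" by simp
    ultimately have "\<not> p dvd (a * d - b * c) \<or> \<not> p dvd (a * d + b * c)" by (metis dvd_add)
    then show ?thesis
    proof
      assume "\<not> p dvd (a * d - b * c)"
      then have "coprime (p^k) (a * d - b * c)" using p by (simp add: prime_imp_coprime)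
      then have "p^k dvd a * d - b * (- c)" using dv by (simp add: coprime_dvd_mult_right_iff)
      then show ?thesis using abc[of d "-c"] cd by auto
    next
      assume "\<not> p dvd (a * d + b * c)"
      then have "coprime (p^k) (a * d + b * c)" using p by (simp add: prime_imp_coprime)
      then have "p^k dvd a * d - b * c" using dv by (simp add: coprime_dvd_mult_left_iff)
      then show ?thesis using abc[of d c] cd by auto
    qed
  qed
qed

section \<open>Finite fields, trace and additive characters\<close>

text \<open>The type becomes the carrier of an explicit ring record, to which the cyclicity of the
  multiplicative group of a finite field applies.\<close>

lemma finite_field_generator:
  "\<exists>g::'a::{field,finite}. g \<noteq> 0 \<and> (\<forall>x. x \<noteq> 0 \<longrightarrow> (\<exists>i::nat. x = g ^ i))"
proof -
  define R where "R = \<lparr>carrier = (UNIV :: 'a set), monoid.mult = (*), one = (1::'a), ring.zero = (0::'a), add = (+)\<rparr>"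
  have "\<exists>y. y + x = 0" "\<exists>y. x + y = 0" for x :: 'a
    by (auto intro: exI[of _ "-x"])
  then have "cring R"
    by unfold_locales (auto simp: R_def Units_def algebra_simps)
  then interpret R: cring R .
  interpret R: Ring.field R
  proof (rule R.cring_fieldI)
    have "\<exists>y. y * x = 1 \<and> x * y = 1" if "x \<noteq> 0" for x :: 'a
      using that by (intro exI[of _ "inverse x"]) auto
    then show "Units R = carrier R - {\<zero>\<^bsub>R\<^esub>}"
      by (auto simp: R_def Units_def)
  qed
  have pow: "a [^]\<^bsub>R\<^esub> i = a ^ i" for a :: 'a and i :: nat
    by (induction i) (simp_all add: R_def nat_pow_def)
  from R.finite_field_mult_group_has_gen obtain a where a: "a \<in> carrier (mult_of R)"
    "carrier (mult_of R) = {a[^]\<^bsub>R\<^esub>i | i::nat . i \<in> UNIV}"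
    by (auto simp: R_def)
  have car: "carrier (mult_of R) = UNIV - {0}"
    by (simp add: R_def)
  have "x \<noteq> 0 \<longrightarrow> (\<exists>i::nat. x = a ^ i)" for x
    using a(2) unfolding car pow by auto
  moreover have "a \<noteq> 0" using a(1) unfolding car by simp
  ultimately show ?thesis by blast
qed

lemma sum_roots_of_unity:
  fixes z :: complex
  assumes "z ^ n = 1"
  shows "(\<Sum>k<n. z ^ k) = (if z = 1 then of_nat n else 0)"
  using assms geometric_sum[of z n] by auto

lemma prime_char_power_add:
  fixes x y :: "'a::comm_ring_1"
  assumes "prime p" "of_nat p = (0::'a)"
  shows "(x + y) ^ p = x ^ p + y ^ p"
proof -
  have "(x + y) ^ p = (\<Sum>k\<le>p. of_nat (p choose k) * x ^ k * y ^ (p - k))"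
    by (rule binomial_ring)
  also have "\<dots> = (\<Sum>k\<le>p. (if k = 0 then y ^ p else 0) + (if k = p then x ^ p else 0))"
  proof (rule sum.cong[OF refl])
    fix k assume "k \<in> {..p}"
    then consider "k = 0" | "k = p" | "0 < k" "k < p" by force
    then show "of_nat (p choose k) * x ^ k * y ^ (p - k) = (if k = 0 then y ^ p else 0) + (if k = p then x ^ p else 0)"
    proof cases
      case 3
      then have "p dvd (p choose k)" using assms by (intro dvd_choose_prime) auto
      then have "of_nat (p choose k) = (0::'a)" using assms by (auto elim!: dvdE)
      then show ?thesis using 3 by simp
    qed (use assms prime_gt_0_nat[of p] in auto)
  qed
  also have "\<dots> = x ^ p + y ^ p" by (simp add: sum.distrib)
  finally show ?thesis .
qed

lemma cis_cong:
  assumes "[i = j] (mod n)" "n > 0"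
  shows "cis (2 * pi * real i / real n) = cis (2 * pi * real j / real n)"
proof -
  have "cis (2 * pi * real i / real n) = cis (2 * pi * real (i mod n) / real n)" for i
  proof -
    have "real i = real n * real (i div n) + real (i mod n)"
      by (metis mult_div_mod_eq of_nat_add of_nat_mult)
    then have "2 * pi * real i / real n = 2 * pi * real (i div n) + 2 * pi * real (i mod n) / real n"
      using assms by (simp add: field_simps)
    then have "cis (2 * pi * real i / real n) = cis (2 * pi * real (i div n)) * cis (2 * pi * real (i mod n) / real n)"
      by (simp only: cis_mult)
    moreover have "cis (2 * pi * real (i div n)) = 1"
      using cis_multiple_2pi[of "real (i div n)"] by simp
    ultimately show ?thesis by simp
  qed
  then show ?thesis using assms by (metis cong_def)
qed

locale prime_power_field =
  fixes p s :: nat and g :: "'a::{field,finite}"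
  assumes p: "prime p" and s: "s \<ge> 1" and card_field: "card (UNIV :: 'a set) = p ^ s"
    and g_nonzero: "g \<noteq> 0" and g_gen: "\<And>x. x \<noteq> 0 \<Longrightarrow> \<exists>i::nat. x = g ^ i"
begin

definition q :: nat where "q = p ^ s"

lemma q_gt_1: "q > 1"
  unfolding q_def using p s by (metis less_le_trans one_less_power prime_gt_1_nat zero_less_one)

lemma card_q: "card (UNIV :: 'a set) = q" using card_field q_def by simp

lemma power_q_minus_1: "x \<noteq> 0 \<Longrightarrow> x ^ (q - 1) = (1::'a)"
proof -
  assume x: "x \<noteq> 0"
  have "(\<Prod>y\<in>UNIV-{0}. x * y) = x ^ (q - 1) * \<Prod>(UNIV-{0})"
    by (simp add: prod.distrib card_q)
  moreover have "(\<Prod>y\<in>UNIV-{0}. x * y) = (\<Prod>y\<in>UNIV-{0}. y)"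
    by (rule prod.reindex_bij_witness[of _ "\<lambda>y. y / x" "\<lambda>y. x * y"]) (use x in auto)
  ultimately show ?thesis by simp
qed

lemma power_q: "x ^ q = (x::'a)"
proof (cases "x = 0")
  case False
  have "x ^ q = x ^ (q - 1) * x" using q_gt_1 by (metis Suc_diff_1 mult.commute order_less_trans power_Suc zero_less_one)
  then show ?thesis using power_q_minus_1[OF False] by simp
qed (use q_gt_1 in auto)

lemma g_power_mod: "g ^ i = g ^ (i mod (q - 1))"
proof -
  have "g ^ i = g ^ ((q - 1) * (i div (q - 1)) + i mod (q - 1))" by simp
  then show ?thesis unfolding power_add power_mult power_q_minus_1[OF g_nonzero] by simp
qed

lemma bij_g: "bij_betw (\<lambda>i. g ^ i) {..<q - 1} (UNIV - {0})"
proof -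
  have "(\<lambda>i. g ^ i) ` {..<q - 1} = UNIV - {0}"
  proof
    show "UNIV - {0} \<subseteq> (\<lambda>i. g ^ i) ` {..<q - 1}"
    proof
      fix x :: 'a assume "x \<in> UNIV - {0}"
      then obtain i where "x = g ^ i" using g_gen by auto
      then have "x = g ^ (i mod (q - 1))" using g_power_mod by simp
      then show "x \<in> (\<lambda>i. g ^ i) ` {..<q - 1}" using q_gt_1 by auto
    qed
  qed (use g_nonzero in auto)
  moreover then have "inj_on (\<lambda>i. g ^ i) {..<q - 1}"
    by (intro eq_card_imp_inj_on) (auto simp: card_q)
  ultimately show ?thesis by (simp add: bij_betw_def)
qed

definition ind :: "'a \<Rightarrow> nat" where "ind x = inv_into {..<q - 1} (\<lambda>i. g ^ i) x"

lemma g_ind: "x \<noteq> 0 \<Longrightarrow> g ^ ind x = x"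
  unfolding ind_def using bij_g by (intro f_inv_into_f) (auto simp: bij_betw_def)

lemma ind_g: "ind (g ^ i) = i mod (q - 1)"
proof -
  have "ind (g ^ (i mod (q - 1))) = i mod (q - 1)"
    unfolding ind_def using bij_g q_gt_1 by (intro inv_into_f_f) (auto simp: bij_betw_def)
  then show ?thesis using g_power_mod by simp
qed

lemma sum_units: "(\<Sum>x\<in>UNIV - {0}. f x) = (\<Sum>i<q - 1. f (g ^ i))"
  using sum.reindex_bij_betw[OF bij_g, of f] by simp

lemma of_nat_p: "of_nat p = (0::'a)"
proof -
  have "CHAR('a) dvd p ^ s" using CHAR_dvd_CARD[where 'a = 'a] card_field by simp
  moreover have "prime CHAR('a)" by (intro prime_CHAR_semidom finite_imp_CHAR_pos finite)
  ultimately have "CHAR('a) = p" using p prime_dvd_power primes_dvd_imp_eq by blast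
  then show ?thesis using of_nat_CHAR by metis
qed

lemma of_nat_eq_0_iff: "of_nat n = (0::'a) \<longleftrightarrow> p dvd n"
proof
  assume n: "of_nat n = (0::'a)"
  show "p dvd n"
  proof (rule ccontr)
    assume "\<not> p dvd n"
    then have "coprime n p" using p prime_imp_coprime coprime_commute by blast
    then obtain x where "[n * x = 1] (mod p)" using cong_solve_coprime_nat by auto
    then have "1 mod p = (n * x) mod p" by (simp add: cong_def)
    then have "1 = (n * x) mod p" using prime_gt_1_nat[OF p] by simp
    then have "n * x = p * ((n * x) div p) + 1" by (metis mult_div_mod_eq)
    then have "of_nat (n * x) = (of_nat (p * ((n * x) div p) + 1) :: 'a)" by metis
    then show False using n of_nat_p by simp
  qed
qed (use of_nat_p in \<open>auto elim!: dvdE\<close>)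

lemma of_int_eq_0_iff: "of_int n = (0::'a) \<longleftrightarrow> int p dvd n"
  by (cases n rule: int_cases2) (simp_all add: of_nat_eq_0_iff)

lemma frob_add: "(x + y) ^ (p ^ i) = x ^ (p ^ i) + (y ^ (p ^ i) :: 'a)"
proof (induction i)
  case (Suc i)
  have "(x + y) ^ (p ^ Suc i) = ((x + y) ^ (p ^ i)) ^ p" by (simp add: mult.commute flip: power_mult)
  also have "\<dots> = x ^ (p ^ Suc i) + y ^ (p ^ Suc i)"
    unfolding Suc prime_char_power_add[OF p of_nat_p] by (simp add: mult.commute flip: power_mult)
  finally show ?case .
qed simp

lemma frob_sum: "(\<Sum>x\<in>A. f x) ^ p = (\<Sum>x\<in>A. f x ^ p :: 'a)"
proof (induction A rule: infinite_finite_induct)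
  case (insert x F)
  then show ?case using frob_add[of _ _ 1] by simp
qed (use p prime_gt_0_nat in auto)

lemma frob_bij: "bij (\<lambda>x::'a. x ^ p)"
proof -
  have "surj (\<lambda>x::'a. x ^ p)"
  proof (rule surjI)
    fix x :: 'a
    have "(x ^ (p ^ (s - 1))) ^ p = x ^ q"
      using s by (simp add: q_def mult.commute flip: power_mult power_Suc)
    then show "(x ^ (p ^ (s - 1))) ^ p = x" using power_q by simp
  qed
  then show ?thesis using finite_UNIV_surj_inj[of "\<lambda>x::'a. x ^ p"] by (simp add: bij_def)
qed

lemma frob_reindex: "(\<Sum>x\<in>UNIV. f (x ^ p)) = (\<Sum>x\<in>UNIV. f (x::'a))"
  using sum.reindex_bij_betw[OF frob_bij] by auto

section \<open>Prime field, absolute trace and additive character\<close>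

definition fp :: "'a set" where "fp = {x. x ^ p = x}"

text \<open>The polynomial \<open>X^p - X\<close> has at most \<open>p\<close> roots, and the
  \<open>p\<close> distinct multiples of 1 are already roots.\<close>

lemma fp_eq: "fp = of_nat ` {..<p}"
proof -
  have inj: "inj_on (of_nat :: nat \<Rightarrow> 'a) {..<p}"
  proof (rule inj_onI)
    fix x y assume xy: "x \<in> {..<p}" "y \<in> {..<p}" "of_nat x = (of_nat y :: 'a)"
    have "x = y" if "x \<le> y" "y < p" "of_nat x = (of_nat y :: 'a)" for x y
    proof -
      have "of_nat (y - x) = (0::'a)" using that by (simp add: of_nat_diff)
      then have "p dvd y - x" using of_nat_eq_0_iff by simp
      then show ?thesis using that by (metis diff_is_0_eq' dvd_imp_le le_antisym less_imp_diff_less not_le zero_less_diff)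
    qed
    then show "x = y" using xy by (metis lessThan_iff nle_le)
  qed
  have sub: "of_nat ` {..<p} \<subseteq> fp"
  proof
    fix x :: 'a assume "x \<in> of_nat ` {..<p}"
    then obtain k where k: "x = of_nat k" by auto
    have "(of_nat k :: 'a) ^ p = of_nat k"
    proof (induction k)
      case 0
      then show ?case using p prime_gt_0_nat by auto
    next
      case (Suc k)
      then show ?case using frob_add[of 1 "of_nat k" 1] by simp
    qed
    then show "x \<in> fp" by (simp add: fp_def k)
  qed
  define P :: "'a poly" where "P = monom 1 p - monom 1 1"
  have p1: "p > 1" using p prime_gt_1_nat by auto
  have cP: "coeff P p = 1" using p1 by (simp add: P_def)
  then have P0: "P \<noteq> 0" by auto
  have "degree P \<le> p" unfolding P_def using p1
    by (intro degree_diff_le) (auto intro: order_trans[OF degree_monom_le])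
  moreover have "fp = {x. poly P x = 0}" by (auto simp: fp_def P_def poly_monom)
  ultimately have "card fp \<le> p" using card_poly_roots_bound[OF P0] by simp
  then have "card fp \<le> card ((of_nat :: nat \<Rightarrow> 'a) ` {..<p})" using card_image[OF inj] by simp
  then show ?thesis using sub by (metis card_seteq finite)
qed

lemma of_nat_fp: "of_nat k \<in> fp"
proof -
  have "of_nat k = (of_nat (k mod p) :: 'a)"
  proof -
    have "(of_nat k :: 'a) = of_nat (p * (k div p) + k mod p)" by simp
    then show ?thesis unfolding of_nat_add of_nat_mult of_nat_p by simp
  qed
  then show ?thesis using p prime_gt_0_nat by (auto simp: fp_eq)
qed

lemma fp_mult: "x \<in> fp \<Longrightarrow> y \<in> fp \<Longrightarrow> x * y \<in> fp" by (simp add: fp_def power_mult_distrib)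

lemma fp_inverse: "x \<in> fp \<Longrightarrow> inverse x \<in> fp" by (simp add: fp_def power_inverse)

lemma fp_0: "0 \<in> fp" using of_nat_fp[of 0] by simp

lemma fp_1: "1 \<in> fp" using of_nat_fp[of 1] by simp

lemma fp_uminus: "x \<in> fp \<Longrightarrow> - x \<in> fp"
proof -
  assume "x \<in> fp"
  moreover have "-1 \<in> fp"
  proof -
    have "(of_nat (p - 1) :: 'a) = of_nat p - 1" using of_nat_diff[of 1 p] prime_gt_0_nat[OF p] by simp
    then show ?thesis using of_nat_fp[of "p-1"] of_nat_p by simp
  qed
  ultimately show ?thesis using fp_mult[of "-1" x] by simp
qed

lemma fp_power: "x \<in> fp \<Longrightarrow> x ^ (p ^ i) = x"
  by (induction i) (auto simp: fp_def power_mult)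

definition tr :: "'a \<Rightarrow> 'a" where "tr x = (\<Sum>i<s. x ^ (p ^ i))"

lemma tr_add: "tr (x + y) = tr x + tr y"
  by (simp add: tr_def frob_add sum.distrib)

lemma tr_scale: "c \<in> fp \<Longrightarrow> tr (c * x) = c * tr x"
  by (simp add: tr_def power_mult_distrib fp_power sum_distrib_left)

text \<open>Since \<open>x^q = x\<close>, Frobenius permutes the conjugates cyclically. Invariance
  in the argument and membership of the value in \<open>fp\<close> both reduce to this shifted
  sum.\<close>

lemma tr_frob_aux: "(\<Sum>i<s. x ^ (p ^ Suc i)) = tr x"
proof -
  have "(\<Sum>i<s. x ^ (p ^ Suc i)) + x ^ (p ^ 0) = (\<Sum>i<Suc s. x ^ (p ^ i))"
    by (simp only: sum.lessThan_Suc_shift add.commute)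
  also have "\<dots> = tr x + x ^ q" by (simp add: tr_def q_def)
  finally show ?thesis using power_q by simp
qed

lemma tr_frob: "tr (x ^ p) = tr x"
  using tr_frob_aux[of x] by (simp add: tr_def flip: power_mult)

lemma tr_fp: "tr x \<in> fp"
  using tr_frob_aux[of x] unfolding fp_def
  by (simp add: tr_def frob_sum mult.commute flip: power_mult)

text \<open>As a polynomial the trace has degree at most \<open>p^(s-1)\<close>, too small to vanish
  at all \<open>q\<close> elements.\<close>

lemma tr_nonzero: "\<exists>x. tr x \<noteq> 0"
proof (rule ccontr)
  assume "\<not> ?thesis"
  then have z: "\<And>x. tr x = 0" by blast
  define P :: "'a poly" where "P = (\<Sum>i<s. monom 1 (p ^ i))"
  have p1: "p > 1" using p prime_gt_1_nat by auto
  have "coeff P (p ^ (s - 1)) = (\<Sum>i<s. if i = s - 1 then 1 else 0)"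
    unfolding P_def coeff_sum using p1 by (intro sum.cong refl) (auto simp: coeff_monom)
  also have "\<dots> = 1" using s by simp
  finally have "P \<noteq> 0" by auto
  moreover have "{x. poly P x = 0} = UNIV" using z by (simp add: P_def poly_sum poly_monom tr_def)
  ultimately have "q \<le> degree P" using card_poly_roots_bound[of P] card_q by simp
  also have "degree P \<le> p ^ (s - 1)" unfolding P_def
    by (intro degree_sum_le) (use p1 in \<open>auto intro!: order_trans[OF degree_monom_le] power_increasing\<close>)
  also have "\<dots> < q" unfolding q_def using p1 s by (intro power_strict_increasing) auto
  finally show False by simp
qed

text \<open>Only meaningful on the prime field \<open>fp\<close>; elsewhere the predicate under \<open>LEAST\<close> is empty.\<close>

definition e :: "'a \<Rightarrow> complex" where
  "e t = cis (2 * pi * real (LEAST k. of_nat k = t) / real p)"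

lemma of_nat_eq_cong: "of_nat i = (of_nat j :: 'a) \<Longrightarrow> [i = j] (mod p)"
proof (induction i j rule: linorder_wlog)
  case (le i j)
  then have "of_nat (j - i) = (0::'a)" by (simp add: of_nat_diff)
  then have "p dvd j - i" using of_nat_eq_0_iff by simp
  then show ?case using le by (metis cong_altdef_nat cong_sym)
next
  case (sym i j)
  then show ?case using cong_sym by metis
qed

lemma e_of_nat: "e (of_nat k) = cis (2 * pi * real k / real p)"
proof -
  have "of_nat (LEAST i. of_nat i = (of_nat k :: 'a)) = (of_nat k :: 'a)"
    by (rule LeastI) (rule refl)
  then show ?thesis unfolding e_def
    by (intro cis_cong of_nat_eq_cong) (use p prime_gt_0_nat in auto)
qed

lemma e_add: "x \<in> fp \<Longrightarrow> y \<in> fp \<Longrightarrow> e (x + y) = e x * e y"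
proof -
  assume "x \<in> fp" "y \<in> fp"
  then obtain i j where ij: "x = of_nat i" "y = of_nat j" by (auto simp: fp_eq)
  have "e (x + y) = e (of_nat (i + j))" using ij by simp
  then show ?thesis unfolding ij e_of_nat by (simp add: cis_mult add_divide_distrib distrib_left)
qed

lemma e_0: "e 0 = 1" using e_of_nat[of 0] by simp

lemma e_1: "e 1 \<noteq> 1"
proof
  assume "e 1 = 1"
  then have "cis (2 * pi / real p) = 1" using e_of_nat[of 1] by simp
  then have "cos (2 * pi / real p) = 1" by (simp add: complex_eq_iff)
  then obtain n :: int where n: "2 * pi / real p = of_int n * 2 * pi" using cos_one_2pi_int by auto
  have p1: "real p > 1" using p prime_gt_1_nat by simp
  have "1 / real p = of_int n"
  proof -
    have "pi * (2 / real p) = pi * (2 * of_int n)" using n by (simp add: mult_ac)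
    then have "2 / real p = 2 * of_int n" using mult_left_cancel[OF pi_neq_zero] by blast
    then show ?thesis by simp
  qed
  moreover have "0 < 1 / real p" "1 / real p < 1" using p1 by auto
  ultimately show False by (metis of_int_0_less_iff of_int_less_1_iff int_one_le_iff_zero_less not_le)
qed

lemma sum_e: "(\<Sum>t\<in>fp. e t) = 0"
proof -
  have b: "bij_betw (\<lambda>t. 1 + t) fp fp"
  proof (rule bij_betw_byWitness[where f' = "\<lambda>t. t - 1"])
    have ad: "x + y \<in> fp" if "x \<in> fp" "y \<in> fp" for x y
      using that frob_add[of x y 1] by (simp add: fp_def)
    show "(+) 1 ` fp \<subseteq> fp" using ad fp_1 by auto
    show "(\<lambda>t. t - 1) ` fp \<subseteq> fp" using ad fp_1 fp_uminus by (metis (no_types, lifting) diff_conv_add_uminus image_subsetI)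
  qed auto
  have "(\<Sum>t\<in>fp. e t) = (\<Sum>t\<in>fp. e (1 + t))" using sum.reindex_bij_betw[OF b] by metis
  also have "\<dots> = e 1 * (\<Sum>t\<in>fp. e t)" by (simp add: sum_distrib_left e_add fp_1)
  finally show ?thesis using e_1 by simp
qed

definition psi :: "'a \<Rightarrow> complex" where "psi x = e (tr x)"

lemma psi_add: "psi (x + y) = psi x * psi y"
  by (simp add: psi_def tr_add e_add tr_fp)

lemma psi_0: "psi 0 = 1"
  using psi_add[of 0 0] e_def by (auto simp: psi_def)

lemma psi_frob: "psi (x ^ p) = psi x" by (simp add: psi_def tr_frob)

lemma psi_norm: "psi x * cnj (psi x) = 1" "psi x \<noteq> 0"
  by (simp_all add: psi_def e_def cis_cnj cis_mult)

lemma psi_uminus: "psi (-x) = cnj (psi x)"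
  using psi_add[of x "-x"] psi_norm[of x] psi_0 by (metis add.right_inverse mult_cancel_left)

lemma psi_nontrivial: "\<exists>x. psi x \<noteq> 1"
proof -
  obtain x where x: "tr x \<noteq> 0" using tr_nonzero by auto
  have "tr (inverse (tr x) * x) = 1" using x tr_scale[OF fp_inverse[OF tr_fp]] by simp
  then show ?thesis using e_1 psi_def by metis
qed

lemma sum_psi: "(\<Sum>x\<in>UNIV. psi (a * x)) = (if a = 0 then of_nat q else 0)"
proof (cases "a = 0")
  case True
  then show ?thesis by (simp add: psi_0 card_q)
next
  case False
  obtain y where y: "psi y \<noteq> 1" using psi_nontrivial by auto
  have "(\<Sum>x\<in>UNIV. psi (a * x)) = (\<Sum>x\<in>UNIV. psi x)"
    by (rule sum.reindex_bij_witness[of _ "\<lambda>x. x / a" "\<lambda>x. a * x"]) (use False in auto)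
  moreover have "(\<Sum>x\<in>UNIV. psi x) = (\<Sum>x\<in>UNIV. psi (y + x))"
    by (rule sum.reindex_bij_witness[of _ "\<lambda>x. y + x" "\<lambda>x. x - y"]) auto
  moreover have "\<dots> = psi y * (\<Sum>x\<in>UNIV. psi x)" by (simp add: psi_add sum_distrib_left)
  ultimately show ?thesis using False y by (metis mult_cancel_right1)
qed

end

section \<open>Gauss and Jacobi sums\<close>

lemma sum_mod_periodic:
  fixes h :: "nat \<Rightarrow> 'b::comm_semiring_1"
  assumes "E > 0"
  shows "(\<Sum>i<D * E. h (i mod E)) = of_nat D * (\<Sum>k<E. h k)"
proof -
  have "(\<Sum>i<D * E. h (i mod E)) = (\<Sum>m<D. \<Sum>i\<in>{m * E..<m * E + E}. h (i mod E))"
    by (rule sum.nat_group[symmetric])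
  also have "\<dots> = (\<Sum>m<D. \<Sum>k<E. h k)"
  proof (rule sum.cong[OF refl])
    fix m
    show "(\<Sum>i\<in>{m * E..<m * E + E}. h (i mod E)) = (\<Sum>k<E. h k)"
    proof (rule sum.reindex_bij_witness[of _ "\<lambda>k. m * E + k" "\<lambda>i. i - m * E"])
      fix i assume i: "i \<in> {m * E..<m * E + E}"
      then have "i = m * E + (i - m * E)" "i - m * E < E" by auto
      then have "i mod E = i - m * E" by (metis mod_less mod_mult_self3)
      then show "h (i - m * E) = h (i mod E)" by simp
    qed auto
  qed
  finally show ?thesis by simp
qed

lemma sum_multiples:
  fixes F :: "nat \<Rightarrow> 'b::comm_monoid_add"
  assumes "D > 0"
  shows "(\<Sum>i<E * D. if D dvd i then F i else 0) = (\<Sum>k<E. F (D * k))"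
proof -
  have "(\<Sum>i<E * D. if D dvd i then F i else 0) = (\<Sum>m<E. \<Sum>i\<in>{m * D..<m * D + D}. if D dvd i then F i else 0)"
    by (rule sum.nat_group[symmetric])
  also have "\<dots> = (\<Sum>m<E. F (D * m))"
  proof (rule sum.cong[OF refl])
    fix m
    have "(\<Sum>i\<in>{m * D..<m * D + D}. if D dvd i then F i else 0) = (\<Sum>i\<in>{m * D..<m * D + D}. if i = m * D then F i else 0)"
    proof (rule sum.cong[OF refl])
      fix i assume i: "i \<in> {m * D..<m * D + D}"
      have "D dvd i \<longleftrightarrow> i = m * D"
      proof
        assume "D dvd i"
        then obtain k where k: "i = D * k" by auto
        have "m * D \<le> k * D" "k * D < Suc m * D" using i k by (auto simp: mult.commute)
        then have "m \<le> k" "k < Suc m" using assms mult_le_cancel2 mult_less_cancel2 by blast+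
        then show "i = m * D" using k by (simp add: mult.commute le_antisym)
      qed auto
      then show "(if D dvd i then F i else 0) = (if i = m * D then F i else 0)" by simp
    qed
    also have "\<dots> = F (D * m)" using assms by (simp add: mult.commute)
    finally show "(\<Sum>i\<in>{m * D..<m * D + D}. if D dvd i then F i else 0) = F (D * m)" .
  qed
  finally show ?thesis .
qed

lemma cis_eq_1_iff_dvd:
  assumes "n > 0"
  shows "cis (2 * pi * real i / real n) = 1 \<longleftrightarrow> n dvd i"
proof
  assume "cis (2 * pi * real i / real n) = 1"
  then have "cos (2 * pi * real i / real n) = 1" by (simp add: complex_eq_iff)
  then obtain k :: int where k: "2 * pi * real i / real n = of_int k * 2 * pi" using cos_one_2pi_int by auto
  have "(2 * pi) * (real i / real n) = (2 * pi) * of_int k" using k by (simp add: mult_ac)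
  then have "real i / real n = of_int k"
    using mult_left_cancel[of "2 * pi" "real i / real n" "of_int k"] pi_gt_zero by linarith
  then have "real i = of_int k * real n" using assms by (simp add: field_simps)
  then have "real_of_int (int i) = real_of_int (k * int n)" by simp
  then have "int i = k * int n" using of_int_eq_iff by blast
  then show "n dvd i" by (metis dvd_triv_right int_dvd_int_iff)
next
  assume "n dvd i"
  then obtain k where "i = n * k" by auto
  then have "2 * pi * real i / real n = 2 * pi * real k" using assms by simp
  then show "cis (2 * pi * real i / real n) = 1" using cis_multiple_2pi[of "real k"] by simp
qed

text \<open>The sum of \<open>G a * cnj (G a)\<close> over \<open>K\<close> is computed twice:
  scaling makes all terms with \<open>a \<noteq> 0\<close> equal, orthogonality leaves the diagonal.
  Stated for a subset \<open>K\<close> because it is applied to the whole field and again to the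
  prime field.\<close>

lemma gauss_norm_abstract:
  fixes K :: "'a::field set" and E chi :: "'a \<Rightarrow> complex"
  assumes fin: "finite K" and K: "0 \<in> K" "\<And>x y. x \<in> K \<Longrightarrow> y \<in> K \<Longrightarrow> x * y \<in> K"
      "\<And>x. x \<in> K \<Longrightarrow> inverse x \<in> K"  "\<And>x y. x \<in> K \<Longrightarrow> y \<in> K \<Longrightarrow> x - y \<in> K"
    and E0: "\<And>x y. x \<in> K \<Longrightarrow> y \<in> K \<Longrightarrow> E (x - y) = E x * cnj (E y)"
    and Esum: "\<And>x. x \<in> K \<Longrightarrow> (\<Sum>a\<in>K. E (a * x)) = (if x = 0 then of_nat (card K) else 0)"
    and chi0: "chi 0 = 0" and chi_mult: "\<And>x y. chi (x * y) = chi x * chi y"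
    and chi_norm: "\<And>x. x \<in> K \<Longrightarrow> x \<noteq> 0 \<Longrightarrow> chi x * cnj (chi x) = 1"
    and chi_sum: "(\<Sum>x\<in>K. chi x) = 0" and card: "card K > 1"
  shows "(\<Sum>x\<in>K. chi x * E x) * cnj (\<Sum>x\<in>K. chi x * E x) = of_nat (card K)"
proof -
  define G where "G a = (\<Sum>x\<in>K. chi x * E (a * x))" for a
  have cK: "(\<Sum>x\<in>K. if x = 0 then 0 else 1) = (of_nat (card K - 1) :: complex)"
  proof -
    have "(\<Sum>x\<in>K. if x = 0 then 0 else 1) = (\<Sum>x\<in>K - {0}. (1::complex))"
      using fin K by (intro sum.mono_neutral_cong_right) auto
    then show ?thesis using fin K by simp
  qed
  have Ga: "G a * cnj (G a) = (if a = 0 then 0 else G 1 * cnj (G 1))" if a: "a \<in> K" for a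
  proof (cases "a = 0")
    case True
    have "E 0 = E 0 * cnj (E 0)" using E0[of 0 0] K by simp
    then have "G 0 = 0" unfolding G_def using chi_sum by (simp flip: sum_distrib_right)
    then show ?thesis using True by simp
  next
    case False
    have "chi a * G a = (\<Sum>x\<in>K. chi (a * x) * E (a * x))"
      by (simp add: G_def sum_distrib_left chi_mult mult_ac)
    also have "\<dots> = G 1"
      unfolding G_def
      by (rule sum.reindex_bij_witness[of _ "\<lambda>x. x * inverse a" "\<lambda>x. a * x"]) (use False a K in auto)
    finally have c: "chi a * G a = G 1" .
    have "G 1 * cnj (G 1) = (chi a * cnj (chi a)) * (G a * cnj (G a))"
      unfolding c[symmetric] by simp
    then show ?thesis using chi_norm[OF a False] False by simp
  qed
  have "(\<Sum>a\<in>K. G a * cnj (G a)) = (\<Sum>a\<in>K. (if a = 0 then 0 else 1) * (G 1 * cnj (G 1)))"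
    by (intro sum.cong refl) (simp add: Ga)
  then have 1: "(\<Sum>a\<in>K. G a * cnj (G a)) = of_nat (card K - 1) * (G 1 * cnj (G 1))"
    using cK by (simp flip: sum_distrib_right)
  have "(\<Sum>a\<in>K. G a * cnj (G a)) = (\<Sum>a\<in>K. \<Sum>x\<in>K. \<Sum>y\<in>K. chi x * cnj (chi y) * E (a * (x - y)))"
  proof (rule sum.cong[OF refl])
    fix a assume a: "a \<in> K"
    have "G a * cnj (G a) = (\<Sum>x\<in>K. \<Sum>y\<in>K. (chi x * E (a * x)) * cnj (chi y * E (a * y)))"
      by (simp add: G_def sum_product cnj_sum)
    also have "\<dots> = (\<Sum>x\<in>K. \<Sum>y\<in>K. chi x * cnj (chi y) * E (a * (x - y)))"
      using a K E0 by (intro sum.cong refl) (simp add: right_diff_distrib mult_ac)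
    finally show "G a * cnj (G a) = (\<Sum>x\<in>K. \<Sum>y\<in>K. chi x * cnj (chi y) * E (a * (x - y)))" .
  qed
  also have "\<dots> = (\<Sum>x\<in>K. \<Sum>y\<in>K. \<Sum>a\<in>K. chi x * cnj (chi y) * E (a * (x - y)))"
    by (subst sum.swap, rule sum.cong[OF refl], rule sum.swap)
  also have "\<dots> = (\<Sum>x\<in>K. \<Sum>y\<in>K. if x = y then chi x * cnj (chi x) * of_nat (card K) else 0)"
    using K by (intro sum.cong refl) (auto simp: Esum simp flip: sum_distrib_left)
  also have "\<dots> = (\<Sum>x\<in>K. chi x * cnj (chi x) * of_nat (card K))" using fin by simp
  also have "\<dots> = (\<Sum>x\<in>K. (if x = 0 then 0 else 1) * of_nat (card K))"
    using chi_norm chi0 by (intro sum.cong refl) auto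
  also have "\<dots> = of_nat (card K - 1) * of_nat (card K)" using cK by (simp flip: sum_distrib_right)
  finally have "of_nat (card K - 1) * (G 1 * cnj (G 1)) = of_nat (card K - 1) * (of_nat (card K) :: complex)"
    using 1 by simp
  moreover have "of_nat (card K - 1) \<noteq> (0::complex)" using card by simp
  ultimately have "G 1 * cnj (G 1) = of_nat (card K)" using mult_left_cancel by blast
  then show ?thesis by (simp add: G_def)
qed

context prime_power_field
begin

section \<open>Multiplicative characters, Gauss sums and Jacobi sums\<close>

definition mchar :: "('a \<Rightarrow> complex) \<Rightarrow> bool" where
  "mchar chi \<longleftrightarrow> chi 0 = 0 \<and> chi 1 = 1 \<and> (\<forall>x y. chi (x * y) = chi x * chi y)"

lemma mchar_0: "mchar chi \<Longrightarrow> chi 0 = 0" by (simp add: mchar_def)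

lemma mchar_1: "mchar chi \<Longrightarrow> chi 1 = 1" by (simp add: mchar_def)

lemma mchar_mult: "mchar chi \<Longrightarrow> chi (x * y) = chi x * chi y" by (simp add: mchar_def)

lemma mchar_pow: "mchar chi \<Longrightarrow> chi (x ^ k) = chi x ^ k"
  by (induction k) (auto simp: mchar_1 mchar_mult)

lemma mchar_power: "mchar chi \<Longrightarrow> k > 0 \<Longrightarrow> mchar (\<lambda>x. chi x ^ k)"
  by (auto simp: mchar_def power_mult_distrib)

lemma mchar_prod: "mchar chi \<Longrightarrow> mchar chi' \<Longrightarrow> mchar (\<lambda>x. chi x * chi' x)"
  by (auto simp: mchar_def)

lemma mchar_norm:
  assumes "mchar chi" "x \<noteq> 0"
  shows "chi x * cnj (chi x) = 1" "chi x \<noteq> 0"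
proof -
  have "chi x ^ (q - 1) = 1" using mchar_pow[OF assms(1), of x "q-1"] power_q_minus_1[OF assms(2)] mchar_1[OF assms(1)] by simp
  then have "norm (chi x) ^ (q - 1) = 1" by (metis norm_one norm_power)
  then have "norm (chi x) = 1" using q_gt_1 by (metis norm_ge_zero power_eq_1_iff zero_less_diff less_numeral_extra(3) abs_norm_cancel real_norm_def)
  then show "chi x * cnj (chi x) = 1" using complex_norm_square[of "chi x"] by simp
  then show "chi x \<noteq> 0" by auto
qed

lemma mchar_inverse: "mchar chi \<Longrightarrow> chi (inverse x) = cnj (chi x)"
proof (cases "x = 0")
  case False
  assume c: "mchar chi"
  have "chi x * chi (inverse x) = 1" using False mchar_mult[OF c, of x "inverse x"] mchar_1[OF c] by simp
  then show ?thesis using mchar_norm[OF c False] by (metis mult_cancel_left)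
qed (simp add: mchar_0)

definition nontriv :: "('a \<Rightarrow> complex) \<Rightarrow> bool" where
  "nontriv chi \<longleftrightarrow> (\<exists>x. x \<noteq> 0 \<and> chi x \<noteq> 1)"

lemma sum_mchar:
  assumes "mchar chi" "nontriv chi"
  shows "(\<Sum>x\<in>UNIV. chi x) = 0"
proof -
  obtain y where y: "y \<noteq> 0" "chi y \<noteq> 1" using assms by (auto simp: nontriv_def)
  have "(\<Sum>x\<in>UNIV. chi x) = (\<Sum>x\<in>UNIV. chi (y * x))"
    by (rule sum.reindex_bij_witness[of _ "\<lambda>x. y * x" "\<lambda>x. x / y"]) (use y in auto)
  also have "\<dots> = chi y * (\<Sum>x\<in>UNIV. chi x)" by (simp add: mchar_mult[OF assms(1)] sum_distrib_left)
  finally show ?thesis using y by simp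
qed

definition gauss :: "('a \<Rightarrow> complex) \<Rightarrow> complex" where
  "gauss chi = (\<Sum>x\<in>UNIV. chi x * psi x)"

definition jacobi :: "('a \<Rightarrow> complex) \<Rightarrow> ('a \<Rightarrow> complex) \<Rightarrow> complex" where
  "jacobi chi chi' = (\<Sum>x\<in>UNIV. chi x * chi' (1 - x))"

lemma gauss_norm:
  assumes "mchar chi" "nontriv chi"
  shows "gauss chi * cnj (gauss chi) = of_nat q"
  unfolding gauss_def card_q[symmetric]
proof (rule gauss_norm_abstract)
  fix x y show "psi (x - y) = psi x * cnj (psi y)"
    using psi_add[of x "-y"] psi_uminus by simp
  show "(\<Sum>a\<in>UNIV. psi (a * x)) = (if x = 0 then of_nat (card (UNIV :: 'a set)) else 0)"
    using sum_psi[of x] by (simp add: mult.commute card_q)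
qed (use assms mchar_norm sum_mchar q_gt_1 in \<open>auto simp: mchar_def card_q\<close>)

lemma gauss_nonzero: "mchar chi \<Longrightarrow> nontriv chi \<Longrightarrow> gauss chi \<noteq> 0"
  using gauss_norm q_gt_1 by fastforce

lemma gauss_scale:
  assumes "mchar chi" "a \<noteq> 0"
  shows "(\<Sum>x\<in>UNIV. chi x * psi (a * x)) = cnj (chi a) * gauss chi"
proof -
  have "(\<Sum>x\<in>UNIV. chi x * psi (a * x)) = (\<Sum>x\<in>UNIV. chi (inverse a * x) * psi x)"
    by (rule sum.reindex_bij_witness[of _ "\<lambda>x. inverse a * x" "\<lambda>x. a * x"]) (use assms in \<open>auto simp flip: mult.assoc\<close>)
  then show ?thesis by (simp add: gauss_def sum_distrib_left mchar_mult[OF assms(1)] mchar_inverse[OF assms(1)] mult_ac)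
qed

text \<open>The substitution of \<open>x^p\<close> for \<open>x\<close> raises the character to the
  power \<open>p\<close> and leaves \<open>psi\<close> unchanged.\<close>

lemma gauss_frob:
  assumes "mchar chi"
  shows "gauss (\<lambda>x. chi x ^ (p ^ j)) = gauss chi"
proof (induction j)
  case (Suc j)
  have "gauss (\<lambda>x. chi x ^ (p ^ Suc j)) = (\<Sum>x\<in>UNIV. chi (x ^ p) ^ (p ^ j) * psi (x ^ p))"
    by (simp add: gauss_def psi_frob mchar_pow[OF assms] power_mult)
  also have "\<dots> = gauss (\<lambda>x. chi x ^ (p ^ j))"
    unfolding gauss_def by (rule frob_reindex)
  finally show ?case using Suc by simp
qed (simp add: gauss_def)

lemma gauss_jacobi:
  assumes c: "mchar chi" "mchar chi'" and n: "nontriv (\<lambda>x. chi x * chi' x)"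
  shows "gauss chi * gauss chi' = jacobi chi chi' * gauss (\<lambda>x. chi x * chi' x)"
proof -
  have "gauss chi * gauss chi' = (\<Sum>x\<in>UNIV. \<Sum>y\<in>UNIV. chi x * chi' y * psi (x + y))"
    by (simp add: gauss_def sum_product psi_add mult_ac)
  also have "\<dots> = (\<Sum>x\<in>UNIV. \<Sum>z\<in>UNIV. chi x * chi' (z - x) * psi z)"
  proof (rule sum.cong[OF refl])
    fix x
    show "(\<Sum>y\<in>UNIV. chi x * chi' y * psi (x + y)) = (\<Sum>z\<in>UNIV. chi x * chi' (z - x) * psi z)"
      by (rule sum.reindex_bij_witness[of _ "\<lambda>z. z - x" "\<lambda>y. x + y"]) auto
  qed
  also have "\<dots> = (\<Sum>z\<in>UNIV. (\<Sum>x\<in>UNIV. chi x * chi' (z - x)) * psi z)"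
    by (subst sum.swap) (simp add: sum_distrib_right)
  also have "\<dots> = (\<Sum>z\<in>UNIV. (chi z * chi' z * jacobi chi chi') * psi z)"
  proof (rule sum.cong[OF refl])
    fix z :: 'a
    have "(\<Sum>x\<in>UNIV. chi x * chi' (z - x)) = chi z * chi' z * jacobi chi chi'"
    proof (cases "z = 0")
      \<comment> \<open>At \<open>z = 0\<close> the inner sum is a multiple of the full sum of the
        product character, which vanishes by nontriviality.\<close>
      case True
      have "chi x * chi' (z - x) = chi' (-1) * (chi x * chi' x)" for x
        using mchar_mult[OF c(2), of "-1" x] True by simp
      then have "(\<Sum>x\<in>UNIV. chi x * chi' (z - x)) = chi' (-1) * (\<Sum>x\<in>UNIV. chi x * chi' x)"
        unfolding sum_distrib_left by (intro sum.cong refl)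
      also have "\<dots> = 0" using sum_mchar[OF mchar_prod[OF c] n] by simp
      finally show ?thesis using True mchar_0[OF c(1)] by simp
    next
      case False
      have "(\<Sum>x\<in>UNIV. chi x * chi' (z - x)) = (\<Sum>u\<in>UNIV. chi (z * u) * chi' (z * (1 - u)))"
        by (rule sum.reindex_bij_witness[of _ "\<lambda>u. z * u" "\<lambda>x. x / z"]) (use False in \<open>auto simp: algebra_simps\<close>)
      then show ?thesis by (simp add: jacobi_def sum_distrib_left mchar_mult[OF c(1)] mchar_mult[OF c(2)] mult_ac)
    qed
    then show "(\<Sum>x\<in>UNIV. chi x * chi' (z - x)) * psi z = chi z * chi' z * jacobi chi chi' * psi z" by simp
  qed
  finally show ?thesis by (simp add: gauss_def sum_distrib_left mult_ac)
qed

text \<open>A character of exact order \<open>n\<close> when \<open>n\<close> divides \<open>q - 1\<close>; otherwise not multiplicative.\<close>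

definition chr :: "nat \<Rightarrow> 'a \<Rightarrow> complex" where
  "chr n x = (if x = 0 then 0 else cis (2 * pi * real (ind x) / real n))"

lemma chr_g:
  assumes "n dvd q - 1"
  shows "chr n (g ^ i) = cis (2 * pi * real i / real n)"
proof -
  have n0: "n > 0" using assms q_gt_1 by (auto intro!: Nat.gr0I)
  have "[i mod (q - 1) = i] (mod n)" using assms by (metis cong_def mod_mod_cancel)
  then show ?thesis using cis_cong[OF _ n0] g_nonzero by (simp add: chr_def ind_g)
qed

lemma mchar_chr: "n dvd q - 1 \<Longrightarrow> mchar (chr n)"
  unfolding mchar_def
proof (intro conjI allI)
  assume n: "n dvd q - 1"
  show "chr n 0 = 0" by (simp add: chr_def)
  show "chr n 1 = 1" using chr_g[OF n, of 0] by simp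
  fix x y
  show "chr n (x * y) = chr n x * chr n y"
  proof (cases "x = 0 \<or> y = 0")
    case False
    then obtain i j where ij: "x = g ^ i" "y = g ^ j" using g_gen by meson
    have "chr n (x * y) = chr n (g ^ (i + j))" by (simp add: ij power_add)
    then show ?thesis unfolding ij chr_g[OF n] by (simp add: cis_mult add_divide_distrib distrib_left)
  qed (auto simp: chr_def)
qed

lemma chr_power:
  assumes "k > 0"
  shows "chr (k * n) x ^ k = chr n x"
  using assms by (auto simp: chr_def DeMoivre)

lemma chr_order:
  assumes "n > 0" "x \<noteq> 0"
  shows "chr n x ^ n = 1"
proof -
  have "chr n x ^ n = cis (2 * pi * real (ind x))" using assms by (simp add: chr_def DeMoivre)
  then show ?thesis using cis_multiple_2pi[of "real (ind x)"] by simp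
qed

lemma nontriv_chr_power:
  assumes "n dvd q - 1" "\<not> n dvd k"
  shows "nontriv (\<lambda>x. chr n x ^ k)"
proof -
  have n0: "n > 0" using assms q_gt_1 by (auto intro!: Nat.gr0I)
  have "chr n g ^ k = cis (2 * pi * real k / real n)"
    using chr_g[OF assms(1), of 1] by (simp add: DeMoivre mult_ac)
  then have "chr n g ^ k \<noteq> 1" using cis_eq_1_iff_dvd[OF n0] assms by simp
  then show ?thesis unfolding nontriv_def using g_nonzero by blast
qed

text \<open>The inner sum over \<open>j\<close> counts the solutions \<open>x\<close> of
  \<open>x ^ D = y\<close>: it is \<open>D\<close> if \<open>y\<close> is a nonzero
  \<open>D\<close>-th power and 0 for other nonzero \<open>y\<close>.\<close>

lemma sum_power_map:
  fixes f :: "'a \<Rightarrow> complex"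
  assumes D: "D dvd q - 1"
  shows "(\<Sum>x\<in>UNIV. f (x ^ D)) = f 0 + (\<Sum>y\<in>UNIV - {0}. f y * (\<Sum>j<D. chr D y ^ j))"
proof -
  have D0: "D > 0" using D q_gt_1 by (auto intro!: Nat.gr0I)
  obtain E where E: "q - 1 = D * E" using D by auto
  have E0: "E > 0" using E q_gt_1 by (auto intro!: Nat.gr0I)
  have "(\<Sum>x\<in>UNIV. f (x ^ D)) = f (0 ^ D) + (\<Sum>x\<in>UNIV - {0}. f (x ^ D))"
    by (rule sum.remove) auto
  also have "(\<Sum>x\<in>UNIV - {0}. f (x ^ D)) = (\<Sum>i<D * E. f (g ^ (D * (i mod E))))"
    unfolding sum_units E
  proof (rule sum.cong[OF refl])
    fix i
    have "[D * i = D * (i mod E)] (mod (q - 1))" unfolding E cong_def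
      by simp
    then have "g ^ (D * i) = g ^ (D * (i mod E))" using g_power_mod by (metis cong_def)
    then show "f ((g ^ i) ^ D) = f (g ^ (D * (i mod E)))" by (simp add: mult.commute flip: power_mult)
  qed
  also have "\<dots> = of_nat D * (\<Sum>k<E. f (g ^ (D * k)))" by (rule sum_mod_periodic[OF E0])
  also have "\<dots> = (\<Sum>k<E. f (g ^ (D * k)) * of_nat D)" by (simp add: sum_distrib_left mult.commute)
  also have "\<dots> = (\<Sum>i<E * D. if D dvd i then f (g ^ i) * of_nat D else 0)"
    by (rule sum_multiples[OF D0, symmetric])
  also have "\<dots> = (\<Sum>i<q - 1. f (g ^ i) * (\<Sum>j<D. chr D (g ^ i) ^ j))"
    unfolding E
  proof (rule sum.cong)
    fix i
    have "(\<Sum>j<D. chr D (g ^ i) ^ j) = (if chr D (g ^ i) = 1 then of_nat D else 0)"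
      using chr_order[OF D0] g_nonzero by (intro sum_roots_of_unity) simp
    then show "(if D dvd i then f (g ^ i) * of_nat D else 0) = f (g ^ i) * (\<Sum>j<D. chr D (g ^ i) ^ j)"
      using chr_g[OF D] cis_eq_1_iff_dvd[OF D0] by simp
  qed (simp add: mult.commute)
  finally show ?thesis by (simp add: sum_units zero_power[OF D0])
qed

text \<open>The value \<open>chr D a\<close> depends only on the index of \<open>a\<close> modulo
  \<open>D\<close>. This is the origin of the factor \<open>(q - 1) / 2^m\<close> in the final
  formula.\<close>

lemma sum_chr_equidistributed:
  fixes F :: "complex \<Rightarrow> complex"
  assumes D: "D dvd q - 1"
  shows "(\<Sum>a\<in>UNIV - {0}. F (chr D a)) = of_nat ((q - 1) div D) * (\<Sum>k<D. F (cis (2 * pi * real k / real D)))"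
proof -
  have D0: "D > 0" using D q_gt_1 by (auto intro!: Nat.gr0I)
  have E: "q - 1 = (q - 1) div D * D" using D by simp
  have "(\<Sum>a\<in>UNIV - {0}. F (chr D a)) = (\<Sum>i<(q - 1) div D * D. F (cis (2 * pi * real (i mod D) / real D)))"
    unfolding sum_units using E
  proof (intro sum.cong)
    fix i
    show "F (chr D (g ^ i)) = F (cis (2 * pi * real (i mod D) / real D))"
      unfolding chr_g[OF D] using cis_cong[OF _ D0, of "i" "i mod D"] by simp
  qed simp
  then show ?thesis using sum_mod_periodic[OF D0, of "\<lambda>k. F (cis (2 * pi * real k / real D))"] by simp
qed

text \<open>The Davenport--Hasse product formula for 2: completing the square in \<open>4 x (1 - x) = 1 - (2 x - 1)\<^sup>2\<close>
  turns \<open>jacobi chi chi\<close> into \<open>jacobi (chr 2) chi\<close>.\<close>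

lemma gauss_duplication:
  assumes c: "mchar chi" and odd: "2 dvd q - 1"
    and n1: "nontriv chi" and n2: "nontriv (\<lambda>x. chi x * chi x)" and n3: "nontriv (\<lambda>x. chr 2 x * chi x)"
  shows "gauss chi * gauss (\<lambda>x. chr 2 x * chi x) * chi 4 = gauss (chr 2) * gauss (\<lambda>x. chi x * chi x)"
proof -
  have two: "(2::'a) \<noteq> 0"
  proof
    assume "(2::'a) = 0"
    then have "p dvd 2" using of_nat_eq_0_iff[of 2] by simp
    then have "p = 2" using p two_is_prime_nat primes_dvd_imp_eq by blast
    then have "2 dvd q" using s unfolding q_def by simp
    then show False using odd q_gt_1 by presburger
  qed
  have "chi 4 * jacobi chi chi = (\<Sum>x\<in>UNIV. chi (1 - (2 * x - 1)^2))"
    unfolding jacobi_def sum_distrib_left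
  proof (rule sum.cong[OF refl])
    fix x :: 'a
    have "1 - (2 * x - 1)^2 = 4 * (x * (1 - x))" by (simp add: power2_eq_square algebra_simps)
    then show "chi 4 * (chi x * chi (1 - x)) = chi (1 - (2 * x - 1)^2)"
      by (simp add: mchar_mult[OF c])
  qed
  also have "\<dots> = (\<Sum>y\<in>UNIV. chi (1 - y^2))"
    by (rule sum.reindex_bij_witness[of _ "\<lambda>y. (y + 1) / 2" "\<lambda>x. 2 * x - 1"]) (use two in \<open>auto simp: field_simps\<close>)
  also have "\<dots> = chi (1 - 0) + (\<Sum>u\<in>UNIV - {0}. chi (1 - u) * (\<Sum>j<2. chr 2 u ^ j))"
    by (rule sum_power_map[OF odd])
  also have "(\<Sum>u\<in>UNIV - {0}. chi (1 - u) * (\<Sum>j<2. chr 2 u ^ j))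
      = (\<Sum>u\<in>UNIV - {0}. chi (1 - u)) + (\<Sum>u\<in>UNIV - {0}. chr 2 u * chi (1 - u))"
    by (simp add: numeral_2_eq_2 algebra_simps sum.distrib)
  also have "(\<Sum>u\<in>UNIV - {0}. chr 2 u * chi (1 - u)) = jacobi (chr 2) chi"
    unfolding jacobi_def by (rule sum.mono_neutral_left) (auto simp: chr_def)
  also have "chi (1 - 0) + ((\<Sum>u\<in>UNIV - {0}. chi (1 - u)) + jacobi (chr 2) chi) = (\<Sum>u\<in>UNIV. chi (1 - u)) + jacobi (chr 2) chi"
    by (simp add: sum.remove[of UNIV 0])
  also have "(\<Sum>u\<in>UNIV. chi (1 - u)) = (\<Sum>u\<in>UNIV. chi u)"
    by (rule sum.reindex_bij_witness[of _ "\<lambda>u. 1 - u" "\<lambda>u. 1 - u"]) auto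
  also have "\<dots> = 0" by (rule sum_mchar[OF c n1])
  finally have J: "chi 4 * jacobi chi chi = jacobi (chr 2) chi" by simp
  have 1: "gauss chi * gauss chi = jacobi chi chi * gauss (\<lambda>x. chi x * chi x)"
    by (rule gauss_jacobi[OF c c n2])
  have 2: "gauss (chr 2) * gauss chi = jacobi (chr 2) chi * gauss (\<lambda>x. chr 2 x * chi x)"
    by (rule gauss_jacobi[OF mchar_chr[OF odd] c n3])
  \<comment> \<open>The extra factor \<open>gauss chi\<close> makes both Jacobi sum relations
    applicable; it is nonzero and cancels at the end.\<close>
  have "gauss chi * (gauss chi * gauss (\<lambda>x. chr 2 x * chi x) * chi 4)
     = (chi 4 * jacobi chi chi) * gauss (\<lambda>x. chi x * chi x) * gauss (\<lambda>x. chr 2 x * chi x)"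
    using 1 by (simp add: mult_ac)
  also have "\<dots> = gauss chi * (gauss (chr 2) * gauss (\<lambda>x. chi x * chi x))"
    unfolding J using 2 by (simp add: mult_ac)
  finally show ?thesis using gauss_nonzero[OF c n1] by simp
qed

end

section \<open>Frobenius-invariant character sums\<close>

lemma power_mod_order:
  fixes z :: "'a::monoid_mult"
  assumes "z ^ n = 1"
  shows "z ^ a = z ^ (a mod n)"
proof -
  have "z ^ a = z ^ (n * (a div n) + a mod n)" by simp
  then show ?thesis unfolding power_add power_mult assms by simp
qed

definition omega :: complex where "omega = Complex (sqrt 2 / 2) (sqrt 2 / 2)"

definition isqrt2 :: complex where "isqrt2 = Complex 0 (sqrt 2)"

lemma isqrt2_square: "isqrt2 * isqrt2 = -2"
  by (simp add: isqrt2_def complex_eq_iff)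

lemma omega_square: "omega^2 = \<i>"
  by (simp add: omega_def complex_eq_iff power2_eq_square)

lemma omega_cube: "omega^3 = \<i> * omega"
  by (simp add: power3_eq_cube flip: omega_square power2_eq_square)

lemma omega_4: "omega^4 = -1"
proof -
  have "omega^4 = (omega^2)^2" by (simp flip: power_mult)
  then show ?thesis by (simp add: omega_square)
qed

lemma omega_cis: "omega = cis (2 * pi / 8)"
  by (simp add: omega_def complex_eq_iff cos_45 sin_45)

lemma omega_values:
  "\<i> * omega = Complex (- sqrt 2 / 2) (sqrt 2 / 2)"
  by (simp add: omega_def complex_eq_iff)

lemma omega_distinct:
  "omega \<noteq> 1" "omega \<noteq> -1" "omega \<noteq> -omega" "omega \<noteq> \<i>" "omega \<noteq> - \<i>"
  "\<i> * omega \<noteq> 1" "\<i> * omega \<noteq> -1" "\<i> * omega \<noteq> omega" "\<i> * omega \<noteq> - omega"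
  "-omega \<noteq> 1"  "\<i> \<noteq> - omega" "- \<i> \<noteq> - omega" "-(\<i> * omega) \<noteq> omega" "-(\<i> * omega) \<noteq> 1"  "-(\<i> * omega) \<noteq> - 1"
  "\<i> \<noteq> omega" "- \<i> \<noteq> omega"
  unfolding omega_values unfolding omega_def by (auto simp: complex_eq_iff)

lemma eighth_root_cases:
  fixes v :: complex
  assumes "v^8 = 1"
  shows "v \<in> {1, -1, \<i>, -\<i>, omega, \<i> * omega, -omega, -(\<i> * omega)}"
proof -
  have w2: "omega * omega = \<i>" using omega_square by (simp add: power2_eq_square)
  have w2': "omega * (omega * x) = \<i> * x" for x by (simp add: w2 flip: mult.assoc)
  have "v^8 - 1 = (v - 1) * (v + 1) * (v - \<i>) * (v + \<i>) * ((v - omega) * (v + omega)) * ((v - \<i> * omega) * (v + \<i> * omega))"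
    by (simp add: algebra_simps w2 w2' eval_nat_numeral)
  then have "(v - 1) * (v + 1) * (v - \<i>) * (v + \<i>) * ((v - omega) * (v + omega)) * ((v - \<i> * omega) * (v + \<i> * omega)) = 0"
    using assms by simp
  then show ?thesis by (auto simp: eq_neg_iff_add_eq_0)
qed

definition sgn_pm1 :: "complex \<Rightarrow> int" where
  "sgn_pm1 v = (if v = 1 then 1 else if v = -1 then -1 else 0)"

text \<open>Only one member of each pair \<open>omega\<close>, \<open>omega^3\<close> and
  \<open>-omega\<close>, \<open>-omega^3\<close> is counted. Cubing swaps the members, so in a
  Frobenius-invariant sum this count is the integer coefficient of \<open>sqrt(-2)\<close>.\<close>

definition sgn_omega :: "complex \<Rightarrow> int" where
  "sgn_omega v = (if v = omega then 1 else if v = -omega then -1 else 0)"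

text \<open>This is the trace from the eighth cyclotomic field to the fixed field of
  \<open>v \<mapsto> v^3\<close>, where \<open>omega + omega^3 = sqrt(-2)\<close>.\<close>

lemma eighth_root_trace:
  assumes "v^8 = 1"
  shows "v + v^3 = 2 * of_int (sgn_pm1 v) + isqrt2 * of_int (sgn_omega v + sgn_omega (v^3))"
proof -
  have w2: "omega * omega = \<i>" using omega_square by (simp add: power2_eq_square)
  have w2': "omega * (omega * x) = \<i> * x" for x by (simp add: w2 flip: mult.assoc)
  have o1: "omega + \<i> * omega = isqrt2" by (simp add: omega_def isqrt2_def complex_eq_iff)
  have o2: "- omega - \<i> * omega = - isqrt2" using o1 by (simp add: algebra_simps)
  have cubes: "omega^3 = \<i> * omega" "(\<i> * omega)^3 = omega" "(-omega)^3 = -(\<i> * omega)"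
      "(-(\<i> * omega))^3 = -omega" "\<i>^3 = -\<i>" "(-\<i>)^3 = \<i>"
    using omega_cube by (simp_all add: power3_eq_cube power_mult_distrib) (simp_all add: w2 w2' algebra_simps)
  have ii: "\<i> \<noteq> 1" "\<i> \<noteq> -1" "- \<i> \<noteq> 1" "-\<i> \<noteq> -1" "omega \<noteq> 0" by (auto simp: complex_eq_iff omega_def)
  have o3: "\<i> * omega + omega = isqrt2" "- (\<i> * omega) - omega = - isqrt2" using o1 by (simp_all add: algebra_simps)
  have "v = 1 \<or> v = -1 \<or> v = \<i> \<or> v = -\<i> \<or> v = omega \<or> v = \<i> * omega \<or> v = -omega \<or> v = -(\<i> * omega)"
    using eighth_root_cases[OF assms] by auto
  then show ?thesis
    by (elim disjE; hypsubst) (simp_all add: cubes sgn_pm1_def sgn_omega_def ii omega_distinct omega_distinct[symmetric] o1 o2 o3)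
qed

locale field_mod8 = prime_power_field +
  assumes p8: "p mod 8 = 3"
begin

lemma frob_iter_reindex:
  assumes "\<And>x::'a. x \<in> Y \<Longrightarrow> x ^ (p ^ j) \<in> Y"
  shows "(\<Sum>x\<in>Y. h (x ^ (p ^ j))) = (\<Sum>x\<in>Y. h x)"
proof -
  have inj: "inj (\<lambda>x::'a. x ^ (p ^ j))"
  proof (induction j)
    case (Suc j)
    have "(\<lambda>x::'a. x ^ (p ^ Suc j)) = (\<lambda>x. x ^ (p ^ j)) \<circ> (\<lambda>x. x ^ p)"
      by (auto simp: power_mult)
    then show ?case using Suc frob_bij by (metis bij_is_inj inj_compose)
  qed auto
  then have "inj_on (\<lambda>x. x ^ (p ^ j)) Y" by (rule inj_on_subset) auto
  moreover then have "(\<lambda>x. x ^ (p ^ j)) ` Y = Y" using assms by (intro endo_inj_surj) auto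
  ultimately have "bij_betw (\<lambda>x. x ^ (p ^ j)) Y Y" by (simp add: bij_betw_def)
  then show ?thesis by (rule sum.reindex_bij_betw)
qed

definition eighth :: "('a \<Rightarrow> complex) \<Rightarrow> 'a set" where
  "eighth chi = {x. chi x ^ 8 = 1}"

lemma frob_invariant_iter:
  assumes "\<And>x::'a. f (x ^ p) = f x"
  shows "f (x ^ (p ^ j)) = f x"
  by (induction j arbitrary: x) (auto simp: power_mult assms)

text \<open>A suitable power of the Frobenius map negates every character value of exact order at least 16,
  so these values cancel.\<close>

lemma frob_sum_eighth:
  fixes f :: "'a \<Rightarrow> int"
  assumes c: "mchar chi" and f: "\<And>x. f (x ^ p) = f x" and R: "R \<ge> 3"
    and ord: "\<And>x. x \<noteq> 0 \<Longrightarrow> chi x ^ (2^R) = 1"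
  shows "(\<Sum>x\<in>UNIV. chi x * of_int (f x)) = (\<Sum>x\<in>eighth chi. chi x * of_int (f x))"
proof -
  define Y where "Y r = {x. chi x ^ (2^r) = 1}" for r :: nat
  have "(\<Sum>x\<in>Y r. chi x * of_int (f x)) = (\<Sum>x\<in>Y 3. chi x * of_int (f x))" if "r \<ge> 3" for r
    using that
  proof (induction r rule: dec_induct)
    case (step r)
    define X where "X = {x. chi x ^ (2^r) = -1}"
    have un: "Y (Suc r) = Y r \<union> X"
    proof -
      have "chi x ^ (2^Suc r) = (chi x ^ (2^r))^2" for x by (simp add: mult.commute flip: power_mult)
      then show ?thesis by (auto simp: Y_def X_def power2_eq_1_iff)
    qed
    \<comment> \<open>With this \<open>j\<close> the power \<open>p^j\<close> is
      \<open>1 + 2^r\<close> modulo \<open>2^(r+1)\<close>, so its action multiplies each value on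
      \<open>X\<close> by its own \<open>2^r\<close>-th power, which is -1.\<close>
    define j :: nat where "j = 2^(r-2)"
    have pj: "[p^j = 1 + 2^r] (mod 2^(r+1))"
      using power_two_power_cong[OF p8, of "r-2"] step by (simp add: j_def eval_nat_numeral Suc_diff_Suc numeral_2_eq_2)
    have cx: "chi (x ^ (p^j)) = - chi x" if "x \<in> X" for x
    proof -
      have x1: "chi x ^ (2^r) = -1" using that by (simp add: X_def)
      have x2: "chi x ^ (2^(r+1)) = 1"
      proof -
        have "chi x ^ (2^(r+1)) = (chi x ^ (2^r))^2" by (simp add: mult.commute flip: power_mult)
        then show ?thesis using x1 by simp
      qed
      have pw: "chi x ^ a = chi x ^ (a mod 2^(r+1))" for a
        by (rule power_mod_order[OF x2])
      have "chi x ^ (p^j) = chi x ^ (1 + 2^r)" using pj pw by (metis cong_def)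
      then show ?thesis using x1 by (simp add: mchar_pow[OF c] power_add)
    qed
    have "x ^ (p^j) \<in> X" if "x \<in> X" for x
    proof -
      have "even ((2::nat)^r)" using step by simp
      then show ?thesis using cx[OF that] that by (simp add: X_def)
    qed
    then have "(\<Sum>x\<in>X. chi x * of_int (f x)) = (\<Sum>x\<in>X. chi (x ^ (p^j)) * of_int (f (x ^ (p^j))))"
      by (rule frob_iter_reindex[symmetric])
    also have "\<dots> = - (\<Sum>x\<in>X. chi x * of_int (f x))"
      by (simp add: cx frob_invariant_iter[of f, OF f] sum_negf)
    finally have z: "(\<Sum>x\<in>X. chi x * of_int (f x)) = 0" by simp
    have "(\<Sum>x\<in>Y (Suc r). chi x * of_int (f x)) = (\<Sum>x\<in>Y r. chi x * of_int (f x)) + (\<Sum>x\<in>X. chi x * of_int (f x))"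
      unfolding un by (rule sum.union_disjoint) (auto simp: Y_def X_def)
    then show ?case using z step by simp
  qed simp
  from this[OF R] have "(\<Sum>x\<in>Y R. chi x * of_int (f x)) = (\<Sum>x\<in>eighth chi. chi x * of_int (f x))"
    by (simp add: Y_def eighth_def)
  moreover have "(\<Sum>x\<in>UNIV. chi x * of_int (f x)) = (\<Sum>x\<in>Y R. chi x * of_int (f x))"
  proof (rule sum.mono_neutral_right)
    have "chi x = 0" if "chi x ^ (2^R) \<noteq> 1" for x
      using ord[of x] that mchar_0[OF c] by (cases "x = 0") auto
    then show "\<forall>x\<in>UNIV - Y R. chi x * of_int (f x) = 0" by (simp add: Y_def)
  qed auto
  ultimately show ?thesis by simp
qed

lemma eighth_frob:
  assumes c: "mchar chi" "x \<in> eighth chi"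
  shows "x ^ p \<in> eighth chi" "chi (x ^ p) = chi x ^ 3"
proof -
  have x: "chi x ^ 8 = 1" using c by (simp add: eighth_def)
  have "p = 8 * (p div 8) + 3" using p8 by presburger
  then have "chi x ^ p = chi x ^ (8 * (p div 8) + 3)" by simp
  then show 1: "chi (x ^ p) = chi x ^ 3" unfolding power_add power_mult x mchar_pow[OF c(1)] by simp
  have "chi (x ^ p) ^ 8 = (chi x ^ 8) ^ 3" unfolding 1 by (simp flip: power_mult)
  then show "x ^ p \<in> eighth chi" using x by (simp add: eighth_def)
qed

text \<open>On eighth roots of unity Frobenius is cubing. \<open>h\<close> is arbitrary because both
  the values and their coordinate \<open>sgn_omega\<close> have to be transported.\<close>

lemma eighth_frob_sum:
  fixes h :: "complex \<Rightarrow> 'b::comm_ring_1" and f :: "'a \<Rightarrow> int"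
  assumes c: "mchar chi" and f: "\<And>x. f (x ^ p) = f x"
  shows "(\<Sum>x\<in>eighth chi. h (chi x ^ 3) * of_int (f x)) = (\<Sum>x\<in>eighth chi. h (chi x) * of_int (f x))"
proof -
  have "(\<Sum>x\<in>eighth chi. h (chi x) * of_int (f x)) = (\<Sum>x\<in>eighth chi. h (chi (x ^ (p ^ 1))) * of_int (f (x ^ (p ^ 1))))"
    by (rule frob_iter_reindex[symmetric]) (use eighth_frob[OF c] in auto)
  also have "\<dots> = (\<Sum>x\<in>eighth chi. h (chi x ^ 3) * of_int (f x))"
    by (intro sum.cong refl) (simp add: f eighth_frob[OF c])
  finally show ?thesis by simp
qed

text \<open>Averaging the sum with its cubed version replaces each value by its trace to
  \<open>\<int>[sqrt(-2)]\<close>. The coordinates appear explicitly because they are later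
  evaluated in the finite field as well.\<close>

lemma frob_sum_zs:
  fixes f :: "'a \<Rightarrow> int"
  assumes c: "mchar chi" and f: "\<And>x. f (x ^ p) = f x" and R: "R \<ge> 3"
    and ord: "\<And>x. x \<noteq> 0 \<Longrightarrow> chi x ^ (2^R) = 1"
  shows "(\<Sum>x\<in>UNIV. chi x * of_int (f x)) =
     zs (\<Sum>x\<in>eighth chi. sgn_pm1 (chi x) * f x) (\<Sum>x\<in>eighth chi. sgn_omega (chi x) * f x)"
proof -
  define W where "W = (\<Sum>x\<in>eighth chi. chi x * of_int (f x))"
  define a where "a = (\<Sum>x\<in>eighth chi. sgn_pm1 (chi x) * f x)"
  define b where "b = (\<Sum>x\<in>eighth chi. sgn_omega (chi x) * f x)"
  have "W = (\<Sum>x\<in>eighth chi. chi x ^ 3 * of_int (f x))"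
    unfolding W_def using eighth_frob_sum[where f = f and h = "\<lambda>v. v", OF c f] by simp
  then have "2 * W = (\<Sum>x\<in>eighth chi. (chi x + chi x ^ 3) * of_int (f x))"
    by (simp add: W_def sum.distrib algebra_simps)
  also have "\<dots> = (\<Sum>x\<in>eighth chi. of_int (2 * (sgn_pm1 (chi x) * f x)) + isqrt2 * of_int (sgn_omega (chi x) * f x + sgn_omega (chi x ^ 3) * f x))"
    by (intro sum.cong refl) (subst eighth_root_trace, auto simp: eighth_def algebra_simps)
  also have "\<dots> = of_int (2 * a) + isqrt2 * of_int (b + (\<Sum>x\<in>eighth chi. sgn_omega (chi x ^ 3) * f x))"
    by (simp add: sum.distrib a_def b_def sum_distrib_left algebra_simps)
  also have "(\<Sum>x\<in>eighth chi. sgn_omega (chi x ^ 3) * f x) = b"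
    unfolding b_def using eighth_frob_sum[where f = f and h = sgn_omega, OF c f] by simp
  also have "of_int (2 * a) + isqrt2 * of_int (b + b) = 2 * zs a b"
    by (simp add: zs_def isqrt2_def complex_eq_iff)
  finally have "W = zs a b" by simp
  then show ?thesis using frob_sum_eighth[where f = f, OF c f R ord] by (simp add: W_def a_def b_def)
qed

text \<open>Only values that are eighth roots of unity contribute, so \<open>u\<close> matters
  modulo 8: 3 is the Frobenius class, while 5 and 7 are the negatives of 3 and 1.\<close>

lemma frob_sum_power:
  fixes f :: "'a \<Rightarrow> int"
  assumes c: "mchar chi" and f: "\<And>x. f (x ^ p) = f x" and R: "R \<ge> 3"
    and ord: "\<And>x. x \<noteq> 0 \<Longrightarrow> chi x ^ (2^R) = 1" and u: "odd u"
  shows "(\<Sum>x\<in>UNIV. chi x ^ u * of_int (f x)) =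
     (if u mod 8 = 1 \<or> u mod 8 = 3 then (\<Sum>x\<in>UNIV. chi x * of_int (f x)) else cnj (\<Sum>x\<in>UNIV. chi x * of_int (f x)))"
proof -
  have u0: "u > 0" using u by (auto intro: Nat.gr0I)
  have E: "eighth (\<lambda>x. chi x ^ u) = eighth chi"
  proof -
    have "chi x ^ 8 = 1" if "(chi x ^ u) ^ 8 = 1" for x
    proof -
      have "x \<noteq> 0" using that mchar_0[OF c] u0 by (auto simp: zero_power)
      then have o: "chi x ^ (2^R) = 1" by (rule ord)
      \<comment> \<open>As \<open>u\<close> is odd, a value killed by \<open>8 * u\<close> and by
        \<open>2^R\<close> is killed by 8; hence \<open>chi\<close> and its \<open>u\<close>-th
        power share the same set \<open>eighth\<close>.\<close>
      have g: "gcd (8 * u) (2^R) = 8"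
      proof -
        have "(2::nat)^R = 8 * 2^(R-3)"
          using R power_add[of "2::nat" 3 "R - 3"] by simp
        moreover have "gcd u (2^(R-3)) = 1" using u by simp
        ultimately show ?thesis using gcd_mult_distrib_nat[of 8 u "2^(R-3)"] by simp
      qed
      obtain a b where ab: "8 * u * a = 2^R * b + gcd (8 * u) (2^R)"
        using bezout_nat[of "8*u" "2^R"] u0 by auto
      have "chi x ^ (8 * u * a) = 1" using that by (simp add: power_mult mult.commute[of 8])
      then show ?thesis unfolding ab g power_add power_mult o by simp
    qed
    moreover have "(chi x ^ u) ^ 8 = 1" if "chi x ^ 8 = 1" for x
      using that by (metis mult.commute power_mult power_one)
    ultimately show ?thesis by (auto simp: eighth_def)
  qed
  have ord': "(chi x ^ u) ^ (2^R) = 1" if "x \<noteq> 0" for x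
    using ord[OF that] by (metis mult.commute power_mult power_one)
  have S1: "(\<Sum>x\<in>UNIV. chi x ^ u * of_int (f x)) = (\<Sum>x\<in>eighth chi. chi x ^ u * of_int (f x))"
    using frob_sum_eighth[where f = f, OF mchar_power[OF c u0] f R ord'] E by simp
  have S2: "(\<Sum>x\<in>UNIV. chi x * of_int (f x)) = (\<Sum>x\<in>eighth chi. chi x * of_int (f x))"
    by (rule frob_sum_eighth[where f = f, OF c f R ord])
  have S3: "(\<Sum>x\<in>eighth chi. chi x ^ 3 * of_int (f x)) = (\<Sum>x\<in>eighth chi. chi x * of_int (f x))"
    using eighth_frob_sum[where f = f and h = "\<lambda>v. v", OF c f] by simp
  have um: "chi x ^ u = chi x ^ (u mod 8)" if "x \<in> eighth chi" for x
  proof -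
    have x: "chi x ^ 8 = 1" using that by (simp add: eighth_def)
    have "chi x ^ u = chi x ^ (8 * (u div 8) + u mod 8)" by simp
    then show ?thesis unfolding power_add power_mult x by simp
  qed
  have cn: "cnj (chi x ^ a) = chi x ^ b" if "x \<in> eighth chi" "a + b = 8" for x a b
  proof -
    have x0: "x \<noteq> 0" using that mchar_0[OF c] by (auto simp: eighth_def)
    have x: "chi x ^ 8 = 1" using that by (simp add: eighth_def)
    have "chi x ^ a * chi x ^ b = 1" using x that(2) by (simp flip: power_add)
    moreover have "chi x ^ a * cnj (chi x ^ a) = 1"
      using mchar_norm(1)[OF c x0] by (metis complex_cnj_power power_mult_distrib power_one)
    ultimately show ?thesis using mchar_norm(2)[OF c x0] by (metis mult_left_cancel power_not_zero)
  qed
  have "u mod 8 = 1 \<or> u mod 8 = 3 \<or> u mod 8 = 5 \<or> u mod 8 = 7" using u by presburger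
  then consider "u mod 8 = 1" | "u mod 8 = 3" | "u mod 8 = 5" | "u mod 8 = 7"
    by blast
  then show ?thesis
  proof cases
    case 1
    then show ?thesis using S1 S2 um by simp
  next
    case 2
    then show ?thesis using S1 S2 S3 um by simp
  next
    case 3
    have "cnj (\<Sum>x\<in>eighth chi. chi x ^ 3 * of_int (f x)) = (\<Sum>x\<in>eighth chi. chi x ^ u * of_int (f x))"
      unfolding cnj_sum by (intro sum.cong refl) (simp add: um 3 cn[of _ 3 5] del: complex_cnj_power)
    then show ?thesis using S1 S2 S3 3 by simp
  next
    case 4
    have "cnj (\<Sum>x\<in>eighth chi. chi x * of_int (f x)) = (\<Sum>x\<in>eighth chi. chi x ^ u * of_int (f x))"
      unfolding cnj_sum by (intro sum.cong refl) (use cn[of _ 1 7] in \<open>simp add: um 4\<close>)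
    then show ?thesis using S1 S2 4 by simp
  qed
qed

end

section \<open>Gauss sums of characters of two-power order\<close>

lemma power_gcd_eq_1:
  fixes z :: "'a::monoid_mult"
  assumes "z ^ a = 1" "z ^ b = 1" "a > 0"
  shows "z ^ gcd a b = 1"
proof -
  obtain x y where xy: "a * x = b * y + gcd a b" using bezout_nat[of a b] assms by auto
  have "z ^ (a * x) = 1" by (simp add: power_mult assms)
  then show ?thesis unfolding xy power_add power_mult assms by simp
qed

text \<open>\<open>M\<close> is one more than the exponent \<open>m\<close> of the equation.
  Characters of order below \<open>2^M\<close> are then squares of characters, and order
  \<open>2^M\<close> itself serves only to settle the last sign.\<close>

locale field_two_power = field_mod8 +
  fixes M :: nat
  assumes M: "M \<ge> 4" and dvd_M: "2^M dvd q - 1"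
begin

lemma two_power_dvd_q_minus_1: "r \<le> M \<Longrightarrow> 2^r dvd q - 1"
  using dvd_M le_imp_power_dvd dvd_trans by blast

abbreviation chi :: "nat \<Rightarrow> 'a \<Rightarrow> complex" where "chi r \<equiv> chr (2^r)"

lemma mchar_chi: "r \<le> M \<Longrightarrow> mchar (chi r)"
  using mchar_chr two_power_dvd_q_minus_1 by blast

lemma chi_two_power: "chi (r + k) x ^ (2^k) = chi r x"
  using chr_power[of "2^k" "2^r" x] by (simp add: power_add mult.commute)

lemma chi_order: "x \<noteq> 0 \<Longrightarrow> chi r x ^ (2^r) = 1"
  using chr_order[of "2^r" x] by simp

text \<open>The unit group of the prime field has order \<open>p - 1\<close>, which is twice an odd
  number since \<open>p mod 8 = 3\<close>.\<close>

lemma chi_fp_square: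
  assumes c: "c \<in> fp" "c \<noteq> 0" and r: "r \<le> M"
  shows "chi r c ^ 2 = 1"
proof -
  have p3: "p \<ge> 3" using p8 by presburger
  have "c ^ (p - 1) * c = c" using c p3 by (simp add: fp_def flip: power_Suc2)
  then have "c ^ (p - 1) = 1" using c by simp
  then have 1: "chi r c ^ (p - 1) = 1"
    using mchar_pow[OF mchar_chi[OF r], of c "p-1"] mchar_1[OF mchar_chi[OF r]] by simp
  have 2: "chi r c ^ (2^Suc r) = 1" using chi_order[OF c(2), of r] by (metis mult.commute power_Suc power_mult power_one)
  have "p - 1 = 2 * (4 * (p div 8) + 1)" using p8 by presburger
  then have "gcd (p - 1) (2^Suc r) = 2 * gcd (4 * (p div 8) + 1) (2^r)"
    using gcd_mult_distrib_nat[of 2 "4 * (p div 8) + 1" "2^r"] by simp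
  also have "gcd (4 * (p div 8) + 1) (2^r) = 1" by (simp add: coprime_iff_gcd_eq_1[symmetric])
  finally show ?thesis using power_gcd_eq_1[OF 1 2] p3 by simp
qed

text \<open>For \<open>r < M\<close> the character is the square of \<open>chi (r + 1)\<close>,
  which is at most quadratic on the prime field.\<close>

lemma chi_fp_trivial:
  assumes c: "c \<in> fp" "c \<noteq> 0" and r: "r < M"
  shows "chi r c = 1"
  using chi_fp_square[OF c, of "r+1"] chi_two_power[of r 1 c] r by simp

text \<open>If a character is trivial on the prime field, its Gauss sum does not change when \<open>psi\<close> is replaced
  by the integer-valued weight \<open>F\<close>; if it is quadratic there, the weight is \<open>F1\<close>, up to a factor of square \<open>-p\<close>.\<close>

definition F :: "'a \<Rightarrow> int" where "F x = of_bool (tr x = 0) - of_bool (tr x = 1)"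

definition F1 :: "'a \<Rightarrow> int" where "F1 x = of_bool (tr x = 1)"

lemma F_frob: "F (x ^ p) = F x" "F1 (x ^ p) = F1 x" by (simp_all add: F_def F1_def tr_frob)

text \<open>The sum of \<open>c\<close> over one fibre of the trace. Scaling by prime field units
  permutes the fibres, so only those over 0 and 1 matter.\<close>

definition U :: "('a \<Rightarrow> complex) \<Rightarrow> 'a \<Rightarrow> complex" where
  "U c t = (\<Sum>x\<in>UNIV. if tr x = t then c x else 0)"

lemma gauss_U: "gauss c = (\<Sum>t\<in>fp. e t * U c t)"
proof -
  have "(\<Sum>t\<in>fp. e t * U c t) = (\<Sum>t\<in>fp. \<Sum>x\<in>UNIV. if tr x = t then c x * e t else 0)"
    unfolding U_def sum_distrib_left by (intro sum.cong refl) simp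
  also have "\<dots> = (\<Sum>x\<in>UNIV. \<Sum>t\<in>fp. if tr x = t then c x * e t else 0)" by (rule sum.swap)
  also have "\<dots> = (\<Sum>x\<in>UNIV. c x * e (tr x))" by (simp add: tr_fp)
  finally show ?thesis by (simp add: gauss_def psi_def)
qed

lemma U_scale:
  assumes "mchar c" "t \<in> fp" "t \<noteq> 0"
  shows "U c (t * u) = c t * U c u"
proof -
  have "U c (t * u) = (\<Sum>x\<in>UNIV. if tr (t * x) = t * u then c (t * x) else 0)"
    unfolding U_def
    by (rule sum.reindex_bij_witness[of _ "\<lambda>x. t * x" "\<lambda>x. x / t"]) (use assms in auto)
  also have "\<dots> = c t * U c u"
    unfolding U_def sum_distrib_left using assms
    by (intro sum.cong refl) (simp add: mchar_mult tr_scale)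
  finally show ?thesis .
qed

text \<open>All fibres over nonzero traces contribute equally, and the nontrivial
  \<open>p\<close>-th roots of unity add up to -1; what is left is
  \<open>U c 0 - U c 1\<close>.\<close>

lemma gauss_trivial_fp:
  assumes c: "mchar c" and t: "\<And>a. a \<in> fp \<Longrightarrow> a \<noteq> 0 \<Longrightarrow> c a = 1"
  shows "gauss c = (\<Sum>x\<in>UNIV. c x * of_int (F x))"
proof -
  have "gauss c = e 0 * U c 0 + (\<Sum>a\<in>fp - {0}. e a * U c a)"
    unfolding gauss_U by (rule sum.remove) (auto simp: fp_0)
  also have "(\<Sum>a\<in>fp - {0}. e a * U c a) = (\<Sum>a\<in>fp - {0}. e a) * U c 1"
    unfolding sum_distrib_right using U_scale[OF c, of _ 1] t by (intro sum.cong refl) auto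
  also have "(\<Sum>a\<in>fp - {0}. e a) = -1"
    using sum_e sum.remove[of fp 0 e] fp_0 e_0 by (simp add: add_eq_0_iff)
  also have "e 0 * U c 0 + -1 * U c 1 = (\<Sum>x\<in>UNIV. c x * of_int (F x))"
  proof -
    have "U c 0 - U c 1 = (\<Sum>x\<in>UNIV. c x * of_int (F x))"
      unfolding U_def sum_subtractf[symmetric] by (intro sum.cong refl) (simp add: F_def)
    then show ?thesis by (simp add: e_0)
  qed
  finally show ?thesis .
qed

lemma e_diff: "x \<in> fp \<Longrightarrow> y \<in> fp \<Longrightarrow> e (x - y) = e x * cnj (e y)"
proof -
  assume xy: "x \<in> fp" "y \<in> fp"
  have "e y * e (-y) = 1" using e_add[of y "-y"] xy fp_uminus e_0 by simp
  moreover have "e y * cnj (e y) = 1" by (simp add: e_def cis_cnj cis_mult)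
  ultimately have "e (-y) = cnj (e y)" by (metis mult_cancel_left zero_neq_one mult_zero_left)
  then show ?thesis using e_add[of x "-y"] xy fp_uminus by simp
qed

lemma fp_diff: "x \<in> fp \<Longrightarrow> y \<in> fp \<Longrightarrow> x - y \<in> fp"
  using frob_add[of x "-y" 1] fp_uminus[of y] by (simp add: fp_def)

lemma fp_divide: "x \<in> fp \<Longrightarrow> y \<in> fp \<Longrightarrow> x / y \<in> fp"
  by (simp add: fp_def power_divide)

lemma card_fp: "card fp = p"
proof -
  have "inj_on (of_nat :: nat \<Rightarrow> 'a) {..<p}"
    by (intro inj_onI) (metis of_nat_eq_cong cong_def lessThan_iff mod_less)
  then show ?thesis unfolding fp_eq by (simp add: card_image)
qed

text \<open>On the prime field \<open>c\<close> is the quadratic character. The fibre over 0 is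
  stable under \<open>b\<close> with \<open>c b = -1\<close>, so it contributes 0, and the
  \<open>p\<close>-th roots of unity collect in the quadratic Gauss sum of the prime field. Its
  square is \<open>-p\<close> because -1 is a nonsquare there.\<close>

lemma gauss_nontrivial_fp:
  assumes c: "mchar c" and sq: "\<And>a. a \<in> fp \<Longrightarrow> a \<noteq> 0 \<Longrightarrow> c a ^ 2 = 1"
    and nt: "b \<in> fp" "b \<noteq> 0" "c b \<noteq> 1"
  shows "\<exists>g. g^2 = - of_nat p \<and> gauss c = g * (\<Sum>x\<in>UNIV. c x * of_int (F1 x))"
proof -
  define g where "g = (\<Sum>a\<in>fp. c a * e a)"
  have cb: "c b = -1" using sq[OF nt(1,2)] nt(3) by (simp add: power2_eq_1_iff)
  have p3: "p \<ge> 3" using p8 by presburger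
  have "U c 0 = c b * U c 0" using U_scale[OF c nt(1,2), of 0] by simp
  then have U0: "U c 0 = 0" using cb by simp
  have "gauss c = (\<Sum>a\<in>fp. c a * e a * U c 1)"
    unfolding gauss_U
  proof (rule sum.cong[OF refl])
    fix a assume a: "a \<in> fp"
    show "e a * U c a = c a * e a * U c 1"
    proof (cases "a = 0")
      case True then show ?thesis using U0 mchar_0[OF c] by simp
    next
      case False then show ?thesis using U_scale[OF c a False, of 1] by simp
    qed
  qed
  then have G: "gauss c = g * U c 1" by (simp add: g_def sum_distrib_right)
  \<comment> \<open>\<open>h = (p - 1) div 2\<close> is odd, so \<open>b ^ h\<close> is a square
    root of 1 at which \<open>c\<close> is -1; it can only be -1.\<close>
  have cm1: "c (-1) = -1"
  proof -
    define h where "h = (p - 1) div 2"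
    have h: "p = 2 * h + 1" "odd h" using p8 unfolding h_def by presburger+
    have "b ^ p = b" using nt by (simp add: fp_def)
    then have "b ^ (2 * h) = 1" using nt h by (metis mult_cancel_right1 power_add power_one_right)
    then have "(b ^ h) ^ 2 = 1" by (metis mult.commute power_mult)
    then have "b ^ h = 1 \<or> b ^ h = -1" by (simp add: power2_eq_1_iff)
    moreover have "c (b ^ h) = -1" using cb h by (simp add: mchar_pow[OF c])
    ultimately show ?thesis using mchar_1[OF c] by auto
  qed
  have "(\<Sum>a\<in>fp. c a) = (\<Sum>a\<in>fp. c (b * a))"
    by (rule sum.reindex_bij_witness[of _ "\<lambda>x. b * x" "\<lambda>x. x / b"]) (use nt in \<open>simp_all add: fp_mult fp_divide\<close>)
  also have "\<dots> = - (\<Sum>a\<in>fp. c a)" by (simp add: mchar_mult[OF c] cb sum_negf)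
  finally have c0: "(\<Sum>a\<in>fp. c a) = 0" by simp
  have "g * cnj g = of_nat (card fp)"
    unfolding g_def
  proof (rule gauss_norm_abstract)
    fix x assume x: "x \<in> fp"
    show "(\<Sum>a\<in>fp. e (a * x)) = (if x = 0 then of_nat (card fp) else 0)"
    proof (cases "x = 0")
      case False
      have "(\<Sum>a\<in>fp. e (a * x)) = (\<Sum>a\<in>fp. e a)"
        by (rule sum.reindex_bij_witness[of _ "\<lambda>y. y / x" "\<lambda>y. y * x"]) (use x False in \<open>simp_all add: fp_mult fp_divide\<close>)
      then show ?thesis using sum_e False by simp
    qed (simp add: e_0)
  qed (use c mchar_norm e_diff c0 p3 in \<open>auto simp: mchar_def fp_0 fp_mult fp_inverse fp_diff card_fp\<close>)
  then have gn: "g * cnj g = of_nat p" using card_fp by simp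
  have "cnj g = (\<Sum>a\<in>fp. c (-a) * e (-a) * c (-1))"
    unfolding g_def cnj_sum
  proof (rule sum.cong[OF refl])
    fix a assume a: "a \<in> fp"
    have 1: "cnj (e a) = e (-a)" using e_diff[OF fp_0 a] e_0 by simp
    have 2: "cnj (c a) = c a"
    proof (cases "a = 0")
      case False
      then have "c a = 1 \<or> c a = -1" using sq[OF a] by (simp add: power2_eq_1_iff)
      then show ?thesis by auto
    qed (simp add: mchar_0[OF c])
    have "c a = c (-1) * c (-a)" using mchar_mult[OF c, of "-1" "-a"] by simp
    then show "cnj (c a * e a) = c (-a) * e (-a) * c (-1)" using 1 2 by simp
  qed
  also have "\<dots> = (\<Sum>a\<in>fp. c a * e a * c (-1))"
    by (rule sum.reindex_bij_witness[of _ uminus uminus]) (auto simp: fp_uminus)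
  also have "\<dots> = - g" by (simp add: cm1 g_def sum_negf)
  finally have "cnj g = - g" .
  then have "g^2 = - of_nat p" using gn by (simp add: power2_eq_square) (metis add.inverse_inverse)
  moreover have "U c 1 = (\<Sum>x\<in>UNIV. c x * of_int (F1 x))"
    unfolding U_def by (intro sum.cong refl) (simp add: F1_def)
  ultimately show ?thesis using G by auto
qed

section \<open>The Gauss sums of order 2^r: conjugation, duplication and the quadratic case\<close>

definition Gr :: "nat \<Rightarrow> complex" where "Gr r = gauss (chi r)"

lemma chi_order_max: "x \<noteq> 0 \<Longrightarrow> chi r x ^ (2 ^ max r 3) = 1"
proof -
  assume x: "x \<noteq> 0"
  have "chi r x ^ (2 ^ max r 3) = (chi r x ^ (2^r)) ^ (2^(max r 3 - r))"
    by (simp flip: power_mult power_add)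
  then show ?thesis using chi_order[OF x] by simp
qed

text \<open>The integer weight \<open>F\<close> is Frobenius-invariant, so the powers are governed
  by \<open>u\<close> modulo 8; \<open>max r 3\<close> pads the orders 2 and 4 to the exponent
  required there.\<close>

lemma gauss_chi_power:
  assumes r: "r < M" and u: "odd u"
  shows "gauss (\<lambda>x. chi r x ^ u) = (if u mod 8 = 1 \<or> u mod 8 = 3 then Gr r else cnj (Gr r))"
proof -
  have u0: "u > 0" using u by (auto intro: Nat.gr0I)
  have c: "mchar (chi r)" using mchar_chi r by simp
  have 1: "gauss (\<lambda>x. chi r x ^ u) = (\<Sum>x\<in>UNIV. chi r x ^ u * of_int (F x))"
    using chi_fp_trivial r by (intro gauss_trivial_fp mchar_power c u0) simp
  have 2: "Gr r = (\<Sum>x\<in>UNIV. chi r x * of_int (F x))"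
    unfolding Gr_def using chi_fp_trivial r by (intro gauss_trivial_fp c) simp
  show ?thesis unfolding 1 2
    by (rule frob_sum_power[where f = F and R = "max r 3", OF c F_frob(1) _ _ u]) (auto intro: chi_order_max)
qed

lemma Gr_zs: "r < M \<Longrightarrow> \<exists>a b. Gr r = zs a b"
proof -
  assume r: "r < M"
  have c: "mchar (chi r)" using mchar_chi r by simp
  have "Gr r = (\<Sum>x\<in>UNIV. chi r x * of_int (F x))"
    unfolding Gr_def using chi_fp_trivial r by (intro gauss_trivial_fp c) simp
  also have "\<dots> = zs (\<Sum>x\<in>eighth (chi r). sgn_pm1 (chi r x) * F x) (\<Sum>x\<in>eighth (chi r). sgn_omega (chi r x) * F x)"
    by (rule frob_sum_zs[where f = F and R = "max r 3", OF c F_frob(1)]) (auto intro: chi_order_max)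
  finally show ?thesis by blast
qed

lemma Gr_norm: "1 \<le> r \<Longrightarrow> r \<le> M \<Longrightarrow> Gr r * cnj (Gr r) = of_nat q"
  unfolding Gr_def using nontriv_chr_power[of "2^r" 1] two_power_dvd_q_minus_1[of r] mchar_chi[of r]
  by (intro gauss_norm) auto

lemma two_fp: "(2::'a) \<in> fp" "(2::'a) \<noteq> 0"
proof -
  show "(2::'a) \<in> fp" using of_nat_fp[of 2] by simp
  have "\<not> p dvd 2" using p8 by (auto dest!: dvd_imp_le)
  then show "(2::'a) \<noteq> 0" using of_nat_eq_0_iff[of 2] by simp
qed

text \<open>This removes the factor \<open>chi 4\<close> from the duplication formula: 4 is the
  square of a prime field element.\<close>

lemma chi_4: "r \<le> M \<Longrightarrow> chi r 4 = 1"
proof -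
  assume r: "r \<le> M"
  have "chi r (2 * 2) = chi r 2 ^ 2" unfolding mchar_mult[OF mchar_chi[OF r]] by (simp add: power2_eq_square)
  then show ?thesis using chi_fp_square[OF two_fp r] by simp
qed

text \<open>Multiplying \<open>chi r\<close> by the quadratic character gives its power
  \<open>1 + 2^(r-1)\<close>. That exponent is 5 for \<open>r = 3\<close>, which produces a
  conjugate, and 1 modulo 8 from \<open>r = 4\<close> on.\<close>

lemma Gr_duplication:
  assumes r: "2 \<le> r" "r \<le> M"
  shows "Gr r * gauss (\<lambda>x. chi r x ^ (1 + 2^(r-1))) = Gr 1 * Gr (r - 1)"
proof -
  have c: "mchar (chi r)" using mchar_chi r by simp
  have d: "(2::nat)^r dvd q - 1" using two_power_dvd_q_minus_1 r by simp
  have c2: "chr 2 x * chi r x = chi r x ^ (1 + 2^(r-1))" for x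
    using chi_two_power[of 1 "r-1" x] r by (simp add: power_add)
  have cc: "chi r x * chi r x = chi (r-1) x" for x
    using chi_two_power[of "r-1" 1 x] r by (simp add: power2_eq_square)
  have cs: "chi r x * chi r x = chi r x ^ 2" for x by (simp add: power2_eq_square)
  have r2: "(2::nat)^r = 2 * 2^(r-1)" using r by (cases r) auto
  have ev: "even ((2::nat)^(r-1))" using r by simp
  have 1: "nontriv (chi r)" using nontriv_chr_power[OF d, of 1] r by simp
  have 2: "nontriv (\<lambda>x. chi r x * chi r x)" unfolding cs
  proof (intro nontriv_chr_power d notI)
    assume "2^r dvd (2::nat)"
    then have "r \<le> 1" using power_dvd_imp_le[of "2::nat" r 1] by simp
    then show False using r by simp
  qed
  have 3: "nontriv (\<lambda>x. chr 2 x * chi r x)" unfolding c2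
  proof (intro nontriv_chr_power d notI)
    assume "2^r dvd 1 + (2::nat)^(r-1)"
    then have "2 dvd 1 + (2::nat)^(r-1)" unfolding r2 by (rule dvd_mult_left)
    then show False using ev by simp
  qed
  have "2 dvd q - 1" using two_power_dvd_q_minus_1[of 1] M by simp
  from gauss_duplication[OF c this 1 2 3]
  show ?thesis using chi_4 r unfolding cc c2 by (simp add: Gr_def)
qed

text \<open>Exponent 7 fixes a character of order 2, yet acts as complex conjugation on its Gauss
  sum.\<close>

lemma Gr_1_real: "cnj (Gr 1) = Gr 1"
proof -
  have "chi 1 x ^ 7 = chi 1 x" for x
  proof (cases "x = 0")
    case False
    then show ?thesis using power_mod_order[OF chi_order[OF False, of 1], of 7] by simp
  qed (simp add: chr_def)
  then have "gauss (\<lambda>x. chi 1 x ^ 7) = Gr 1" by (simp add: Gr_def)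
  then show ?thesis using gauss_chi_power[of 1 7] M by simp
qed

lemma Gr_1_square: "Gr 1 ^ 2 = of_nat q"
  using Gr_norm[of 1] Gr_1_real M by (simp add: power2_eq_square)

text \<open>For order 8 the left side of the duplication formula is \<open>Gr 3\<close> times its
  conjugate, that is \<open>q = Gr 1 ^ 2\<close>.\<close>

lemma Gr_2: "Gr 2 = Gr 1"
proof -
  have "gauss (\<lambda>x. chi 3 x ^ 5) = cnj (Gr 3)" using gauss_chi_power[of 3 5] M by simp
  then have "Gr 3 * cnj (Gr 3) = Gr 1 * Gr 2" using Gr_duplication[of 3] M by simp
  then have "Gr 1 * Gr 2 = of_nat q" using Gr_norm[of 3] M by simp
  then have "Gr 1 * Gr 2 = Gr 1 * Gr 1" using Gr_1_square by (simp only: power2_eq_square)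
  moreover have "Gr 1 \<noteq> 0" using Gr_1_square q_gt_1 by auto
  ultimately show ?thesis by simp
qed

text \<open>Translation by an element of trace 1 matches the fibres of the trace over 0 and
  1.\<close>

lemma sum_F: "(\<Sum>x\<in>UNIV. F x) = 0"
proof -
  obtain y where y: "tr y \<noteq> 0" using tr_nonzero by auto
  define z where "z = inverse (tr y) * y"
  have z: "tr z = 1" using y tr_scale[OF fp_inverse[OF tr_fp]] by (simp add: z_def)
  have "(\<Sum>x\<in>UNIV. of_bool (tr x = 0) :: int) = (\<Sum>x\<in>UNIV. of_bool (tr (x + (-1) * z) = 0))"
    by (rule sum.reindex_bij_witness[of _ "\<lambda>x. x - z" "\<lambda>x. x + z"]) auto
  also have "\<dots> = (\<Sum>x\<in>UNIV. of_bool (tr x = 1))"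
    unfolding tr_add using tr_scale[OF fp_uminus[OF fp_1], of z] z by simp
  finally show ?thesis by (simp add: F_def sum_subtractf)
qed

text \<open>This congruence fixes the sign of the quadratic Gauss sum.\<close>

lemma Gr_1_cong: "\<exists>n::int. 3 * Gr 1 = of_int (4 * n + 1)"
proof -
  have ee: "gauss (\<lambda>x. chi 2 x ^ j) = (\<Sum>x\<in>UNIV. chi 2 x ^ j * of_int (F x))" if "j > 0" for j
    using chi_fp_trivial[of _ 2] M that by (intro gauss_trivial_fp mchar_power mchar_chi) simp_all
  have 3: "gauss (\<lambda>x. chi 2 x ^ 3) = Gr 1" using gauss_chi_power[of 2 3] M Gr_2 by simp
  have 2: "gauss (\<lambda>x. chi 2 x ^ 2) = Gr 1" using chi_two_power[of 1 1] by (simp add: Gr_def)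
  have 1: "gauss (\<lambda>x. chi 2 x ^ 1) = Gr 1" using Gr_2 by (simp add: Gr_def)
  \<comment> \<open>For \<open>x \<noteq> 0\<close> the sum of all four powers of
    \<open>chi 2 x\<close> is 4 or 0. The missing zeroth power accounts for \<open>- F x\<close>,
    which sums to 0, and the residue 1 is \<open>F 0\<close>.\<close>
  have "3 * Gr 1 = (\<Sum>x\<in>UNIV. (chi 2 x ^ 1 + chi 2 x ^ 2 + chi 2 x ^ 3) * of_int (F x))"
    using ee[of 1] ee[of 2] ee[of 3] 1 2 3 by (simp add: sum.distrib distrib_right)
  also have "\<dots> = (\<Sum>x\<in>UNIV. of_int ((if chi 2 x = 1 then 4 * F x else 0) - F x + (if x = 0 then F x else 0)))"
  proof (rule sum.cong[OF refl])
    fix x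
    show "(chi 2 x ^ 1 + chi 2 x ^ 2 + chi 2 x ^ 3) * of_int (F x) = of_int ((if chi 2 x = 1 then 4 * F x else 0) - F x + (if x = 0 then F x else 0))"
    proof (cases "x = 0")
      case True then show ?thesis by (simp add: chr_def)
    next
      case False
      have "(\<Sum>k<4. chi 2 x ^ k) = (if chi 2 x = 1 then of_nat 4 else 0)"
        using chi_order[OF False, of 2] by (intro sum_roots_of_unity) simp
      then have "chi 2 x ^ 1 + chi 2 x ^ 2 + chi 2 x ^ 3 = (if chi 2 x = 1 then 4 else 0) - 1"
        by (simp add: eval_nat_numeral algebra_simps)
      then show ?thesis unfolding \<open>chi 2 x ^ 1 + chi 2 x ^ 2 + chi 2 x ^ 3 = _\<close> using False by (simp add: algebra_simps)
    qed
  qed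
  also have "\<dots> = of_int ((\<Sum>x\<in>UNIV. if chi 2 x = 1 then 4 * F x else 0) - (\<Sum>x\<in>UNIV. F x) + (\<Sum>x\<in>UNIV. if x = 0 then F x else 0))"
    by (simp only: sum.distrib sum_subtractf of_int_sum[symmetric])
  also have "(\<Sum>x\<in>UNIV. if chi 2 x = 1 then 4 * F x else 0) = 4 * (\<Sum>x\<in>UNIV. if chi 2 x = 1 then F x else 0)"
    unfolding sum_distrib_left by (intro sum.cong refl) simp
  also have "(\<Sum>x\<in>UNIV. if x = 0 then F x else 0) = 1"
  proof -
    have "tr 0 = 0" using tr_scale[OF fp_0, of 0] by simp
    then show ?thesis by (simp add: F_def)
  qed
  finally have "3 * Gr 1 = of_int (4 * (\<Sum>x\<in>UNIV. if chi 2 x = 1 then F x else 0) - 0 + 1)"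
    unfolding sum_F .
  then show ?thesis unfolding diff_0_right by blast
qed

definition s1 :: nat where "s1 = s div 2^(M-2)"

lemma s_eq: "s = 2^(M-2) * s1" "s1 > 0"
proof -
  have "2^((M-2)+2) dvd p ^ s - 1"
  proof -
    have "M - 2 + 2 = M" using M by simp
    then show ?thesis using dvd_M unfolding q_def by metis
  qed
  then have "2^(M-2) dvd s" using M s by (intro two_power_dvd_exponent[OF p8, of "M-2" s]) simp_all
  then show 1: "s = 2^(M-2) * s1" by (simp add: s1_def)
  then show "s1 > 0" using s by (metis gr0I mult_0_right not_one_le_zero)
qed

lemma p_even_power: "even k \<Longrightarrow> p ^ k mod 8 = 1"
proof -
  assume "even k"
  then obtain l where "k = 2 * l" by auto
  then show ?thesis using not_dvd_choose_half_eighth[OF p p8, of l] by simp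
qed

lemma four_dvd_s: "4 dvd s"
proof -
  have "(2::nat)^2 dvd 2^(M-2)" using M by (intro le_imp_power_dvd) auto
  then show ?thesis using s_eq by (metis dvd_mult2 power2_eq_square num_double numeral_times_numeral)
qed

text \<open>\<open>Q\<close> is an even power of \<open>p\<close>, hence 1 modulo 8, so
  \<open>3 * Q\<close> is 3 modulo 4, whereas \<open>3 * Gr 1\<close> is 1 modulo 4. The negative
  root remains.\<close>

lemma Gr_1: "Gr 1 = - of_int (int p ^ (s div 2))"
proof -
  define Q where "Q = int p ^ (s div 2)"
  have "s = s div 2 * 2" using four_dvd_s by presburger
  then have "Q^2 = int q" unfolding Q_def q_def by (simp flip: power_mult)
  then have "Gr 1 ^ 2 = of_int Q ^ 2" using Gr_1_square by (metis of_int_of_nat_eq of_int_power)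
  then have "Gr 1 = of_int Q \<or> Gr 1 = - of_int Q" by (simp add: power2_eq_iff)
  moreover have "Gr 1 \<noteq> of_int Q"
  proof
    assume "Gr 1 = of_int Q"
    moreover obtain n :: int where "3 * Gr 1 = of_int (4 * n + 1)" using Gr_1_cong by blast
    ultimately have "(of_int (3 * Q) :: complex) = of_int (4 * n + 1)" by simp
    then have "3 * Q = 4 * n + 1" using of_int_eq_iff by blast
    moreover have "Q mod 8 = 1"
    proof -
      have "even (s div 2)" using four_dvd_s by presburger
      then have "int (p ^ (s div 2) mod 8) = 1" using p_even_power by simp
      then show ?thesis by (simp add: Q_def zmod_int)
    qed
    ultimately show False by presburger
  qed
  ultimately show ?thesis by (simp add: Q_def)
qed

end

section \<open>The exact value of the Gauss sums\<close>

lemma zs_square_norm: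
  assumes "zs a b ^ 2 = zs c d"
  shows "(a^2 + 2 * b^2)^2 = c^2 + 2 * d^2"
proof -
  have "zs (a^2 - 2 * b^2) (2 * a * b) = zs c d"
    using assms by (simp add: power2_eq_square zs_mult algebra_simps)
  then have cd: "c = a^2 - 2 * b^2" "d = 2 * a * b" by (auto simp: zs_eq_iff)
  show ?thesis unfolding cd by (simp add: power2_eq_square algebra_simps)
qed

lemma zs_sqrt_prime_power:
  fixes P :: int
  assumes P: "prime P" "odd P" and z: "zs x y ^ 2 = of_int (P^j) * zs c d" and prim: "\<not> (P dvd c \<and> P dvd d)"
  shows "even j \<and> (\<exists>a b. zs x y = of_int (P^(j div 2)) * zs a b \<and> zs a b ^ 2 = zs c d)"
proof -
  have "zs (x^2 - 2 * y^2) (2 * x * y) = zs (P^j * c) (P^j * d)"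
    using z unfolding power2_eq_square zs_mult zs_scale zs_eq_iff by (simp add: algebra_simps)
  then have 1: "x^2 - 2 * y^2 = P^j * c" "2 * x * y = P^j * d" by (auto simp: zs_eq_iff)
  from zs_square_prime_power[OF P 1 prim] obtain a b where "even j"
    and ab: "x = P^(j div 2) * a" "y = P^(j div 2) * b" "a^2 - 2 * b^2 = c" "2 * a * b = d" by blast
  have "zs a b ^ 2 = zs c d"
    using ab(3,4) by (simp add: power2_eq_square zs_mult zs_eq_iff algebra_simps)
  moreover have "zs x y = of_int (P^(j div 2)) * zs a b" unfolding zs_scale using ab by simp
  ultimately show ?thesis using \<open>even j\<close> by blast
qed

lemma zs_primitive_sqrt:
  assumes "zs a b ^ 2 = zs c d" "\<not> (n dvd c \<and> n dvd d)"
  shows "\<not> (n dvd a \<and> n dvd b)"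
proof
  assume "n dvd a \<and> n dvd b"
  moreover have "zs (a^2 - 2 * b^2) (2 * a * b) = zs c d"
    using assms by (simp add: power2_eq_square zs_mult algebra_simps)
  then have "c = a^2 - 2 * b^2" "d = 2 * a * b" by (auto simp: zs_eq_iff)
  ultimately show False using assms by (auto simp: power2_eq_square)
qed

lemma int_square_mod_8:
  fixes a :: int
  shows "a^2 mod 8 = 0 \<or> a^2 mod 8 = 1 \<or> a^2 mod 8 = 4"
proof -
  have e: "a^2 mod 8 = (a mod 8)^2 mod 8" by (simp add: power_mod)
  have "a mod 8 = 0 \<or> a mod 8 = 1 \<or> a mod 8 = 2 \<or> a mod 8 = 3 \<or> a mod 8 = 4 \<or> a mod 8 = 5 \<or> a mod 8 = 6 \<or> a mod 8 = 7"
    by presburger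
  then show ?thesis unfolding e by (elim disjE) simp_all
qed

text \<open>\<open>2 * b^2 - a^2\<close> is the real part of minus the square of
  \<open>zs a b\<close>, whose norm is \<open>a^2 + 2 * b^2\<close>.\<close>

lemma form_mod8_one:
  fixes a b :: int
  assumes "(a^2 + 2 * b^2) mod 8 = 1"
  shows "(2 * b^2 - a^2) mod 4 = 3"
proof -
  have "(2 * y - x) mod 4 = 3"
    if "(x + 2 * y) mod 8 = 1" "x mod 8 = 0 \<or> x mod 8 = 1 \<or> x mod 8 = 4" "y mod 8 = 0 \<or> y mod 8 = 1 \<or> y mod 8 = 4"
    for x y :: int
    using that(2,3,1) by (elim disjE) presburger+
  then show ?thesis using assms int_square_mod_8 by blast
qed

text \<open>Counterpart for odd powers of \<open>p\<close> as norm: the square itself is taken,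
  since a factor of square \<open>-p\<close> absorbs the sign.\<close>

lemma form_mod8_three:
  fixes a b :: int
  assumes "(a^2 + 2 * b^2) mod 8 = 3"
  shows "(a^2 - 2 * b^2) mod 4 = 3"
proof -
  have "(x - 2 * y) mod 4 = 3"
    if "(x + 2 * y) mod 8 = 3" "x mod 8 = 0 \<or> x mod 8 = 1 \<or> x mod 8 = 4" "y mod 8 = 0 \<or> y mod 8 = 1 \<or> y mod 8 = 4"
    for x y :: int
    using that(2,3,1) by (elim disjE) presburger+
  then show ?thesis using assms int_square_mod_8 by blast
qed

context field_two_power
begin

lemma prime_int: "prime (int p)" "odd (int p)"
proof -
  show "prime (int p)" using p by simp
  have "odd p" using p8 by presburger
  then show "odd (int p)" by simp
qed

lemma g_power_eq_1: "g ^ j = 1 \<longleftrightarrow> (q - 1) dvd j"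
proof
  assume "g ^ j = 1"
  then show "(q - 1) dvd j" using ind_g[of j] ind_g[of 0] by (simp add: mod_eq_0_iff_dvd)
next
  assume "(q - 1) dvd j"
  then show "g ^ j = 1" using power_q_minus_1[OF g_nonzero] by (auto elim!: dvdE simp: power_mult)
qed

lemma power_sum:
  assumes "j > 0"
  shows "(\<Sum>x\<in>UNIV. x ^ j) = (if (q - 1) dvd j then -1 else (0::'a))"
proof -
  have "(\<Sum>x\<in>UNIV. x ^ j) = 0 ^ j + (\<Sum>x\<in>UNIV - {0::'a}. x ^ j)" by (rule sum.remove) auto
  also have "\<dots> = (\<Sum>i<q - 1. (g ^ j) ^ i)"
    using assms by (simp add: sum_units zero_power mult.commute flip: power_mult)
  also have "\<dots> = (if (q - 1) dvd j then -1 else 0)"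
  proof (cases "g ^ j = 1")
    case True
    have "p dvd q" using s by (simp add: q_def)
    then have "of_nat q = (0::'a)" using of_nat_eq_0_iff by simp
    then have "of_nat (q - 1) = (-1::'a)" using q_gt_1 by (simp add: of_nat_diff)
    then show ?thesis using True g_power_eq_1[of j] by simp
  next
    case False
    have "(g ^ j) ^ (q - 1) = 1" using power_q_minus_1[of "g ^ j"] g_nonzero by simp
    then show ?thesis using False g_power_eq_1[of j] geometric_sum[OF False, of "q - 1"] by simp
  qed
  finally show ?thesis .
qed

definition E :: nat where "E = (q - 1) div 8"

lemma q_minus_1_eq: "q - 1 = 8 * E" "E > 0"
proof -
  have "8 dvd q - 1" using two_power_dvd_q_minus_1[of 3] M by simp
  then show 1: "q - 1 = 8 * E" by (simp add: E_def)
  show "E > 0" using 1 q_gt_1 by (cases E) auto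
qed

lemma g_4E: "g ^ (4 * E) = -1"
proof -
  have "(g ^ (4 * E)) ^ 2 = 1" using power_q_minus_1[OF g_nonzero] q_minus_1_eq by (simp flip: power_mult)
  then have "g ^ (4 * E) = 1 \<or> g ^ (4 * E) = -1" by (simp add: power2_eq_1_iff)
  moreover have "g ^ (4 * E) \<noteq> 1" unfolding g_power_eq_1 q_minus_1_eq(1) using q_minus_1_eq(2) by (auto dest!: dvd_imp_le)
  ultimately show ?thesis by simp
qed

text \<open>The quadratic character with integer values, so that one function can be read in the
  complex numbers and in the finite field.\<close>

definition eta :: "'a \<Rightarrow> int" where
  "eta y = (if y = 0 then 0 else if even (ind y) then 1 else -1)"

lemma eta_chr: "of_int (eta y) = chr 2 y"
proof (cases "y = 0")
  case False
  have d: "2 dvd q - 1" using q_minus_1_eq by simp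
  have "chr 2 y = chr 2 (g ^ ind y)" using g_ind[OF False] by simp
  also have "\<dots> = cis pi ^ ind y" unfolding chr_g[OF d] by (simp add: DeMoivre mult.commute del: cis_pi)
  finally show ?thesis using False by (simp add: eta_def)
qed (simp add: eta_def chr_def)

lemma eta_power: "of_int (eta y) = (y::'a) ^ (4 * E)"
proof (cases "y = 0")
  case False
  have "y ^ (4 * E) = (g ^ ind y) ^ (4 * E)" using g_ind[OF False] by simp
  also have "\<dots> = (g ^ (4 * E)) ^ ind y" by (simp add: mult.commute flip: power_mult)
  finally show ?thesis using False by (simp add: eta_def g_4E)
qed (use q_minus_1_eq in \<open>simp add: eta_def zero_power\<close>)

lemma eta_frob: "eta (y ^ p) = eta y"
proof -
  have "odd p" using p8 by presburger
  have "mchar (chr 2)" using q_minus_1_eq by (intro mchar_chr) simp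
  then have "of_int (eta (y ^ p)) = chr 2 y ^ p" unfolding eta_chr by (rule mchar_pow)
  also have "\<dots> = of_int (eta y ^ p)" unfolding of_int_power eta_chr ..
  finally have "eta (y ^ p) = eta y ^ p" using of_int_eq_iff by blast
  moreover have "eta y = 0 \<or> eta y = 1 \<or> eta y = -1" by (simp add: eta_def)
  ultimately show ?thesis using \<open>odd p\<close> odd_pos[OF \<open>odd p\<close>] by (auto simp: zero_power)
qed

lemma eta_one_minus_frob: "eta (1 - x ^ p) = eta (1 - x)"
proof -
  have "(1 + (-x)) ^ p = 1 + (-x) ^ p" using frob_add[of 1 "-x" 1] by simp
  moreover have "(-x) ^ p = - (x ^ p)" using prime_int by (simp add: power_minus_odd)
  ultimately have "1 - x ^ p = (1 - x) ^ p" by simp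
  then show ?thesis by (simp add: eta_frob)
qed

definition J :: complex where "J = jacobi (chi 3) (chi 1)"

lemma J_eq: "J = (\<Sum>x\<in>UNIV. chi 3 x * of_int (eta (1 - x)))"
  by (simp add: J_def jacobi_def eta_chr)

lemma chi3_g: "chi 3 (g ^ i) = omega ^ (i mod 8)"
proof -
  have "chi 3 (g ^ i) = cis (2 * pi * real i / real (2^3))" using two_power_dvd_q_minus_1[of 3] M by (intro chr_g) simp
  also have "\<dots> = omega ^ i" unfolding omega_cis DeMoivre by (simp add: mult_ac)
  also have "omega ^ i = omega ^ (i mod 8)"
  proof (rule power_mod_order)
    have "omega ^ 8 = (omega ^ 4) ^ 2" by (simp flip: power_mult)
    then show "omega ^ 8 = 1" by (simp add: omega_4)
  qed
  finally show ?thesis .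
qed

text \<open>The image of the Jacobi sum under reduction modulo a prime above \<open>p\<close>; the exponent \<open>7 * E\<close> selects
  the prime at which it does not vanish.\<close>

lemma binomial_char_sum:
  "(\<Sum>x\<in>UNIV. x ^ (7 * E) * (1 - x) ^ (4 * E)) \<noteq> (0::'a)"
proof -
  have "(\<Sum>x\<in>UNIV. x ^ (7 * E) * (1 - x) ^ (4 * E)) =
     (\<Sum>x\<in>UNIV. \<Sum>k\<le>4 * E. of_nat (4 * E choose k) * (-1) ^ k * (x::'a) ^ (7 * E + k))"
  proof (rule sum.cong[OF refl])
    fix x :: 'a
    have "(1 - x) ^ (4 * E) = (- x + 1) ^ (4 * E)" by simp
    also have "\<dots> = (\<Sum>k\<le>4 * E. of_nat (4 * E choose k) * (- x) ^ k * 1 ^ (4 * E - k))"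
      by (rule binomial_ring)
    finally show "x ^ (7 * E) * (1 - x) ^ (4 * E) = (\<Sum>k\<le>4 * E. of_nat (4 * E choose k) * (-1) ^ k * x ^ (7 * E + k))"
      by (simp add: sum_distrib_left power_add power_minus[of x] mult_ac)
  qed
  also have "\<dots> = (\<Sum>k\<le>4 * E. of_nat (4 * E choose k) * (-1) ^ k * (\<Sum>x\<in>UNIV. (x::'a) ^ (7 * E + k)))"
    by (subst sum.swap) (simp add: sum_distrib_left)
  also have "\<dots> = (\<Sum>k\<le>4 * E. if k = E then - (of_nat (4 * E choose E) * (-1) ^ E) else 0)"
  proof (rule sum.cong[OF refl])
    fix k assume k: "k \<in> {..4 * E}"
    \<comment> \<open>\<open>7 * E + k\<close> lies between \<open>7 * E\<close> and
      \<open>11 * E\<close>, where \<open>8 * E\<close> is the only multiple of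
      \<open>q - 1\<close>.\<close>
    have "(q - 1) dvd 7 * E + k \<longleftrightarrow> k = E"
    proof
      assume "(q - 1) dvd 7 * E + k"
      then obtain c where c: "7 * E + k = 8 * E * c" using q_minus_1_eq by (auto elim!: dvdE)
      then have "c = 1"
      proof -
        have "c \<noteq> 0" using c q_minus_1_eq(2) by (cases c) auto
        moreover have "c < 2"
        proof (rule ccontr)
          assume "\<not> c < 2"
          then have "8 * E * 2 \<le> 8 * E * c" by (intro mult_le_mono2) simp
          moreover have "k \<le> 4 * E" using k by simp
          ultimately show False using c q_minus_1_eq(2) by linarith
        qed
        ultimately show ?thesis by simp
      qed
      then show "k = E" using c by simp
    qed (use q_minus_1_eq(1) in simp)
    then show "of_nat (4 * E choose k) * (-1) ^ k * (\<Sum>x\<in>UNIV. (x::'a) ^ (7 * E + k))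
        = (if k = E then - (of_nat (4 * E choose E) * (-1) ^ E) else 0)"
      using power_sum[of "7 * E + k"] q_minus_1_eq(2) by simp
  qed
  also have "\<dots> = - (of_nat (4 * E choose E) * (-1) ^ E)" by simp
  also have "\<dots> \<noteq> 0"
  proof -
    have "s = 2 * (s div 2)" using four_dvd_s by presburger
    then have "q = p ^ (2 * (s div 2))" unfolding q_def by metis
    then have "\<not> p dvd ((q - 1) div 2 choose ((q - 1) div 8))"
      using not_dvd_choose_half_eighth[OF p p8, of "s div 2"] by simp
    then have "\<not> p dvd (4 * E choose E)" using q_minus_1_eq by simp
    then show ?thesis using of_nat_eq_0_iff by simp
  qed
  finally show ?thesis .
qed

lemma eighth_chi3: "eighth (chi 3) = UNIV - {0}"
  using chi_order[of _ 3] by (auto simp: eighth_def chr_def)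

text \<open>The coordinates \<open>c\<close> and \<open>d\<close> make sense in both worlds:
  replacing \<open>omega\<close> by \<open>v = g^(7 * E)\<close>, another root of X^4 + 1, turns
  \<open>J\<close> into the field element \<open>S\<close>, with \<open>v + v^3\<close> in the role
  of \<open>sqrt(-2)\<close>. If \<open>p\<close> divided both coordinates, \<open>S\<close> would
  vanish, contrary to \<open>binomial_char_sum\<close>.\<close>

lemma J_primitive: "\<exists>c d. J = zs c d \<and> \<not> (int p dvd c \<and> int p dvd d)"
proof -
  define f where "f x = eta (1 - x)" for x
  have f: "f (x ^ p) = f x" for x by (simp add: f_def eta_one_minus_frob)
  have mc: "mchar (chi 3)" using M by (intro mchar_chi) simp
  define c where "c = (\<Sum>x\<in>UNIV - {0}. sgn_pm1 (chi 3 x) * f x)"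
  define d where "d = (\<Sum>x\<in>UNIV - {0}. sgn_omega (chi 3 x) * f x)"
  have "(\<Sum>x\<in>UNIV. chi 3 x * of_int (f x)) = zs c d"
    unfolding c_def d_def eighth_chi3[symmetric]
    by (rule frob_sum_zs[where f = f and R = 3, OF mc f _ chi_order]) simp_all
  then have J: "J = zs c d" by (simp add: J_eq f_def)
  define v where "v = g ^ (7 * E)"
  have v4: "v ^ 4 = -1"
  proof -
    have "v ^ 4 = (g ^ (4 * E)) ^ 7" unfolding v_def by (simp add: mult.commute flip: power_mult)
    then show ?thesis by (simp add: g_4E)
  qed
  have v8: "v ^ 8 = 1"
  proof -
    have "v ^ 8 = (v ^ 4) ^ 2" by (simp flip: power_mult)
    then show ?thesis by (simp add: v4)
  qed
  have o8: "omega ^ 8 = 1"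
  proof -
    have "omega ^ 8 = (omega ^ 4) ^ 2" by (simp flip: power_mult)
    then show ?thesis by (simp add: omega_4)
  qed
  have vk: "v ^ 5 = - v" "v ^ 6 = - (v^2)" "v ^ 7 = - (v^3)"
    using v4 power_add[of v 4 1] power_add[of v 4 2] power_add[of v 4 3] by simp_all
  have wk: "omega ^ 5 = - omega" "omega ^ 6 = - \<i>" "omega ^ 7 = - (\<i> * omega)"
    using omega_4 power_add[of omega 4 1] power_add[of omega 4 2] power_add[of omega 4 3] omega_cube omega_square by simp_all
  define th where "th x = (x::'a) ^ (7 * E)" for x
  have th_g: "th (g ^ i) = v ^ (i mod 8)" for i
  proof -
    have "th (g ^ i) = v ^ i" by (simp add: th_def v_def mult.commute flip: power_mult)
    then show ?thesis using power_mod_order[OF v8] by simp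
  qed
  have ii: "\<i> \<noteq> 1" "\<i> \<noteq> -1" "- \<i> \<noteq> 1" "-\<i> \<noteq> -1" "omega \<noteq> 0" by (auto simp: complex_eq_iff omega_def)
  \<comment> \<open>The analogue of \<open>eighth_root_trace\<close> in the finite field; the table
    of powers of \<open>v\<close> rests on \<open>v ^ 4 = -1\<close> alone.\<close>
  have pt: "th x + th x ^ 3 = of_int (2 * sgn_pm1 (chi 3 x)) + (v + v^3) * of_int (sgn_omega (chi 3 x) + sgn_omega (chi 3 x ^ 3))"
    if "x \<noteq> 0" for x
  proof -
    define k where "k = ind x mod 8"
    have 1: "th x = v ^ k" using th_g[of "ind x"] g_ind[OF that] by (simp add: k_def)
    have 2: "chi 3 x = omega ^ k" using chi3_g[of "ind x"] g_ind[OF that] by (simp add: k_def)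
    have 3: "th x ^ 3 = v ^ ((3 * k) mod 8)" unfolding 1 using power_mod_order[OF v8, of "3 * k"] by (simp add: mult.commute flip: power_mult)
    have 4: "chi 3 x ^ 3 = omega ^ ((3 * k) mod 8)" unfolding 2 using power_mod_order[OF o8, of "3 * k"] by (simp add: mult.commute flip: power_mult)
    have "k < 8" by (simp add: k_def)
    then have "k = 0 \<or> k = 1 \<or> k = 2 \<or> k = 3 \<or> k = 4 \<or> k = 5 \<or> k = 6 \<or> k = 7" by linarith
    then show ?thesis unfolding 3 4 unfolding 1 2
      by (elim disjE; hypsubst) (simp_all add: v4 vk wk omega_4 omega_square omega_cube sgn_pm1_def sgn_omega_def ii omega_distinct omega_distinct[symmetric])
  qed
  define S where "S = (\<Sum>x\<in>UNIV - {0}. th x * of_int (f x))"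
  have S0: "S \<noteq> 0"
  proof -
    have "S = (\<Sum>x\<in>UNIV. x ^ (7 * E) * (1 - x) ^ (4 * E))"
      unfolding S_def using q_minus_1_eq(2) by (intro sum.mono_neutral_cong_left) (auto simp: th_def f_def eta_power zero_power)
    then show ?thesis using binomial_char_sum by simp
  qed
  \<comment> \<open>Frobenius cubes \<open>th x\<close>, an eighth root of unity, exactly as it
    cubes the complex character.\<close>
  have "S = (\<Sum>x\<in>UNIV - {0}. th (x ^ (p ^ 1)) * of_int (f (x ^ (p ^ 1))))"
    unfolding S_def by (rule frob_iter_reindex[symmetric]) auto
  also have "\<dots> = (\<Sum>x\<in>UNIV - {0}. th x ^ 3 * of_int (f x))"
  proof (rule sum.cong[OF refl])
    fix x :: 'a assume "x \<in> UNIV - {0}"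
    then have "th x = v ^ (ind x mod 8)" using th_g[of "ind x"] g_ind[of x] by simp
    then have "th x ^ 8 = 1" using v8 by (metis mult.commute power_mult power_one)
    then have "th x ^ p = th x ^ 3" using power_mod_order[of "th x" 8 p] p8 by simp
    moreover have "th (x ^ p) = th x ^ p" by (simp add: th_def mult.commute flip: power_mult)
    ultimately show "th (x ^ (p ^ 1)) * of_int (f (x ^ (p ^ 1))) = th x ^ 3 * of_int (f x)" by (simp add: f)
  qed
  finally have "2 * S = (\<Sum>x\<in>UNIV - {0}. (th x + th x ^ 3) * of_int (f x))"
    by (simp add: S_def sum.distrib algebra_simps)
  also have "\<dots> = (\<Sum>x\<in>UNIV - {0}. of_int (2 * (sgn_pm1 (chi 3 x) * f x)) + (v + v^3) * of_int (sgn_omega (chi 3 x) * f x + sgn_omega (chi 3 x ^ 3) * f x))"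
    by (intro sum.cong refl) (simp add: pt algebra_simps)
  also have "\<dots> = of_int (2 * c) + (v + v^3) * of_int (d + (\<Sum>x\<in>UNIV - {0}. sgn_omega (chi 3 x ^ 3) * f x))"
    unfolding c_def d_def of_int_add of_int_mult of_int_sum sum.distrib sum_distrib_left by (simp add: sum.distrib sum_distrib_left distrib_left)
  also have "(\<Sum>x\<in>UNIV - {0}. sgn_omega (chi 3 x ^ 3) * f x) = d"
    unfolding d_def using eighth_frob_sum[where f = f and h = sgn_omega, OF mc f] unfolding eighth_chi3 by simp
  finally have S2: "2 * S = of_int (2 * c) + (v + v^3) * of_int (d + d)" .
  have "\<not> (int p dvd c \<and> int p dvd d)"
  proof
    assume "int p dvd c \<and> int p dvd d"
    then have "int p dvd 2 * c" "int p dvd d + d" by auto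
    then have "of_int (2 * c) = (0::'a)" "of_int (d + d) = (0::'a)" using of_int_eq_0_iff by blast+
    then have "2 * S = 0" using S2 by (simp only: mult_zero_right add_0_right)
    then show False using S0 two_fp by simp
  qed
  then show ?thesis using J by blast
qed

text \<open>\<open>l r\<close> is \<open>s / 2^(r-1)\<close>, so that \<open>A\<^sub>r\<^sup>2 + 2 B\<^sub>r\<^sup>2 = p^(2 * l r)\<close>.\<close>

definition l :: "nat \<Rightarrow> nat" where "l r = 2^(M - 1 - r) * s1"

lemma s_half: "s = 2 * (s div 2)" "s div 2 = 2 * l 3" "even (s div 2)"
proof -
  show "s = 2 * (s div 2)" "even (s div 2)" using four_dvd_s by presburger+
  have "M - 2 = (M - 4) + 2" using M by simp
  then have "s = 2^((M - 4) + 2) * s1" using s_eq(1) by metis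
  then have "s = 4 * (2^(M - 4) * s1)" by (simp add: power_add)
  moreover have "l 3 = 2^(M - 4) * s1" by (simp add: l_def)
  ultimately show "s div 2 = 2 * l 3" by simp
qed

lemma l_pos: "l r > 0" using s_eq by (simp add: l_def)

lemma l_Suc: "Suc r \<le> M - 1 \<Longrightarrow> l r = 2 * l (Suc r)"
proof -
  assume r: "Suc r \<le> M - 1"
  then have "M - 1 - r = Suc (M - 1 - Suc r)" by linarith
  then show ?thesis by (simp add: l_def)
qed

lemma l_le: "3 \<le> r \<Longrightarrow> r \<le> M - 1 \<Longrightarrow> 2 * l r \<le> s div 2"
proof (induction r rule: dec_induct)
  case base show ?case using s_half by simp
next
  case (step r)
  then show ?case using l_Suc[of r] by simp
qed

text \<open>\<open>1 + 2^r\<close> is congruent to the Frobenius power \<open>p ^ (2^(r-2))\<close>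
  modulo \<open>2^(r+1)\<close>, so the second factor of the duplication formula is
  \<open>Gr (Suc r)\<close> again. Unlike \<open>gauss_chi_power\<close>, this argument covers the
  top order \<open>Suc r = M\<close>.\<close>

lemma Gr_Suc_square:
  assumes r: "3 \<le> r" "r < M"
  shows "Gr (Suc r) ^ 2 = Gr 1 * Gr r"
proof -
  have "[p ^ (2^(r-2)) = 1 + 2^(r-2+2)] (mod 2^(r-2+3))"
    by (rule power_two_power_cong[OF p8]) (use r in simp)
  moreover have "r - 2 + 2 = r" "r - 2 + 3 = Suc r" using r by auto
  ultimately have pc: "[p ^ (2^(r-2)) = 1 + 2^r] (mod 2^(Suc r))" by metis
  have "chi (Suc r) x ^ (1 + 2^r) = chi (Suc r) x ^ (p ^ (2^(r-2)))" for x
  proof (cases "x = 0")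
    case True
    have "p > 0" using p prime_gt_0_nat by blast
    then show ?thesis using True by (simp add: chr_def zero_power)
  next
    case False
    show ?thesis using power_mod_order[OF chi_order[OF False, of "Suc r"]] pc by (metis cong_def)
  qed
  then have "gauss (\<lambda>x. chi (Suc r) x ^ (1 + 2^r)) = Gr (Suc r)"
    using gauss_frob[of "chi (Suc r)" "2^(r-2)"] mchar_chi[of "Suc r"] r by (simp add: Gr_def)
  then show ?thesis using Gr_duplication[of "Suc r"] r by (simp add: power2_eq_square)
qed

text \<open>The product of the two characters is \<open>chi 3 ^ 5\<close>, whose Gauss sum is the
  conjugate of \<open>Gr 3\<close>. Multiplying the Jacobi relation by \<open>Gr 3\<close> turns the
  conjugate into the norm \<open>q = Gr 1 ^ 2\<close>.\<close>

lemma Gr_3_square: "Gr 3 ^ 2 = - of_int (int p ^ (s div 2)) * J"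
proof -
  have m: "mchar (chi 3)" "mchar (chi 1)" using M by (intro mchar_chi; simp)+
  have c5: "chi 3 x * chi 1 x = chi 3 x ^ 5" for x
    using chi_two_power[of 1 2 x] power_add[of "chi 3 x" 1 4] by simp
  have n: "nontriv (\<lambda>x. chi 3 x * chi 1 x)" unfolding c5
    by (rule nontriv_chr_power) (use two_power_dvd_q_minus_1[of 3] M in auto)
  have "gauss (\<lambda>x. chi 3 x * chi 1 x) = cnj (Gr 3)" unfolding c5 using gauss_chi_power[of 3 5] M by simp
  then have "Gr 3 * Gr 1 = J * cnj (Gr 3)" using gauss_jacobi[OF m n] by (simp only: Gr_def J_def)
  then have "Gr 3 ^ 2 * Gr 1 = J * (Gr 3 * cnj (Gr 3))" by (simp add: power2_eq_square mult_ac)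
  also have "Gr 3 * cnj (Gr 3) = Gr 1 * Gr 1" using Gr_norm[of 3] M Gr_1_square by (simp add: power2_eq_square)
  finally have "Gr 1 * (Gr 3 ^ 2) = Gr 1 * (Gr 1 * J)" by (simp add: mult_ac)
  moreover have "Gr 1 \<noteq> 0" using Gr_1_square q_gt_1 by auto
  ultimately have "Gr 3 ^ 2 = Gr 1 * J" by simp
  then show ?thesis unfolding Gr_1 .
qed

lemma not_dvd_real_part:
  assumes "a^2 + 2 * b^2 = int p ^ k" "k > 0" "\<not> (int p dvd a \<and> int p dvd b)"
  shows "\<not> int p dvd a"
proof
  assume a: "int p dvd a"
  then have "int p dvd a^2" by (simp add: power2_eq_square)
  moreover have "int p dvd int p ^ k" using assms by simp
  ultimately have "int p dvd 2 * b^2" using assms(1) by (metis dvd_add_right_iff)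
  moreover have "\<not> int p dvd 2"
  proof -
    have "p \<ge> 3" using p8 by presburger
    then show ?thesis by (auto dest!: zdvd_imp_le)
  qed
  ultimately have "int p dvd b" using prime_int by (simp add: prime_dvd_mult_iff prime_dvd_power_iff)
  then show False using a assms by simp
qed

text \<open>Each square root halves the exponent of \<open>p\<close>: from \<open>s div 2\<close> at
  the start, and from \<open>s div 2 + (s div 2 - l r) = s - l r\<close> at each later level, where
  \<open>l r = 2 * l (Suc r)\<close>. Primitivity starts with \<open>J\<close> and is handed on,
  which makes the powers exact and keeps \<open>p\<close> out of \<open>a\<close>.\<close>

lemma Gr_form:
  assumes "3 \<le> r" "r \<le> M - 1"
  shows "\<exists>a b. Gr r = of_int (int p ^ (s div 2 - l r)) * zs a b \<and> a^2 + 2 * b^2 = int p ^ (2 * l r) \<and> \<not> int p dvd a"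
  using assms
proof (induction r rule: dec_induct)
  case base
  obtain c d where cd: "J = zs c d" "\<not> (int p dvd c \<and> int p dvd d)" using J_primitive by blast
  obtain x y where xy: "Gr 3 = zs x y" using Gr_zs[of 3] M by auto
  have "zs x y ^ 2 = of_int (int p ^ (s div 2)) * zs (-c) (-d)"
    using Gr_3_square unfolding xy cd zs_uminus[symmetric] by simp
  from zs_sqrt_prime_power[OF prime_int this] cd(2) obtain a b where
    ab: "zs x y = of_int (int p ^ (s div 2 div 2)) * zs a b" "zs a b ^ 2 = zs (-c) (-d)" by auto
  have e: "s div 2 div 2 = s div 2 - l 3" "s div 2 div 2 = l 3" using s_half by auto
  have G: "Gr 3 = of_int (int p ^ (l 3)) * zs a b" using xy ab e by simp
  have "of_int (int p ^ (l 3) * int p ^ (l 3) * (a^2 + 2 * b^2)) = (of_int (int p ^ (l 3)) * zs a b) * cnj (of_int (int p ^ (l 3)) * zs a b)"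
    using zs_mult_cnj[of a b] by (simp add: mult_ac)
  also have "\<dots> = of_int (int p ^ s)" using Gr_norm[of 3] M unfolding G by (simp add: q_def)
  finally have "int p ^ (l 3) * int p ^ (l 3) * (a^2 + 2 * b^2) = int p ^ s" using of_int_eq_iff by blast
  also have "int p ^ s = int p ^ (l 3) * int p ^ (l 3) * int p ^ (2 * l 3)"
    using s_half by (simp flip: power_add)
  finally have nn: "a^2 + 2 * b^2 = int p ^ (2 * l 3)" using prime_int by auto
  have "\<not> (int p dvd a \<and> int p dvd b)" using zs_primitive_sqrt[OF ab(2)] cd(2) by auto
  then have "\<not> int p dvd a" using not_dvd_real_part[OF nn] l_pos by simp
  then show ?case using nn G e by metis
next
  case (step r)
  then obtain c d where cd: "Gr r = of_int (int p ^ (s div 2 - l r)) * zs c d" "c^2 + 2 * d^2 = int p ^ (2 * l r)" "\<not> int p dvd c"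
    by auto
  have r: "Suc r \<le> M - 1" using step by simp
  have "Suc r < M" using r M by linarith
  then obtain x y where xy: "Gr (Suc r) = zs x y" using Gr_zs by blast
  have ex: "s div 2 + (s div 2 - l r) = s - l r" using l_le[of r] step s_half(1) by linarith
  have "Gr (Suc r) ^ 2 = Gr 1 * Gr r" using Gr_Suc_square step by simp
  also have "\<dots> = of_int (int p ^ (s div 2 + (s div 2 - l r))) * zs (-c) (-d)"
    unfolding Gr_1 cd(1) power_add zs_uminus[symmetric] by simp
  finally have "zs x y ^ 2 = of_int (int p ^ (s - l r)) * zs (-c) (-d)" unfolding xy ex .
  from zs_sqrt_prime_power[OF prime_int this] cd(3) obtain a b where
    ab: "zs x y = of_int (int p ^ ((s - l r) div 2)) * zs a b" "zs a b ^ 2 = zs (-c) (-d)" by auto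
  have e: "(s - l r) div 2 = s div 2 - l (Suc r)" using l_Suc[OF r] by simp
  have "(a^2 + 2 * b^2)^2 = c^2 + 2 * d^2" using zs_square_norm[OF ab(2)] by simp
  also have "\<dots> = (int p ^ l r)^2" using cd(2) by (simp add: mult.commute flip: power_mult)
  finally have "a^2 + 2 * b^2 = int p ^ l r" by (simp add: power2_eq_iff_nonneg)
  then have nn: "a^2 + 2 * b^2 = int p ^ (2 * l (Suc r))" using l_Suc[OF r] by simp
  have "\<not> (int p dvd a \<and> int p dvd b)" using zs_primitive_sqrt[OF ab(2)] cd(3) by auto
  then have "\<not> int p dvd a" using not_dvd_real_part[OF nn] l_pos by simp
  then show ?case using nn xy ab(1) e by metis
qed

lemma int_p_power_mod8: "int p ^ k mod 8 = (if even k then 1 else 3)"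
proof (cases "even k")
  case True
  then have "int (p ^ k mod 8) = 1" using p_even_power by simp
  then show ?thesis using True by (simp add: zmod_int)
next
  case False
  then obtain j where j: "k = 2 * j + 1" by (auto elim: oddE)
  have "int (p ^ (2 * j) mod 8) = 1" using p_even_power by simp
  then have "int p ^ (2 * j) mod 8 = 1" by (simp add: zmod_int)
  moreover have "int p mod 8 = 3" using p8 by presburger
  ultimately have "(int p ^ (2 * j) * int p) mod 8 = 3" by (metis mod_mult_eq mult_1 mod_mod_trivial)
  then show ?thesis using False j by (simp add: mult.commute)
qed

text \<open>Whether the character of order \<open>2^(r+1)\<close> is trivial on the prime field decides the parity of \<open>l r\<close>;
  both cases lead to the same congruence for \<open>c\<close>.\<close>

lemma Gr_form_sign:
  assumes r: "3 \<le> r" "r \<le> M - 1"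
    and G: "Gr r = of_int (int p ^ (s div 2 - l r)) * zs c d" and n: "c^2 + 2 * d^2 = int p ^ (2 * l r)"
    and pc: "\<not> int p dvd c"
  shows "c mod 4 = 3"
proof -
  have rM: "Suc r \<le> M" "r < M" using r M by auto
  have mc: "mchar (chi (Suc r))" by (rule mchar_chi[OF rM(1)])
  have ex: "s div 2 + (s div 2 - l r) = s - l r" using l_le[of r] r s_half(1) by linarith
  have "Gr (Suc r) ^ 2 = Gr 1 * Gr r" using Gr_Suc_square r rM by simp
  also have "\<dots> = of_int (int p ^ (s div 2 + (s div 2 - l r))) * zs (-c) (-d)"
    unfolding Gr_1 G power_add zs_uminus[symmetric] by simp
  finally have sq: "Gr (Suc r) ^ 2 = of_int (int p ^ (s - l r)) * zs (-c) (-d)" unfolding ex .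
  have nrm: "a^2 + 2 * b^2 = int p ^ l r" if "(a^2 + 2 * b^2)^2 = c^2 + 2 * d^2" for a b
  proof -
    have "(a^2 + 2 * b^2)^2 = (int p ^ l r)^2" using that n by (simp add: mult.commute flip: power_mult)
    then show ?thesis by (simp add: power2_eq_iff_nonneg)
  qed
  have zz: "\<exists>x y. (\<Sum>x\<in>UNIV. chi (Suc r) x * of_int (f x)) = zs x y" if "\<And>x. f (x ^ p) = f x" for f
    using frob_sum_zs[where f = f and R = "Suc r", OF mc that _ chi_order] r by fastforce
  have ls: "l r < s" using l_le[of r] r l_pos[of r] s_half(1) by linarith
  show ?thesis
  proof (cases "\<forall>a\<in>fp. a \<noteq> 0 \<longrightarrow> chi (Suc r) a = 1")
    case True
    then have "Gr (Suc r) = (\<Sum>x\<in>UNIV. chi (Suc r) x * of_int (F x))"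
      unfolding Gr_def by (intro gauss_trivial_fp mc) auto
    then obtain x y where xy: "Gr (Suc r) = zs x y" using zz[of F] F_frob by auto
    from zs_sqrt_prime_power[OF prime_int sq[unfolded xy]] pc obtain a b where
      ev: "even (s - l r)" and ab: "zs a b ^ 2 = zs (-c) (-d)" by auto
    \<comment> \<open>Since \<open>s\<close> is even, \<open>l r\<close> is even too, and the norm
      \<open>p ^ l r\<close> of the root is 1 modulo 8; here \<open>c\<close> is the real part of
      minus a square.\<close>
    have evl: "even (l r)" using ev ls s_half(1) by presburger
    have "(a^2 + 2 * b^2) mod 8 = 1"
      using nrm[of a b] zs_square_norm[OF ab] int_p_power_mod8[of "l r"] evl by simp
    then have "(2 * b^2 - a^2) mod 4 = 3" by (rule form_mod8_one)
    moreover have "zs (a^2 - 2 * b^2) (2 * a * b) = zs (-c) (-d)"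
      using ab by (simp add: power2_eq_square zs_mult algebra_simps)
    then have "2 * b^2 - a^2 = c" by (simp add: zs_eq_iff)
    ultimately show ?thesis by simp
  next
    case False
    then obtain b0 where b0: "b0 \<in> fp" "b0 \<noteq> 0" "chi (Suc r) b0 \<noteq> 1" by blast
    from gauss_nontrivial_fp[OF mc _ b0] chi_fp_square rM obtain h where
      h: "h^2 = - of_nat p" "Gr (Suc r) = h * (\<Sum>x\<in>UNIV. chi (Suc r) x * of_int (F1 x))"
      unfolding Gr_def by blast
    then obtain x y where xy: "Gr (Suc r) = h * zs x y" using zz[of F1] F_frob by auto
    \<comment> \<open>\<open>h ^ 2 = - p\<close> uses up one factor \<open>p\<close> and the minus
      sign. The remaining exponent must be even, so \<open>l r\<close> is odd and the norm of the
      primitive root is 3 modulo 8.\<close>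
    have "s - l r = Suc (s - l r - 1)" using ls by simp
    then have "of_int (int p ^ (s - l r)) = of_nat p * (of_int (int p ^ (s - l r - 1)) :: complex)"
      by (metis of_int_mult of_int_of_nat_eq power_Suc)
    then have "of_nat p * (zs x y ^ 2) = of_nat p * (of_int (int p ^ (s - l r - 1)) * zs c d)"
      using sq unfolding xy power_mult_distrib h(1) zs_uminus[symmetric] by simp
    moreover have "of_nat p \<noteq> (0::complex)" using prime_gt_0_nat[OF p] by simp
    ultimately have "zs x y ^ 2 = of_int (int p ^ (s - l r - 1)) * zs c d" by simp
    from zs_sqrt_prime_power[OF prime_int this] pc obtain a b where
      ev: "even (s - l r - 1)" and ab: "zs a b ^ 2 = zs c d" by auto
    have evl: "odd (l r)" using ev ls s_half(1) by presburger
    have "(a^2 + 2 * b^2) mod 8 = 3"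
      using nrm[of a b] zs_square_norm[OF ab] int_p_power_mod8[of "l r"] evl by simp
    then have "(a^2 - 2 * b^2) mod 4 = 3" by (rule form_mod8_three)
    moreover have "zs (a^2 - 2 * b^2) (2 * a * b) = zs c d"
      using ab by (simp add: power2_eq_square zs_mult algebra_simps)
    then have "a^2 - 2 * b^2 = c" by (simp add: zs_eq_iff)
    ultimately show ?thesis by simp
  qed
qed

text \<open>The residue modulo 4 excludes \<open>a = - A\<close>, but nothing decides the sign of
  \<open>B\<close>; the counting formula will be symmetric in it.\<close>

lemma Gr_eq:
  assumes r: "3 \<le> r" "r \<le> M - 1"
    and AB: "A^2 + 2 * B^2 = int p ^ (2 * l r)" "A mod 4 = 3" "\<not> int p dvd A"
  shows "Gr r = of_int (int p ^ (s div 2 - l r)) * zs A B \<or> Gr r = of_int (int p ^ (s div 2 - l r)) * zs A (-B)"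
proof -
  obtain a b where ab: "Gr r = of_int (int p ^ (s div 2 - l r)) * zs a b" "a^2 + 2 * b^2 = int p ^ (2 * l r)" "\<not> int p dvd a"
    using Gr_form[OF r] by blast
  have a4: "a mod 4 = 3" by (rule Gr_form_sign[OF r ab])
  have "\<bar>a\<bar> = \<bar>A\<bar> \<and> \<bar>b\<bar> = \<bar>B\<bar>"
    by (rule prime_power_form_unique[OF prime_int ab(2) AB(1) ab(3) AB(3)])
  moreover have "a \<noteq> - A" using a4 AB(2) by presburger
  ultimately show ?thesis using ab(1) by (auto simp: abs_eq_iff)
qed

end

section \<open>Counting solutions\<close>

lemma sum_even_odd:
  fixes f :: "nat \<Rightarrow> 'a::comm_monoid_add"
  shows "(\<Sum>k<2 * N. f k) = (\<Sum>k<N. f (2 * k)) + (\<Sum>k<N. f (2 * k + 1))"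
  by (induction N) (simp_all add: add_ac)

text \<open>Every positive index is a power of two times an odd number. The splitting is used twice:
  for exponents of the character, where \<open>t\<close> decides its order, and for indices of
  elements, where \<open>t\<close> decides the order of the root of unity.\<close>

lemma sum_two_adic:
  fixes f :: "nat \<Rightarrow> 'a::comm_monoid_add"
  shows "(\<Sum>k<2^m. f k) = f 0 + (\<Sum>t<m. \<Sum>i<2^(m - t - 1). f (2^t * (2 * i + 1)))"
proof (induction m arbitrary: f)
  case (Suc m)
  have "(\<Sum>k<2^Suc m. f k) = (\<Sum>k<2^m. f (2 * k)) + (\<Sum>k<2^m. f (2 * k + 1))"
    using sum_even_odd[of f "2^m"] by simp
  also have "(\<Sum>k<2^m. f (2 * k)) = f 0 + (\<Sum>t<m. \<Sum>i<2^(m - t - 1). f (2 * (2^t * (2 * i + 1))))"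
    using Suc[of "\<lambda>k. f (2 * k)"] by simp
  finally show ?case
    by (simp add: sum.lessThan_Suc_shift mult.assoc add_ac del: sum.lessThan_Suc)
qed simp

lemma sum_four:
  fixes f :: "nat \<Rightarrow> 'a::comm_monoid_add"
  shows "(\<Sum>k<4 * N. f k) = (\<Sum>k<N. f (4 * k) + f (4 * k + 1) + f (4 * k + 2) + f (4 * k + 3))"
proof (induction N)
  case (Suc N)
  have "4 * Suc N = Suc (Suc (Suc (Suc (4 * N))))" by simp
  then have "(\<Sum>k<4 * Suc N. f k) = (\<Sum>k<4 * N. f k) + f (4 * N) + f (4 * N + 1) + f (4 * N + 2) + f (4 * N + 3)"
    by (simp add: eval_nat_numeral)
  then show ?case using Suc by (simp add: add_ac)
qed simp

lemma two_power_dvd_iff: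
  fixes u :: nat
  assumes "odd u"
  shows "2^r dvd 2^c * (2^t * u) \<longleftrightarrow> r \<le> c + t"
proof -
  have "2^r dvd 2^(c + t) * u \<longleftrightarrow> (2::nat)^r dvd 2^(c + t)"
    using assms by (intro coprime_dvd_mult_left_iff) simp
  also have "\<dots> \<longleftrightarrow> r \<le> c + t"
    using power_dvd_imp_le[of "2::nat" r "c + t"] le_imp_power_dvd[of r "c + t" "2::nat"] by auto
  finally show ?thesis by (simp only: power_add mult.assoc)
qed

lemma two_power_split:
  assumes "3 \<le> r"
  shows "(2::'a::comm_semiring_1)^(r - 1) = 4 * 2^(r - 3)" "(2::'a)^(r - 2) = 2 * 2^(r - 3)"
proof -
  have "r - 1 = Suc (Suc (r - 3))" "r - 2 = Suc (r - 3)" using assms by linarith+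
  then show "(2::'a)^(r - 1) = 4 * 2^(r - 3)" "(2::'a)^(r - 2) = 2 * 2^(r - 3)"
    by (simp_all flip: mult.assoc)
qed

lemma omega_odd_power_trace:
  "omega ^ (2 * i + 1) + (omega ^ (2 * i + 1))^3 = (if i mod 4 < 2 then 1 else -1) * isqrt2"
  "(omega ^ (2 * i + 1))^4 = -1"
proof -
  have o8: "omega ^ 8 = 1"
  proof -
    have "omega ^ 8 = (omega ^ 4) ^ 2" by (simp flip: power_mult)
    then show ?thesis by (simp add: omega_4)
  qed
  have o1: "omega + omega^3 = isqrt2" unfolding omega_cube by (simp add: omega_def isqrt2_def complex_eq_iff)
  have wk: "omega ^ 5 = - omega" "omega ^ 7 = - (omega^3)"
    using omega_4 power_add[of omega 4 1] power_add[of omega 4 3] by simp_all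
  define k where "k = i mod 4"
  have "omega ^ (2 * i + 1) = omega ^ ((2 * i + 1) mod 8)" by (rule power_mod_order[OF o8])
  also have "(2 * i + 1) mod 8 = 2 * k + 1" unfolding k_def by presburger
  finally have 1: "omega ^ (2 * i + 1) = omega ^ (2 * k + 1)" .
  have "(omega ^ (2 * k + 1))^3 = omega ^ (((2 * k + 1) * 3) mod 8)"
    unfolding power_mult[symmetric] by (rule power_mod_order[OF o8])
  moreover have "k < 4" by (simp add: k_def)
  then have "k = 0 \<or> k = 1 \<or> k = 2 \<or> k = 3" by linarith
  moreover have "- omega - omega^3 = - isqrt2" "- (omega^3) - omega = - isqrt2" "omega^3 + omega = isqrt2"
    using o1 by (simp_all add: algebra_simps)
  ultimately show "omega ^ (2 * i + 1) + (omega ^ (2 * i + 1))^3 = (if i mod 4 < 2 then 1 else -1) * isqrt2"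
    unfolding 1 k_def[symmetric] using o1 by (elim disjE; simp add: wk)
  have "(omega ^ (2 * i + 1))^4 = (omega^4) ^ (2 * i + 1)" by (metis mult.commute power_mult)
  then show "(omega ^ (2 * i + 1))^4 = -1" by (simp add: omega_4)
qed

context field_two_power
begin

section \<open>Exponential sums split by character order and 2-adic valuation\<close>

definition m :: nat where "m = M - 1"

lemma m_bounds: "3 \<le> m" "m < M" "m \<le> M" "1 \<le> m" "2 \<le> m" using M by (auto simp: m_def)

text \<open>The contribution of the characters of exact order \<open>2^r\<close>, which are the odd
  powers of \<open>chi r\<close>.\<close>

definition H :: "nat \<Rightarrow> complex \<Rightarrow> complex" where
  "H r w = (\<Sum>i<2^(r-1). w ^ (2 * i + 1) * gauss (\<lambda>x. chi r x ^ (2 * i + 1)))"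

text \<open>The exponential sum \<open>T\<close> at a nonzero element, as a function of the
  conjugate character value \<open>z\<close> there; \<open>j\<close> runs over the nontrivial powers
  of \<open>chi m\<close>.\<close>

definition layer_sum :: "complex \<Rightarrow> complex" where
  "layer_sum z = (\<Sum>j\<in>{1..<2^m}. z ^ j * gauss (\<lambda>x. chi m x ^ j))"

lemma layer_sum_eq: "layer_sum z = (\<Sum>r\<in>{1..m}. H r (z ^ (2^(m - r))))"
proof -
  define f where "f j = (if j = 0 then 0 else z ^ j * gauss (\<lambda>x. chi m x ^ j))" for j
  have "layer_sum z = (\<Sum>j\<in>{1..<2^m}. f j)" unfolding layer_sum_def by (intro sum.cong) (auto simp: f_def)
  also have "\<dots> = (\<Sum>j<2^m. f j)" by (rule sum.mono_neutral_left) (auto simp: f_def)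
  also have "\<dots> = (\<Sum>t<m. \<Sum>i<2^(m - t - 1). f (2^t * (2 * i + 1)))"
    using sum_two_adic[of f m] by (simp add: f_def)
  also have "\<dots> = (\<Sum>t<m. H (m - t) (z ^ (2^t)))"
  proof (rule sum.cong[OF refl])
    fix t assume t: "t \<in> {..<m}"
    have "chi m x ^ (2^t * (2 * i + 1)) = chi (m - t) x ^ (2 * i + 1)" for x i
      using chi_two_power[of "m - t" t x] t by (simp only: power_mult) simp
    then show "(\<Sum>i<2^(m - t - 1). f (2^t * (2 * i + 1))) = H (m - t) (z ^ (2^t))"
      unfolding H_def f_def by (intro sum.cong refl) (simp only: power_mult[of z], simp)
  qed
  also have "\<dots> = (\<Sum>r\<in>{1..m}. H r (z ^ (2^(m - r))))"
    by (rule sum.reindex_bij_witness[of _ "\<lambda>r. m - r" "\<lambda>t. m - t"]) auto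
  finally show ?thesis .
qed

lemma H_1: "H 1 w = w * Gr 1"
  by (simp add: H_def Gr_def)

lemma H_2: "H 2 w = (w + w^3) * Gr 1"
proof -
  have "gauss (\<lambda>x. chi 2 x ^ 3) = Gr 2" using gauss_chi_power[of 2 3] M by simp
  moreover have "gauss (\<lambda>x. chi 2 x) = Gr 2" by (simp add: Gr_def)
  ultimately show ?thesis using Gr_2 by (simp add: H_def numeral_2_eq_2 numeral_3_eq_3 algebra_simps)
qed

text \<open>The Gauss sums repeat in the pattern \<open>Gr r\<close>, \<open>Gr r\<close>,
  conjugate, conjugate, so blocks of four form a geometric series in \<open>w^8\<close>. It vanishes
  unless \<open>w\<close> is an eighth root of unity.\<close>

lemma H_ge_3:
  assumes r: "3 \<le> r" "r \<le> m" and w: "w ^ (2^r) = 1"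
  shows "H r w = (if w^8 = 1 then 2^(r-3) * ((w + w^3) * Gr r + w^4 * (w + w^3) * cnj (Gr r)) else 0)"
proof -
  have rM: "r < M" using r m_bounds by linarith
  have e: "(2::nat)^(r-1) = 4 * 2^(r-3)" by (rule two_power_split(1)[OF r(1)])
  have g: "gauss (\<lambda>x. chi r x ^ (2 * i + 1)) = (if i mod 4 < 2 then Gr r else cnj (Gr r))" for i
  proof -
    have "(2 * i + 1) mod 8 = 1 \<or> (2 * i + 1) mod 8 = 3 \<longleftrightarrow> i mod 4 < 2" by presburger
    then show ?thesis using gauss_chi_power[OF rM, of "2 * i + 1"] by simp
  qed
  define f where "f i = w ^ (2 * i + 1) * (if i mod 4 < 2 then Gr r else cnj (Gr r))" for i
  have "H r w = (\<Sum>i<4 * 2^(r-3). f i)" unfolding H_def e f_def g ..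
  also have "\<dots> = (\<Sum>k<2^(r-3). f (4 * k) + f (4 * k + 1) + f (4 * k + 2) + f (4 * k + 3))" by (rule sum_four)
  also have "\<dots> = (\<Sum>k<2^(r-3). (w^8)^k * ((w + w^3) * Gr r + w^4 * (w + w^3) * cnj (Gr r)))"
  proof (rule sum.cong[OF refl])
    fix k :: nat
    have m: "(4 * k) mod 4 = 0" "(4 * k + 1) mod 4 = 1" "(4 * k + 2) mod 4 = 2" "(4 * k + 3) mod 4 = 3" by presburger+
    have pw: "w ^ (2 * (4 * k + c) + 1) = (w^8)^k * w ^ (2 * c + 1)" for c
    proof -
      have "2 * (4 * k + c) + 1 = 8 * k + (2 * c + 1)" by simp
      then show ?thesis by (simp only: power_add[of w "8 * k"] power_mult)
    qed
    have fk: "f (4 * k) = (w^8)^k * (w * Gr r)" "f (4 * k + 1) = (w^8)^k * (w^3 * Gr r)"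
       "f (4 * k + 2) = (w^8)^k * (w^5 * cnj (Gr r))" "f (4 * k + 3) = (w^8)^k * (w^7 * cnj (Gr r))"
      unfolding f_def m using pw[of 0] pw[of 1] pw[of 2] pw[of 3] by (simp_all del: power_Suc One_nat_def)
    have w57: "w^5 = w^4 * w" "w^7 = w^4 * w^3" by (simp_all add: eval_nat_numeral)
    show "f (4 * k) + f (4 * k + 1) + f (4 * k + 2) + f (4 * k + 3) = (w^8)^k * ((w + w^3) * Gr r + w^4 * (w + w^3) * cnj (Gr r))"
      unfolding fk w57 by (simp only: distrib_left distrib_right mult.assoc add.assoc)
  qed
  also have "\<dots> = (\<Sum>k<2^(r-3). (w^8)^k) * ((w + w^3) * Gr r + w^4 * (w + w^3) * cnj (Gr r))"
    by (simp only: sum_distrib_right)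
  also have "(\<Sum>k<2^(r-3). (w^8)^k) = (if w^8 = 1 then of_nat (2^(r-3)) else 0)"
  proof (rule sum_roots_of_unity)
    have "8 * 2^(r-3) = (2::nat)^r" using r power_add[of "2::nat" 3 "r-3"] by simp
    then show "(w^8) ^ (2^(r-3)) = 1" using w by (metis power_mult)
  qed
  finally show ?thesis by simp
qed

definition p_part :: "nat \<Rightarrow> real" where "p_part r = real p ^ (s div 2 - l r)"

definition gauss_form :: "nat \<Rightarrow> int \<Rightarrow> int \<Rightarrow> bool" where
  "gauss_form r a b \<longleftrightarrow> Gr r = of_int (int p ^ (s div 2 - l r)) * zs a b"

lemma gauss_form_add_cnj: "gauss_form r a b \<Longrightarrow> Gr r + cnj (Gr r) = of_real (2 * p_part r * of_int a)"
  by (simp add: gauss_form_def p_part_def zs_def complex_eq_iff)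

lemma gauss_form_diff_cnj: "gauss_form r a b \<Longrightarrow> Gr r - cnj (Gr r) = of_real (2 * p_part r * of_int b) * isqrt2"
  by (simp add: gauss_form_def p_part_def zs_def complex_eq_iff isqrt2_def)

text \<open>For \<open>r > t\<close> the root of unity has order \<open>2^(r - t)\<close>, otherwise
  it is 1. The values 1 and -1 pick out the real part of \<open>Gr r\<close>, primitive eighth roots
  the coefficient of \<open>sqrt(-2)\<close>. At order 4 the factor \<open>w + w^3\<close> is 0,
  which explains the gap at \<open>r = t + 2\<close> between the last \<open>A\<close> and the
  \<open>B\<close> term.\<close>

lemma H_values:
  assumes r: "3 \<le> r" "r \<le> m" and G: "gauss_form r a b" and k: "k = 2^t * (2 * i + 1)"
  shows "H r (cis (2 * pi * real k / real (2^r))) =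
    of_real (if r \<le> t then 2^(r-1) * p_part r * a else if r = t + 1 then - (2^(r-1) * p_part r * a)
       else if r = t + 3 then - ((if i mod 4 < 2 then 1 else -1) * (2^(r-1) * p_part r * b)) else 0)"
proof -
  define w where "w = cis (2 * pi * real k / real (2^r))"
  have wp: "w ^ c = cis (2 * pi * real (c * k) / real (2^r))" for c
    unfolding w_def DeMoivre by (simp add: mult_ac)
  have w1: "w ^ c = 1 \<longleftrightarrow> 2^r dvd c * k" for c
    unfolding wp by (rule cis_eq_1_iff_dvd) simp
  have w2: "w ^ (2^c) = 1 \<longleftrightarrow> r \<le> c + t" for c
    unfolding w1 k by (rule two_power_dvd_iff) simp
  have e: "(2::real)^(r-1) = 4 * 2^(r-3)" by (rule two_power_split(1)[OF r(1)])
  have H: "H r w = (if w^8 = 1 then 2^(r-3) * ((w + w^3) * Gr r + w^4 * (w + w^3) * cnj (Gr r)) else 0)"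
    by (rule H_ge_3[OF r]) (simp add: w2)
  have w8: "w^8 = 1 \<longleftrightarrow> r \<le> 3 + t" using w2[of 3] by simp
  consider "r \<le> t" | "r = t + 1" | "r = t + 2" | "r = t + 3" | "r > t + 3" by linarith
  then have "H r w = of_real (if r \<le> t then 2^(r-1) * p_part r * a else if r = t + 1 then - (2^(r-1) * p_part r * a)
       else if r = t + 3 then - ((if i mod 4 < 2 then 1 else -1) * (2^(r-1) * p_part r * b)) else 0)"
  proof cases
    case 1
    then have "w = 1" using w2[of 0] by simp
    then have "H r w = 2^(r-3) * 2 * (Gr r + cnj (Gr r))" unfolding H by (simp add: algebra_simps)
    then show ?thesis unfolding gauss_form_add_cnj[OF G] using 1 e by simp
  next
    case 2
    then have "w \<noteq> 1" "w^2 = 1" using w2[of 0] w2[of 1] by auto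
    then have "w = -1" by (simp add: power2_eq_1_iff)
    then have "H r w = - (2^(r-3) * 2 * (Gr r + cnj (Gr r)))" unfolding H by (simp add: algebra_simps)
    then show ?thesis unfolding gauss_form_add_cnj[OF G] using 2 e by simp
  next
    case 3
    have "w^4 = (w^2)^2" by (simp flip: power_mult)
    moreover have "w^2 \<noteq> 1" "w^4 = 1" using 3 w2[of 1] w2[of 2] by auto
    ultimately have "w^2 = -1" using power2_eq_1_iff[of "w^2"] by metis
    then have "w + w^3 = 0" by (simp add: power3_eq_cube power2_eq_square)
    then show ?thesis unfolding H using 3 by simp
  next
    case 4
    have "2 * pi * real k / real (2^r) = real (2 * i + 1) * (2 * pi / 8)"
      unfolding k 4 by (simp add: power_add field_simps)
    then have w: "w = omega ^ (2 * i + 1)" unfolding w_def omega_cis DeMoivre by (rule arg_cong)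
    have "H r w = 2^(r-3) * ((w + w^3) * (Gr r - cnj (Gr r)))"
      unfolding H using w8 4 omega_odd_power_trace(2)[of i] w by (simp add: algebra_simps)
    \<comment> \<open>One \<open>sqrt(-2)\<close> stems from \<open>w + w^3\<close>, the other from
      \<open>Gr r - cnj (Gr r)\<close>; their product -2 supplies the minus sign and completes the
      power of two to \<open>2^(r-1)\<close>.\<close>
    also have "\<dots> = 2^(r-3) * ((if i mod 4 < 2 then 1 else -1) * of_real (2 * p_part r * b) * (isqrt2 * isqrt2))"
      unfolding gauss_form_diff_cnj[OF G] w omega_odd_power_trace(1) by simp
    finally show ?thesis unfolding isqrt2_square using 4 e by simp
  next
    case 5
    then show ?thesis unfolding H using w8 by simp
  qed
  then show ?thesis unfolding w_def .
qed

lemma H_1_values: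
  assumes k: "k = 2^t * (2 * i + 1)"
  shows "H 1 (cis (2 * pi * real k / real (2^1))) = (if t = 0 then -1 else 1) * Gr 1"
proof -
  define w where "w = cis (2 * pi * real k / real (2^1))"
  have w1: "w ^ (2^c) = 1 \<longleftrightarrow> 1 \<le> c + t" for c
  proof -
    have "w ^ (2^c) = cis (2 * pi * real (2^c * k) / real (2^1))"
      unfolding w_def DeMoivre by (simp add: mult_ac)
    then have "w ^ (2^c) = 1 \<longleftrightarrow> 2^1 dvd 2^c * k" using cis_eq_1_iff_dvd[of "2^1" "2^c * k"] by (simp only: zero_less_power zero_less_numeral)
    also have "\<dots> \<longleftrightarrow> 1 \<le> c + t" unfolding k by (rule two_power_dvd_iff) simp
    finally show ?thesis .
  qed
  have "w = (if t = 0 then -1 else 1)" using w1[of 0] w1[of 1] by (auto simp: power2_eq_1_iff)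
  then show ?thesis unfolding H_1 w_def by simp
qed

lemma H_2_values:
  assumes k: "k = 2^t * (2 * i + 1)"
  shows "H 2 (cis (2 * pi * real k / real (2^2))) = (if t = 0 then 0 else if t = 1 then -2 else 2) * Gr 1"
proof -
  define w where "w = cis (2 * pi * real k / real (2^2))"
  have w1: "w ^ (2^c) = 1 \<longleftrightarrow> 2 \<le> c + t" for c
  proof -
    have "w ^ (2^c) = cis (2 * pi * real (2^c * k) / real (2^2))"
      unfolding w_def DeMoivre by (simp add: mult_ac)
    then have "w ^ (2^c) = 1 \<longleftrightarrow> 2^2 dvd 2^c * k" using cis_eq_1_iff_dvd[of "2^2" "2^c * k"] by (simp only: zero_less_power zero_less_numeral)
    also have "\<dots> \<longleftrightarrow> 2 \<le> c + t" unfolding k by (rule two_power_dvd_iff) simp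
    finally show ?thesis .
  qed
  consider "t = 0" | "t = 1" | "t \<ge> 2" by linarith
  then have "w + w^3 = (if t = 0 then 0 else if t = 1 then -2 else 2)"
  proof cases
    case 1
    have "w^4 = (w^2)^2" by (simp flip: power_mult)
    moreover have "w^2 \<noteq> 1" "w^4 = 1" using 1 w1[of 1] w1[of 2] by auto
    ultimately have "w^2 = -1" using power2_eq_1_iff[of "w^2"] by metis
    then have "w + w^3 = 0" by (simp add: power3_eq_cube power2_eq_square)
    then show ?thesis using 1 by simp
  next
    case 2
    then have "w = -1" using w1[of 0] w1[of 1] by (auto simp: power2_eq_1_iff)
    then show ?thesis using 2 by simp
  next
    case 3
    then have "w = 1" using w1[of 0] by simp
    then show ?thesis using 3 by simp
  qed
  then show ?thesis unfolding H_2 w_def by simp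
qed

definition rt :: real where "rt = real p ^ (s div 2)"

lemma Gr_1_rt: "Gr 1 = of_real (- rt)" unfolding Gr_1 rt_def by simp

text \<open>\<open>V a b t sg\<close> is \<open>T\<close> at the elements whose index has 2-adic valuation \<open>t\<close>; the sign \<open>sg\<close> depends on the
  odd part of the index modulo 8.\<close>

definition V :: "(nat \<Rightarrow> int) \<Rightarrow> (nat \<Rightarrow> int) \<Rightarrow> nat \<Rightarrow> real \<Rightarrow> real" where
  "V a b t sg = (if t < 2 then rt else - 3 * rt) + (\<Sum>r=3..m. if r \<le> t then 2^(r-1) * p_part r * a r
     else if r = t + 1 then - (2^(r-1) * p_part r * a r)
     else if r = t + 3 then - (sg * (2^(r-1) * p_part r * b r)) else 0)"

lemma layer_sum_split: "layer_sum z = H 1 (z ^ (2^(m - 1))) + H 2 (z ^ (2^(m - 2))) + (\<Sum>r=3..m. H r (z ^ (2^(m - r))))"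
proof -
  have "{1..m} = insert 1 (insert 2 {3..m})" using m_bounds by auto
  then show ?thesis unfolding layer_sum_eq by (simp add: add.assoc)
qed

lemma cis_two_power:
  assumes "r \<le> m"
  shows "cis (2 * pi * real k / real (2^m)) ^ (2^(m - r)) = cis (2 * pi * real k / real (2^r))"
proof -
  have "(2::real)^m = 2^(m - r) * 2^r" using assms by (simp flip: power_add)
  then show ?thesis unfolding DeMoivre by (simp add: field_simps)
qed

lemma layer_sum_values:
  assumes G: "\<And>r. 3 \<le> r \<Longrightarrow> r \<le> m \<Longrightarrow> gauss_form r (a r) (b r)" and k: "k = 2^t * (2 * i + 1)"
  shows "layer_sum (cis (2 * pi * real k / real (2^m))) = of_real (V a b t (if i mod 4 < 2 then 1 else -1))"
proof -
  note m = m_bounds(4,5)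
  have "(\<Sum>r=3..m. H r (cis (2 * pi * real k / real (2^m)) ^ (2^(m - r)))) =
    (\<Sum>r=3..m. of_real (if r \<le> t then 2^(r-1) * p_part r * a r else if r = t + 1 then - (2^(r-1) * p_part r * a r)
       else if r = t + 3 then - ((if i mod 4 < 2 then 1 else -1) * (2^(r-1) * p_part r * b r)) else 0))"
    by (intro sum.cong refl) (simp only: cis_two_power atLeastAtMost_iff H_values[OF _ _ G k])
  \<comment> \<open>Orders 2 and 4 together give \<open>rt + 0\<close> at \<open>t = 0\<close>,
    \<open>- rt + 2 * rt\<close> at \<open>t = 1\<close> and \<open>- rt - 2 * rt\<close> from
    \<open>t = 2\<close> on, the constants in \<open>V\<close>.\<close>
  then show ?thesis
    unfolding layer_sum_split cis_two_power[OF m(1)] cis_two_power[OF m(2)] H_1_values[OF k] H_2_values[OF k] V_def Gr_1_rt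
    by (auto simp only: of_real_sum of_real_add of_real_mult) (auto simp: algebra_simps)
qed

lemma layer_sum_one:
  assumes G: "\<And>r. 3 \<le> r \<Longrightarrow> r \<le> m \<Longrightarrow> gauss_form r (a r) (b r)"
  shows "layer_sum 1 = of_real (- 3 * rt + (\<Sum>r=3..m. 2^(r-1) * p_part r * a r))"
proof -
  have "H r 1 = of_real (2^(r-1) * p_part r * a r)" if r: "3 \<le> r" "r \<le> m" for r
  proof -
    have e: "(2::real)^(r-1) = 4 * 2^(r-3)" by (rule two_power_split(1)[OF r(1)])
    have "H r 1 = 2^(r-3) * 2 * (Gr r + cnj (Gr r))" using H_ge_3[OF r, of 1] by (simp add: algebra_simps)
    then show ?thesis unfolding gauss_form_add_cnj[OF G[OF r]] using e by simp
  qed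
  then have "(\<Sum>r=3..m. H r (1 ^ (2^(m - r)))) = (\<Sum>r=3..m. of_real (2^(r-1) * p_part r * a r))"
    by (intro sum.cong refl) simp
  then show ?thesis unfolding layer_sum_split H_1 H_2 Gr_1_rt by simp
qed

text \<open>Valuation \<open>t\<close> occurs with \<open>2^(m - t - 1)\<close> odd parts, half of
  them with each sign when \<open>t + 3 \<le> m\<close>. For larger \<open>t\<close> there is no
  order \<open>2^(t+3)\<close>, so \<open>V\<close> is independent of \<open>sg\<close> and 0 is a
  conventional value.\<close>

lemma layer_sum_power_sum:
  assumes G: "\<And>r. 3 \<le> r \<Longrightarrow> r \<le> m \<Longrightarrow> gauss_form r (a r) (b r)"
  shows "(\<Sum>k<2^m. layer_sum (cis (2 * pi * real k / real (2^m))) ^ n) =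
     of_real ((- 3 * rt + (\<Sum>r=3..m. 2^(r-1) * p_part r * a r)) ^ n +
       (\<Sum>t<m. if t + 3 \<le> m then 2^(m - t - 2) * (V a b t 1 ^ n + V a b t (-1) ^ n) else 2^(m - t - 1) * V a b t 0 ^ n))"
proof -
  define f where "f k = layer_sum (cis (2 * pi * real k / real (2^m))) ^ n" for k
  have "(\<Sum>i<2^(m - t - 1). f (2^t * (2 * i + 1))) =
     of_real (if t + 3 \<le> m then 2^(m - t - 2) * (V a b t 1 ^ n + V a b t (-1) ^ n) else 2^(m - t - 1) * V a b t 0 ^ n)"
    if t: "t < m" for t
  proof -
    have fv: "f (2^t * (2 * i + 1)) = of_real (V a b t (if i mod 4 < 2 then 1 else -1) ^ n)" for i
      unfolding f_def using layer_sum_values[of a b "2^t * (2 * i + 1)", OF G refl] by simp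
    show ?thesis
    proof (cases "t + 3 \<le> m")
      case True
      have mt: "3 \<le> m - t" using True by simp
      have e: "(2::nat)^(m - t - 1) = 4 * 2^(m - t - 3)" by (rule two_power_split(1)[OF mt])
      have e2: "(2::real)^(m - t - 2) = 2 * 2^(m - t - 3)" by (rule two_power_split(2)[OF mt])
      have "(\<Sum>i<2^(m - t - 1). f (2^t * (2 * i + 1))) = (\<Sum>k<(2::nat)^(m - t - 3). of_real (2 * (V a b t 1 ^ n + V a b t (-1) ^ n)))"
        unfolding e sum_four fv
      proof (rule sum.cong[OF refl])
        fix k :: nat
        have m: "(4 * k) mod 4 = 0" "(4 * k + 1) mod 4 = 1" "(4 * k + 2) mod 4 = 2" "(4 * k + 3) mod 4 = 3" by presburger+
        show "complex_of_real (V a b t (if 4 * k mod 4 < 2 then 1 else - 1) ^ n) +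
         complex_of_real (V a b t (if (4 * k + 1) mod 4 < 2 then 1 else - 1) ^ n) +
         complex_of_real (V a b t (if (4 * k + 2) mod 4 < 2 then 1 else - 1) ^ n) +
         complex_of_real (V a b t (if (4 * k + 3) mod 4 < 2 then 1 else - 1) ^ n) =
         complex_of_real (2 * (V a b t 1 ^ n + V a b t (- 1) ^ n))"
          unfolding m by simp
      qed
      then show ?thesis using True e2 by simp
    next
      case False
      then have "V a b t c = V a b t 0" for c
        unfolding V_def by (intro arg_cong2[where f = "(+)"] sum.cong refl) auto
      then have "f (2^t * (2 * i + 1)) = of_real (V a b t 0 ^ n)" for i using fv by metis
      then show ?thesis using False by simp
    qed
  qed
  then have "(\<Sum>t<m. \<Sum>i<2^(m - t - 1). f (2^t * (2 * i + 1))) = (\<Sum>t<m. of_real (if t + 3 \<le> m then 2^(m - t - 2) * (V a b t 1 ^ n + V a b t (-1) ^ n) else 2^(m - t - 1) * V a b t 0 ^ n))"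
    by (intro sum.cong refl) simp
  moreover have "f 0 = of_real ((- 3 * rt + (\<Sum>r=3..m. 2^(r-1) * p_part r * a r)) ^ n)"
    unfolding f_def using layer_sum_one[OF G] by simp
  ultimately have "(\<Sum>k<2^m. f k) = of_real ((- 3 * rt + (\<Sum>r=3..m. 2^(r-1) * p_part r * a r)) ^ n) +
     (\<Sum>t<m. of_real (if t + 3 \<le> m then 2^(m - t - 2) * (V a b t 1 ^ n + V a b t (-1) ^ n) else 2^(m - t - 1) * V a b t 0 ^ n))"
    using sum_two_adic[of f m] by simp
  then show ?thesis unfolding f_def by (simp only: of_real_add of_real_sum)
qed

section \<open>From exponential sums to the number of solutions\<close>

definition T :: "'a \<Rightarrow> complex" where "T a = (\<Sum>x\<in>UNIV. psi (a * x ^ (2^m)))"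

lemma T_0: "T 0 = of_nat q" by (simp add: T_def psi_0 card_q)

lemma T_eq_layer_sum:
  assumes a: "a \<noteq> 0"
  shows "T a = layer_sum (cnj (chi m a))"
proof -
  have D: "2^m dvd q - 1" using two_power_dvd_q_minus_1[OF m_bounds(3)] by simp
  have mc: "mchar (chi m)" using mchar_chi[OF m_bounds(3)] by simp
  have D1: "(2::nat)^m > 0" by simp
  have "T a = psi (a * 0) + (\<Sum>y\<in>UNIV - {0}. psi (a * y) * (\<Sum>j<2^m. chi m y ^ j))"
    unfolding T_def by (rule sum_power_map[OF D])
  also have "(\<Sum>y\<in>UNIV - {0}. psi (a * y) * (\<Sum>j<2^m. chi m y ^ j)) =
     (\<Sum>y\<in>UNIV - {0}. psi (a * y) + (\<Sum>j\<in>{1..<2^m}. chi m y ^ j * psi (a * y)))"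
  proof (rule sum.cong[OF refl])
    fix y
    have "{..<2^m} = insert 0 {1..<(2::nat)^m}" using D1 by auto
    then have "(\<Sum>j<2^m. chi m y ^ j) = 1 + (\<Sum>j\<in>{1..<2^m}. chi m y ^ j)" by simp
    then show "psi (a * y) * (\<Sum>j<2^m. chi m y ^ j) = psi (a * y) + (\<Sum>j\<in>{1..<2^m}. chi m y ^ j * psi (a * y))"
      by (simp add: distrib_left sum_distrib_left mult.commute)
  qed
  also have "\<dots> = (\<Sum>y\<in>UNIV - {0}. psi (a * y)) + (\<Sum>j\<in>{1..<2^m}. \<Sum>y\<in>UNIV - {0}. chi m y ^ j * psi (a * y))"
    unfolding sum.distrib by (subst (2) sum.swap) simp
  \<comment> \<open>The element 0 and the trivial character together complete the additive sum over
    the whole field, which vanishes for \<open>a \<noteq> 0\<close>.\<close>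
  also have "psi (a * 0) + ((\<Sum>y\<in>UNIV - {0}. psi (a * y)) + (\<Sum>j\<in>{1..<2^m}. \<Sum>y\<in>UNIV - {0}. chi m y ^ j * psi (a * y)))
     = (\<Sum>y\<in>UNIV. psi (a * y)) + (\<Sum>j\<in>{1..<2^m}. \<Sum>y\<in>UNIV - {0}. chi m y ^ j * psi (a * y))"
    by (simp add: sum.remove[of UNIV 0] add.assoc)
  also have "(\<Sum>y\<in>UNIV. psi (a * y)) = 0" using sum_psi[of a] a by simp
  also have "(\<Sum>j\<in>{1..<2^m}. \<Sum>y\<in>UNIV - {0}. chi m y ^ j * psi (a * y)) = layer_sum (cnj (chi m a))"
    unfolding layer_sum_def
  proof (rule sum.cong[OF refl])
    fix j :: nat assume j: "j \<in> {1..<2^m}"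
    then have j0: "j > 0" by simp
    have "(\<Sum>y\<in>UNIV - {0}. chi m y ^ j * psi (a * y)) = (\<Sum>y\<in>UNIV. chi m y ^ j * psi (a * y))"
      using mchar_0[OF mc] j0 by (intro sum.mono_neutral_left) (auto simp: zero_power)
    also have "\<dots> = cnj (chi m a ^ j) * gauss (\<lambda>x. chi m x ^ j)"
      by (rule gauss_scale[OF mchar_power[OF mc j0] a])
    finally show "(\<Sum>y\<in>UNIV - {0}. chi m y ^ j * psi (a * y)) = cnj (chi m a) ^ j * gauss (\<lambda>x. chi m x ^ j)" by simp
  qed
  finally show ?thesis by simp
qed

lemma solutions_count:
  "of_nat q * of_nat (card {x \<in> {0..<n} \<rightarrow>\<^sub>E (UNIV :: 'a set). (\<Sum>i<n. (x i) ^ (2^m)) = 0}) =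
    (of_nat q ^ n + of_nat ((q - 1) div 2^m) * (\<Sum>k<2^m. layer_sum (cis (2 * pi * real k / real (2^m))) ^ n) :: complex)"
proof -
  let ?X = "{0..<n} \<rightarrow>\<^sub>E (UNIV :: 'a set)"
  have fin: "finite ?X" by (intro finite_PiE) auto
  have D: "2^m dvd q - 1" using two_power_dvd_q_minus_1[OF m_bounds(3)] by simp
  have mc: "mchar (chi m)" using mchar_chi[OF m_bounds(3)] by simp
  have "of_nat q * of_nat (card {x \<in> ?X. (\<Sum>i<n. (x i) ^ (2^m)) = 0}) = (\<Sum>x\<in>?X. if (\<Sum>i<n. (x i) ^ (2^m)) = 0 then of_nat q else (0::complex))"
    using fin by (simp add: sum.If_cases Int_def conj_commute mult.commute)
  also have "\<dots> = (\<Sum>x\<in>?X. \<Sum>a\<in>UNIV. psi ((\<Sum>i<n. (x i) ^ (2^m)) * a))"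
    by (simp add: sum_psi)
  also have "\<dots> = (\<Sum>a\<in>UNIV. \<Sum>x\<in>?X. psi ((\<Sum>i<n. (x i) ^ (2^m)) * a))" by (rule sum.swap)
  also have "\<dots> = (\<Sum>a\<in>UNIV. T a ^ n)"
  proof (rule sum.cong[OF refl])
    fix a :: 'a
    have ps: "psi (\<Sum>i\<in>I. h i) = (\<Prod>i\<in>I. psi (h i))" if "finite I" for I :: "nat set" and h
      using that by induction (auto simp: psi_0 psi_add)
    have "T a ^ n = (\<Prod>i\<in>{0..<n}. \<Sum>y\<in>UNIV. psi (a * y ^ (2^m)))" by (simp add: T_def)
    also have "\<dots> = (\<Sum>x\<in>?X. \<Prod>i\<in>{0..<n}. psi (a * x i ^ (2^m)))"
      by (rule prod_sum_PiE) auto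
    also have "\<dots> = (\<Sum>x\<in>?X. psi ((\<Sum>i<n. (x i) ^ (2^m)) * a))"
    proof (rule sum.cong[OF refl])
      fix x :: "nat \<Rightarrow> 'a"
      have "(\<Sum>i<n. (x i) ^ (2^m)) * a = (\<Sum>i\<in>{0..<n}. a * (x i) ^ (2^m))"
        by (simp add: sum_distrib_left mult.commute atLeast0LessThan)
      then show "(\<Prod>i\<in>{0..<n}. psi (a * x i ^ (2^m))) = psi ((\<Sum>i<n. (x i) ^ (2^m)) * a)"
        by (simp only: ps finite_atLeastLessThan)
    qed
    finally show "(\<Sum>x\<in>?X. psi ((\<Sum>i<n. (x i) ^ (2^m)) * a)) = T a ^ n" by simp
  qed
  also have "\<dots> = of_nat q ^ n + (\<Sum>a\<in>UNIV - {0}. T a ^ n)"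
    by (simp add: sum.remove[of UNIV 0] T_0)
  \<comment> \<open>The conjugate character value is the value at the inverse, and inversion
    permutes the units.\<close>
  also have "(\<Sum>a\<in>UNIV - {0}. T a ^ n) = (\<Sum>a\<in>UNIV - {0}. layer_sum (chi m (inverse a)) ^ n)"
    by (intro sum.cong refl) (simp add: T_eq_layer_sum mchar_inverse[OF mc])
  also have "\<dots> = (\<Sum>a\<in>UNIV - {0}. layer_sum (chi m a) ^ n)"
    by (rule sum.reindex_bij_witness[of _ inverse inverse]) auto
  also have "\<dots> = of_nat ((q - 1) div 2^m) * (\<Sum>k<2^m. layer_sum (cis (2 * pi * real k / real (2^m))) ^ n)"
    using sum_chr_equidistributed[OF D, of "\<lambda>z. layer_sum z ^ n"] by simp
  finally show ?thesis .
qed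

section \<open>Translation into real powers of q\<close>

lemma s_l: "1 \<le> r \<Longrightarrow> r \<le> m \<Longrightarrow> s = 2^(r-1) * l r"
proof -
  assume r: "1 \<le> r" "r \<le> m"
  have "M - 2 = (r - 1) + (M - 1 - r)" using r m_bounds by (simp add: m_def)
  then have "(2::nat)^(M-2) = 2^(r-1) * 2^(M - 1 - r)" by (metis power_add)
  then show ?thesis using s_eq(1) by (simp add: l_def)
qed

lemma s_div_l: "2 \<le> r \<Longrightarrow> r \<le> m \<Longrightarrow> real s / 2^(r-2) = real (2 * l r)"
proof -
  assume r: "2 \<le> r" "r \<le> m"
  then have "r - 1 = Suc (r - 2)" by linarith
  then have e: "(2::real)^(r-1) = 2 * 2^(r-2)" by simp
  have "real s = real (2^(r-1) * l r)" using s_l[of r] r by (intro arg_cong[where f = real]) simp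
  then have "real s = 2^(r-2) * real (2 * l r)" by (simp add: e del: One_nat_def)
  then show ?thesis by simp
qed

lemma rt_powr: "rt = real q powr (1/2)"
proof -
  have "real q powr (1/2) = real p powr (real s * (1/2))"
    using prime_gt_0_nat[OF p] by (simp add: q_def powr_powr flip: powr_realpow)
  also have "real s * (1/2) = real (s div 2)" using s_half(1) by linarith
  finally show ?thesis using prime_gt_0_nat[OF p] by (simp add: rt_def powr_realpow)
qed

text \<open>With \<open>s = 2^(r-1) * l r\<close> the exponent of \<open>p\<close> is
  \<open>s / 2 - s / 2^(r-1)\<close>, that is \<open>s / 2 - l r\<close>.\<close>

lemma p_part_powr:
  assumes r: "3 \<le> r" "r \<le> m"
  shows "p_part r = real q powr ((2^(r-2) - 1) / 2^(r-1))"
proof -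
  have "real s = real (2^(r-1) * l r)" using s_l[of r] r by (intro arg_cong[where f = real]) simp
  then have e: "real s = 2^(r-1) * real (l r)" by simp
  have "real q powr ((2^(r-2) - 1) / 2^(r-1)) = real p powr (real s * ((2^(r-2) - 1) / 2^(r-1)))"
    using prime_gt_0_nat[OF p] by (simp add: q_def powr_powr flip: powr_realpow)
  also have "real s * ((2^(r-2) - 1) / 2^(r-1)) = real (s div 2 - l r)"
  proof -
    have "l r \<le> s div 2" using l_le[of r] r by (simp add: m_def)
    then have "real (s div 2 - l r) = real (s div 2) - real (l r)" by (simp add: of_nat_diff)
    also have "real (s div 2) = real s / 2" using s_half(1) by linarith
    also have "\<dots> = 2^(r-2) * real (l r)"
    proof -
      have "r - 1 = Suc (r - 2)" using r by linarith
      then show ?thesis using e by simp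
    qed
    finally have "real (s div 2 - l r) = real (l r) * (2^(r-2) - 1)" by (simp add: algebra_simps)
    moreover have "real s * ((2^(r-2) - 1) / 2^(r-1)) = real (l r) * (2^(r-2) - 1)" unfolding e by simp
    ultimately show ?thesis by simp
  qed
  finally show ?thesis using prime_gt_0_nat[OF p] by (simp add: p_part_def powr_realpow)
qed

lemma V_eq:
  assumes t: "t < m"
  shows "V a b t sg = (if t < 2 then rt else - 3 * rt) + (\<Sum>r=3..t. 2^(r-1) * p_part r * a r)
     - (if 2 \<le> t then 2^t * p_part (t+1) * a (t+1) else 0) - (if t + 3 \<le> m then sg * (2^(t+2) * p_part (t+3) * b (t+3)) else 0)"
proof -
  have "(\<Sum>r=3..m. if r \<le> t then 2^(r-1) * p_part r * a r
     else if r = t + 1 then - (2^(r-1) * p_part r * a r)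
     else if r = t + 3 then - (sg * (2^(r-1) * p_part r * b r)) else 0)
    = (\<Sum>r=3..m. (if r \<le> t then 2^(r-1) * p_part r * a r else 0) + (if r = t + 1 then - (2^(r-1) * p_part r * a r) else 0)
       + (if r = t + 3 then - (sg * (2^(r-1) * p_part r * b r)) else 0))"
    by (intro sum.cong refl) auto
  also have "\<dots> = (\<Sum>r=3..m. if r \<le> t then 2^(r-1) * p_part r * a r else 0)
     - (if 2 \<le> t then 2^t * p_part (t+1) * a (t+1) else 0) - (if t + 3 \<le> m then sg * (2^(t+2) * p_part (t+3) * b (t+3)) else 0)"
    unfolding sum.distrib using t by (simp add: numeral_eq_Suc)
  also have "(\<Sum>r=3..m. if r \<le> t then 2^(r-1) * p_part r * a r else 0) = (\<Sum>r=3..t. 2^(r-1) * p_part r * a r)"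
    using t by (intro sum.mono_neutral_cong_right) auto
  finally show ?thesis unfolding V_def by simp
qed

text \<open>The sign of \<open>b r\<close> is open separately for each \<open>r\<close>. Every
  \<open>V\<close> contains at most one \<open>b\<close>, with coefficient \<open>sg\<close> up to
  sign, so a wrong choice merely swaps the terms for \<open>sg = 1\<close> and
  \<open>sg = -1\<close>.\<close>

lemma solutions_real:
  assumes n: "n \<ge> 1" and G: "\<And>r. 3 \<le> r \<Longrightarrow> r \<le> m \<Longrightarrow> gauss_form r (a r) (b r) \<or> gauss_form r (a r) (- b r)"
  shows "real (card {x \<in> {0..<n} \<rightarrow>\<^sub>E (UNIV :: 'a set). (\<Sum>i<n. (x i) ^ (2^m)) = 0}) =
    real q ^ (n - 1) + (real q - 1) / (2^m * real q) * ((- 3 * rt + (\<Sum>r=3..m. 2^(r-1) * p_part r * a r)) ^ n +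
       (\<Sum>t<m. if t + 3 \<le> m then 2^(m - t - 2) * (V a b t 1 ^ n + V a b t (-1) ^ n) else 2^(m - t - 1) * V a b t 0 ^ n))"
proof -
  define b' where "b' r = (if gauss_form r (a r) (b r) then b r else - b r)" for r
  have G': "gauss_form r (a r) (b' r)" if "3 \<le> r" "r \<le> m" for r using G[OF that] by (auto simp: b'_def)
  have Vb: "V a b' t 1 ^ n + V a b' t (-1) ^ n = V a b t 1 ^ n + V a b t (-1) ^ n" if "t < m" for t
  proof -
    have "b' (t + 3) = b (t + 3) \<or> b' (t + 3) = - b (t + 3)" by (simp add: b'_def)
    then show ?thesis unfolding V_eq[OF that] by (elim disjE) (simp_all only: of_int_minus minus_mult_right[symmetric] minus_mult_left[symmetric] mult_minus_left mult_minus_right mult_1_left minus_minus add.commute)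
  qed
  have V0: "V a b' t 0 = V a b t 0" if "t < m" for t unfolding V_eq[OF that] by simp
  define X where "X = (- 3 * rt + (\<Sum>r=3..m. 2^(r-1) * p_part r * a r)) ^ n +
       (\<Sum>t<m. if t + 3 \<le> m then 2^(m - t - 2) * (V a b' t 1 ^ n + V a b' t (-1) ^ n) else 2^(m - t - 1) * V a b' t 0 ^ n)"
  define N where "N = card {x \<in> {0..<n} \<rightarrow>\<^sub>E (UNIV :: 'a set). (\<Sum>i<n. (x i) ^ (2^m)) = 0}"
  have D: "2^m dvd q - 1" using two_power_dvd_q_minus_1[OF m_bounds(3)] by simp
  have q0: "real q > 0" using q_gt_1 by simp
  have "(of_real (real q * real N) :: complex) = of_real (real q ^ n + real ((q - 1) div 2^m) * X)"
    using solutions_count[of n] layer_sum_power_sum[of a b' n, OF G'] by (simp add: N_def X_def)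
  then have "real q * real N = real q ^ n + real ((q - 1) div 2^m) * X" using of_real_eq_iff by blast
  also have "real ((q - 1) div 2^m) = (real q - 1) / 2^m"
  proof -
    have "real ((q - 1) div 2^m) = real (q - 1) / real (2^m)" using D by (rule real_of_nat_div)
    then show ?thesis using q_gt_1 by (simp add: of_nat_diff)
  qed
  also have "real q ^ n = real q * real q ^ (n - 1)" using n by (cases n) auto
  also have "(real q - 1) / 2^m * X = real q * ((real q - 1) / (2^m * real q) * X)" using q0 by simp
  finally have "real q * real N = real q * (real q ^ (n - 1) + (real q - 1) / (2^m * real q) * X)"
    by (simp only: distrib_left)
  then have "real N = real q ^ (n - 1) + (real q - 1) / (2^m * real q) * X" using q0 by simp
  moreover have "X = (- 3 * rt + (\<Sum>r=3..m. 2^(r-1) * p_part r * a r)) ^ n +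
       (\<Sum>t<m. if t + 3 \<le> m then 2^(m - t - 2) * (V a b t 1 ^ n + V a b t (-1) ^ n) else 2^(m - t - 1) * V a b t 0 ^ n)"
    unfolding X_def by (intro arg_cong2[where f = "(+)"] sum.cong refl) (simp add: Vb V0)
  ultimately show ?thesis unfolding N_def by simp
qed

end

theorem theorem1:
  fixes p s m n q :: nat and A B :: "nat \<Rightarrow> int"
    and F :: "'a::{field,finite} itself"
  assumes p: "prime p" and p8: "p mod 8 = 3"
    and s: "s \<ge> 1" and q: "q = p ^ s" and card: "card (UNIV :: 'a set) = q"
    and m: "m \<ge> 3" and dvd: "2 ^ (m+1) dvd (q - 1)"
    and n: "n \<ge> 1"
    and AB: "\<And>r. 2 \<le> r \<Longrightarrow> r \<le> m \<Longrightarrow>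
        real p powr (real s / 2 ^ (r-2)) = real_of_int ((A r)^2 + 2 * (B r)^2)
        \<and> [A r = -1] (mod 4) \<and> \<not> int p dvd A r"
  defines "N \<equiv> card {x \<in> {0..<n} \<rightarrow>\<^sub>E (UNIV :: 'a set). (\<Sum>i<n. (x i) ^ (2^m)) = 0}"
      and "Q \<equiv> real q"
  shows "(m = 3 \<longrightarrow>
     real N = Q ^ (n-1) + (Q - 1) / (8 * Q) *
       ( 2 * ((Q powr (1/2) + 4 * B 3 * Q powr (1/4)) ^ n
              + (Q powr (1/2) - 4 * B 3 * Q powr (1/4)) ^ n)
       + 2 * Q powr (real n / 2)
       + (-3 * Q powr (1/2) + 4 * A 3 * Q powr (1/4)) ^ n
       + (-3 * Q powr (1/2) - 4 * A 3 * Q powr (1/4)) ^ n))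
   \<and> (m \<ge> 4 \<longrightarrow>
     real N = Q ^ (n-1) + (Q - 1) / (2^m * Q) *
       ( 2^(m-2) * ((Q powr (1/2) + 4 * B 3 * Q powr (1/4)) ^ n
                  + (Q powr (1/2) - 4 * B 3 * Q powr (1/4)) ^ n)
       + 2^(m-3) * ((Q powr (1/2) + 8 * B 4 * Q powr (3/8)) ^ n
                  + (Q powr (1/2) - 8 * B 4 * Q powr (3/8)) ^ n)
       + (\<Sum>t=2..m-3. 2^(m-t-2) *
            ((Ssum Q A t - 2^t * A (t+1) * Q powr ((2^(t-1) - 1) / 2^t)
                 + 2^(t+2) * B (t+3) * Q powr ((2^(t+1) - 1) / 2^(t+2))) ^ n
           + (Ssum Q A t - 2^t * A (t+1) * Q powr ((2^(t-1) - 1) / 2^t)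
                 - 2^(t+2) * B (t+3) * Q powr ((2^(t+1) - 1) / 2^(t+2))) ^ n))
       + 2 * (Ssum Q A (m-2) - 2^(m-2) * A (m-1) * Q powr ((2^(m-3) - 1) / 2^(m-2))) ^ n
       + (Ssum Q A (m-1) - 2^(m-1) * A m * Q powr ((2^(m-2) - 1) / 2^(m-1))) ^ n
       + (Ssum Q A m) ^ n))"
proof -
  obtain g :: 'a where "g \<noteq> 0 \<and> (\<forall>x. x \<noteq> 0 \<longrightarrow> (\<exists>i::nat. x = g ^ i))"
    using finite_field_generator[where 'a = 'a] by (elim exE)
  then have g: "g \<noteq> 0" "\<And>x. x \<noteq> 0 \<Longrightarrow> \<exists>i::nat. x = g ^ i"
    by simp_all
  have field: "prime_power_field p s g"
    by (rule prime_power_field.intro[OF p s _ g]) (simp_all add: card q)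
  \<comment> \<open>The locale takes the exponent \<open>m + 1\<close> of the hypothesis on
    \<open>q - 1\<close>; its own constant \<open>m\<close> is one less and agrees with the given
    \<open>m\<close>.\<close>
  interpret K: field_two_power p s g "Suc m"
    by (intro field_two_power.intro field_mod8.intro field field_mod8_axioms.intro field_two_power_axioms.intro)
      (use p8 m dvd in \<open>auto simp: prime_power_field.q_def[OF field] q\<close>)
  have Km: "K.m = m" by (simp add: K.m_def)
  have Kq: "K.q = q" by (simp add: K.q_def q)
  have p0: "real p > 0" using prime_gt_0_nat[OF p] by simp
  have G: "K.gauss_form r (A r) (B r) \<or> K.gauss_form r (A r) (- B r)" if r: "3 \<le> r" "r \<le> m" for r
  proof -
    have 1: "real p powr (real s / 2 ^ (r-2)) = real_of_int ((A r)^2 + 2 * (B r)^2)" "[A r = -1] (mod 4)" "\<not> int p dvd A r"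
      using AB[of r] r by auto
    have "real p powr (real s / 2 ^ (r-2)) = real p ^ (2 * K.l r)"
      using K.s_div_l[of r] r p0 by (simp add: Km powr_realpow del: of_nat_mult)
    then have "real_of_int ((A r)^2 + 2 * (B r)^2) = real_of_int (int p ^ (2 * K.l r))" using 1 by simp
    then have 2: "(A r)^2 + 2 * (B r)^2 = int p ^ (2 * K.l r)" using of_int_eq_iff by blast
    have 3: "A r mod 4 = 3" using 1(2) by (simp add: cong_def)
    show ?thesis unfolding K.gauss_form_def using K.Gr_eq[of r, OF _ _ 2 3 1(3)] r by simp
  qed
  define V where "V = K.V A B"
  define S where "S k = - 3 * K.rt + (\<Sum>r=3..k. 2^(r-1) * K.p_part r * A r)" for k
  have Ss: "Ssum Q A k = S k" if "k \<le> m" for k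
  proof -
    have "(\<Sum>r=3..k. 2^(r-1) * K.p_part r * A r) = (\<Sum>r=3..k. 2^(r-1) * real_of_int (A r) * Q powr ((2^(r-2) - 1) / 2^(r-1)))"
      using that by (intro sum.cong refl) (simp add: K.p_part_powr Km Kq Q_def)
    then show ?thesis unfolding Ssum_def S_def K.rt_powr Kq Q_def by simp
  qed
  have p_part: "K.p_part r = Q powr ((2^(r-2) - 1) / 2^(r-1))" if "3 \<le> r" "r \<le> m" for r
    using K.p_part_powr[of r] that by (simp add: Km Kq Q_def)
  have rt: "K.rt = Q powr (1/2)" using K.rt_powr by (simp add: Kq Q_def)
  have PP3: "K.p_part 3 = Q powr (1/4)" using p_part[of 3] m by simp
  have V_eq: "V t sg = (if t < 2 then K.rt else S t) - (if 2 \<le> t then 2^t * K.p_part (t+1) * A (t+1) else 0)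
      - (if t + 3 \<le> m then sg * (2^(t+2) * K.p_part (t+3) * B (t+3)) else 0)" if "t < m" for t sg
    using K.V_eq[of t A B sg] that unfolding V_def S_def Km by simp
  define W where "W t = (if t + 3 \<le> m then 2^(m - t - 2) * (V t 1 ^ n + V t (-1) ^ n) else 2^(m - t - 1) * V t 0 ^ n)" for t
  have main: "real N = Q ^ (n-1) + (Q - 1) / (2^m * Q) * (S m ^ n + (\<Sum>t<m. W t))"
    using K.solutions_real[OF n, of A B] G unfolding Km Kq N_def Q_def W_def V_def S_def by blast
  show ?thesis
  proof (intro conjI impI)
    assume m3: "m = 3"
    \<comment> \<open>For \<open>m = 3\<close> only valuation 0 leaves room for a \<open>B\<close>
      term. Valuation 1 yields the bare power of \<open>rt\<close>, and the two powers with
      \<open>A 3\<close> come from valuation 2 and from index 0.\<close>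
    have W: "(\<Sum>t<m. W t) = W 0 + W 1 + W 2" unfolding m3 by (simp add: eval_nat_numeral)
    have W0: "W 0 = 2 * ((Q powr (1/2) + 4 * B 3 * Q powr (1/4)) ^ n + (Q powr (1/2) - 4 * B 3 * Q powr (1/4)) ^ n)"
      unfolding W_def rt[symmetric] PP3[symmetric] using V_eq[of 0] m3 by (simp add: mult_ac add_ac)
    have W1: "W 1 = 2 * Q powr (real n / 2)"
    proof -
      have "K.rt ^ n = Q powr (real n / 2)"
        using K.q_gt_1 by (simp add: rt Kq Q_def powr_power)
      then show ?thesis unfolding W_def using V_eq[of 1] m3 by simp
    qed
    have W2: "W 2 = (-3 * Q powr (1/2) - 4 * A 3 * Q powr (1/4)) ^ n"
      unfolding W_def rt[symmetric] PP3[symmetric] using V_eq[of 2] m3 by (simp add: S_def mult_ac)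
    have Sm: "S m = -3 * Q powr (1/2) + 4 * A 3 * Q powr (1/4)"
      unfolding rt[symmetric] PP3[symmetric] S_def m3 by simp
    have "(2::real)^m = 8" using m3 by simp
    then show "real N = Q ^ (n-1) + (Q - 1) / (8 * Q) *
       ( 2 * ((Q powr (1/2) + 4 * B 3 * Q powr (1/4)) ^ n
              + (Q powr (1/2) - 4 * B 3 * Q powr (1/4)) ^ n)
       + 2 * Q powr (real n / 2)
       + (-3 * Q powr (1/2) + 4 * A 3 * Q powr (1/4)) ^ n
       + (-3 * Q powr (1/2) - 4 * A 3 * Q powr (1/4)) ^ n)"
      unfolding main W W0 W1 W2 Sm by (simp only: add_ac)
  next
    assume m4: "4 \<le> m"
    have PP4: "K.p_part 4 = Q powr (3/8)" using p_part[of 4] m4 by simp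
    \<comment> \<open>Valuations 0 and 1 have main term \<open>rt\<close> and no \<open>A\<close>;
      \<open>2..m-3\<close> carry both kinds of terms; at \<open>m-2\<close> and \<open>m-1\<close>
      the index \<open>t + 3\<close> of \<open>B\<close> exceeds \<open>m\<close>. Index 0 supplies
      the remaining power of \<open>S m\<close>.\<close>
    have "{..<m} = insert (m-1) (insert (m-2) (insert 1 (insert 0 {2..m-3})))" using m4 by auto
    moreover have "m - 1 \<notin> insert (m-2) (insert 1 (insert 0 {2..m-3}))" "m - 2 \<notin> insert 1 (insert 0 {2..m-3})"
      "1 \<notin> insert 0 {2..m-3}" "0 \<notin> {2..m-3}" using m4 by auto
    ultimately have "(\<Sum>t<m. W t) = W 0 + W 1 + (\<Sum>t=2..m-3. W t) + W (m-2) + W (m-1)"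
      by (simp only: sum.insert finite_insert finite_atLeastAtMost not_False_eq_True add_ac)
    moreover have "W 0 = 2^(m-2) * ((K.rt + 4 * B 3 * K.p_part 3) ^ n + (K.rt - 4 * B 3 * K.p_part 3) ^ n)"
      unfolding W_def using V_eq[of 0] m4 by (simp add: mult_ac add_ac)
    moreover have "W 1 = 2^(m-3) * ((K.rt + 8 * B 4 * K.p_part 4) ^ n + (K.rt - 8 * B 4 * K.p_part 4) ^ n)"
      unfolding W_def using V_eq[of 1] m4 by (simp add: mult_ac add_ac eval_nat_numeral)
    moreover have "(\<Sum>t=2..m-3. W t) = (\<Sum>t=2..m-3. 2^(m-t-2) *
            ((Ssum Q A t - 2^t * A (t+1) * Q powr ((2^(t-1) - 1) / 2^t)
                 + 2^(t+2) * B (t+3) * Q powr ((2^(t+1) - 1) / 2^(t+2))) ^ n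
           + (Ssum Q A t - 2^t * A (t+1) * Q powr ((2^(t-1) - 1) / 2^t)
                 - 2^(t+2) * B (t+3) * Q powr ((2^(t+1) - 1) / 2^(t+2))) ^ n))"
    proof (rule sum.cong[OF refl])
      fix t assume t: "t \<in> {2..m-3}"
      have t': "2 \<le> t" "t + 3 \<le> m" "t < m" "\<not> t < 2" using t m4 by auto
      have e: "t + 1 - 2 = t - 1" "t + 1 - 1 = t" "t + 3 - 2 = t + 1" "t + 3 - 1 = t + 2" by auto
      have P1: "K.p_part (t+1) = Q powr ((2^(t-1) - 1) / 2^t)" using p_part[of "t+1"] t' unfolding e by simp
      have P3: "K.p_part (t+3) = Q powr ((2^(t+1) - 1) / 2^(t+2))" using p_part[of "t+3"] t' unfolding e by simp
      have S: "Ssum Q A t = S t" using Ss t' by simp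
      have "V t 1 = S t - 2^t * A (t+1) * K.p_part (t+1) - 2^(t+2) * B (t+3) * K.p_part (t+3)"
        "V t (-1) = S t - 2^t * A (t+1) * K.p_part (t+1) + 2^(t+2) * B (t+3) * K.p_part (t+3)"
        unfolding V_eq[OF t'(3)] using t' by (simp_all add: mult_ac)
      then show "W t = 2^(m-t-2) *
            ((Ssum Q A t - 2^t * A (t+1) * Q powr ((2^(t-1) - 1) / 2^t)
                 + 2^(t+2) * B (t+3) * Q powr ((2^(t+1) - 1) / 2^(t+2))) ^ n
           + (Ssum Q A t - 2^t * A (t+1) * Q powr ((2^(t-1) - 1) / 2^t)
                 - 2^(t+2) * B (t+3) * Q powr ((2^(t+1) - 1) / 2^(t+2))) ^ n)"
        unfolding W_def S P1 P3 using t'(2) by (simp add: add.commute)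
    qed
    moreover have "W (m-2) = 2 * (Ssum Q A (m-2) - 2^(m-2) * A (m-1) * Q powr ((2^(m-3) - 1) / 2^(m-2))) ^ n"
    proof -
      have e: "m - 2 + 1 = m - 1" "m - 1 - 2 = m - 3" "m - 1 - 1 = m - 2" "m - (m - 2) - 1 = 1" using m4 by auto
      have P1: "K.p_part (m-1) = Q powr ((2^(m-3) - 1) / 2^(m-2))" using p_part[of "m-1"] m4 unfolding e by simp
      have S: "Ssum Q A (m-2) = S (m-2)" using Ss by simp
      have "\<not> m - 2 < 2" "2 \<le> m - 2" using m4 by auto
      then have "V (m-2) 0 = S (m-2) - 2^(m-2) * A (m-1) * K.p_part (m-1)"
        using V_eq[of "m-2" 0] m4 unfolding e by (simp add: mult_ac)
      moreover have "\<not> m - 2 + 3 \<le> m" using m4 by simp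
      ultimately show ?thesis unfolding W_def e S P1 by simp
    qed
    moreover have "W (m-1) = (Ssum Q A (m-1) - 2^(m-1) * A m * Q powr ((2^(m-2) - 1) / 2^(m-1))) ^ n"
    proof -
      have e: "m - 1 + 1 = m" "m - (m - 1) - 1 = 0" using m4 by auto
      have P1: "K.p_part m = Q powr ((2^(m-2) - 1) / 2^(m-1))" using p_part[of m] m4 by simp
      have S: "Ssum Q A (m-1) = S (m-1)" using Ss by simp
      have "\<not> m - 1 < 2" "2 \<le> m - 1" using m4 by auto
      then have "V (m-1) 0 = S (m-1) - 2^(m-1) * A m * K.p_part m"
        using V_eq[of "m-1" 0] m4 unfolding e by (simp add: mult_ac)
      moreover have "\<not> m - 1 + 3 \<le> m" using m4 by simp
      ultimately show ?thesis unfolding W_def e S P1 by simp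
    qed
    moreover have "S m = Ssum Q A m" using Ss by simp
    ultimately show "real N = Q ^ (n-1) + (Q - 1) / (2^m * Q) *
       ( 2^(m-2) * ((Q powr (1/2) + 4 * B 3 * Q powr (1/4)) ^ n
                  + (Q powr (1/2) - 4 * B 3 * Q powr (1/4)) ^ n)
       + 2^(m-3) * ((Q powr (1/2) + 8 * B 4 * Q powr (3/8)) ^ n
                  + (Q powr (1/2) - 8 * B 4 * Q powr (3/8)) ^ n)
       + (\<Sum>t=2..m-3. 2^(m-t-2) *
            ((Ssum Q A t - 2^t * A (t+1) * Q powr ((2^(t-1) - 1) / 2^t)
                 + 2^(t+2) * B (t+3) * Q powr ((2^(t+1) - 1) / 2^(t+2))) ^ n
           + (Ssum Q A t - 2^t * A (t+1) * Q powr ((2^(t-1) - 1) / 2^t)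
                 - 2^(t+2) * B (t+3) * Q powr ((2^(t+1) - 1) / 2^(t+2))) ^ n))
       + 2 * (Ssum Q A (m-2) - 2^(m-2) * A (m-1) * Q powr ((2^(m-3) - 1) / 2^(m-2))) ^ n
       + (Ssum Q A (m-1) - 2^(m-1) * A m * Q powr ((2^(m-2) - 1) / 2^(m-1))) ^ n
       + (Ssum Q A m) ^ n)"
      unfolding main rt PP3 PP4 by (simp only: add_ac)
  qed
qed

end
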